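(* Let $L$ be a Legendrian knot in standard contact $\mathbb{R}^3$ whose front projection is nearly plat, and let $\mathcal{C}^{+}$ and $\mathcal{C}^{-}$ be Morse complex sequences (MCSs) for $L$. If $\mathcal{C}^{+}$ and $\mathcal{C}^{-}$ are equivalent, then the linearized complexes $(A_{\mathcal{C}^{+}},d_1^{+})$ and $(A_{\mathcal{C}^{-}},d_1^{-})$ are isomorphic.
   Context: **Fronts.** The contact structure on $\mathbb{R}^3$ is $\ker(dz-y\,dx)$; the front projection is the projection to the $xz$-plane, with singularities only transverse crossings and semicubical cusps. A front is in plat position if all left cusps have the same $x$-coordinate, all right cusps have the same $x$-coordinate, and no two crossings have the same $x$-coordinate; it is nearly plat if it is obtained by slightly perturbing a plat front so that the cusps have distinct $x$-coordinates. A Maslov potential is a map $\mu:L\to\mathbb{Z}$, constant except at cusps, where the value on the upper strand is one more than the value on the lower strand; one is fixed (rotation number $0$). Along a vertical line the strands of $L$ are numbered $1,2,\dots$ from top to bottom. $\langle\cdot,\cdot\rangle$ is the pairing for which the given basis is orthonormal. Let $Q(L)$ be the set of crossings and right cusps; a right cusp has degree $1$, and a crossing has degree $\mu(T)-\mu(B)$, where $T,B$ are the crossing strands and $T$ has smaller slope. **MCS.** A handleslide mark is a vertical segment in the $xz$-plane connecting two strands of $L$ with equal Maslov potential, missing crossings and cusps. An MCS $\mathcal{C}=(\{(C_m,\delta_m)\},\{x_m\},H)$ consists of values $x_1<\dots<x_M$, $\mathbb{Z}$-graded complexes $(C_m,\delta_m)$ of $\mathbb{Z}_2$-vector spaces ($1\le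 m\le M$), and a collection $H$ of handleslide marks such that: (1) each line $x=x_m$ meets $L$, misses crossings, cusps and handleslide marks, and these lines cut $L$ into pieces each containing exactly one crossing, left cusp, right cusp or handleslide mark (put $x_{M+1}=+\infty$); (2) $C_m$ has basis the points $e_1,e_2,\dots$ of $L\cap\{x=x_m\}$ numbered from top to bottom, with $|e_i|=\mu(e_i)$; (3) $\delta_m$ has degree $-1$ and $\delta_m e_i=\sum_{j>i}c_{ij}e_j$, $c_{ij}\in\mathbb{Z}_2$; (4) if a crossing or cusp between strands $k,k+1$ lies in $x_m\le x\le x_{m+1}$, then $\langle\delta_{m+1}e_k,e_{k+1}\rangle=1$ for a left cusp, $\langle\delta_m e_k,e_{k+1}\rangle=1$ for a right cusp, $\langle\delta_m e_k,e_{k+1}\rangle=0$ for a crossing; and $\langle\delta_1e_1,e_2\rangle=1$; (5) consecutive complexes are related as follows. (a) Crossing of strands $k,k+1$: the linear map $C_m\to C_{m+1}$ interchanging the indices $k$ and $k+1$ and fixing the other $e_i$ is an isomorphism of complexes. (b) Left cusp with strands $k,k+1$: the map $e_i\mapsto[e_i]$ for $i<k$, $e_i\mapsto[e_{i+2}]$ for $i\ge k$ is an isomorphism from $(C_m,\delta_m)$ to the quotient of $(C_{m+1},\delta_{m+1})$ by the subcomplex spanned by $\{e_k,\delta_{m+1}e_k\}$. (c) Right cusp: as in (b) with the roles of $m$ and $m+1$ reversed. (d) Handleslide mark between strands $k<l$: the map $h_{k,l}:C_m\to C_{m+1}$, $e_k\mapsto e_k+e_l$, $e_i\mapsto e_i$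 for $i\ne k$, is an isomorphism of complexes. **Marked fronts.** The marks in $H$ are called explicit. In addition, at a left (resp. right) cusp with strands $k,k+1$ one records implicit handleslide marks immediately to the right (resp. left) of the cusp: one from $i$ to $k$ for each $i<k$ with $\langle\delta e_i,e_{k+1}\rangle=1$, and one from $k+1$ to $j$ for each $j>k+1$ with $\langle\delta e_k,e_j\rangle=1$, where $\delta$ is the differential of the complex on the side of the cusp containing the two cusp strands. The order of implicit marks at a cusp is irrelevant. An MCS is uniquely determined by its collection of explicit and implicit marks. **Equivalence.** Two MCSs for $L$ are equivalent if they are joined by a finite sequence of MCSs, consecutive ones being related by one of the following moves, or its inverse or reflection about a horizontal or vertical axis; each changes the marks only in a small vertical strip. Write $(k,l)$, $k<l$, for a mark between strands $k$ and $l$. (Move 1) Insert or remove two consecutive explicit marks with the same endpoints. (Moves 2–5) Interchange consecutive explicit marks $(k,l)$ and $(k',l')$ with $l\ne k'$ and $k\ne l'$. (Move 6) Replace consecutive explicit marks, read from left to right, $(k,l),(l,m)$ by $(l,m),(k,m),(k,l)$. (Moves 7, 8, 10) Push an explicit mark through an adjacent crossing, its endpoints following the strands of $L$, provided the mark does not connect the two crossing strands. (Moves 9, 11, 12) Push an explicit mark past a cusp, from one side of the cusp together with its implicit marks to the other, where neither endpoint of the mark is on a cusp strand and its endpoints follow the strands of $L$. The implicit marks do not change, except as follows, where the strands are numbered on the side containing the cusp strands $k,k+1$ and the explicit mark is $(i,j)$: if $j<k$ and there is an implicit mark $(j,k)$, then the implicit mark $(i,k)$ is toggled (added if absent, deleted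 if present); if $i>k+1$ and there is an implicit mark $(k+1,i)$, then the implicit mark $(k+1,j)$ is toggled. (Moves 13, 14) If an explicit mark of the form $(i,k)$ with $i<k$, or $(k+1,j)$ with $j>k+1$, is adjacent to the implicit marks of a cusp with strands $k,k+1$, delete it and toggle the implicit mark with the same endpoints. (Move 15) Suppose that for some $p$ there are generators $e_i,e_j\in C_p$ with $i<j$ and $|e_i|=|e_j|-1$. Let $e_{u_1},\dots,e_{u_r}$ be the generators with $\langle\delta_pe_{u},e_i\rangle=1$ and $e_{v_1},\dots,e_{v_s}$ those with $\langle\delta_pe_j,e_{v}\rangle=1$, and assume $r+s>0$. Insert immediately to the right of $x_p$ the $r+s$ consecutive explicit marks $(u_1,j),\dots,(u_r,j),(i,v_1),\dots,(i,v_s)$; the complexes outside the strip containing them are unchanged. **Chord paths.** A chord $(x_0,[i,j])$, $i<j$, is the vertical segment at $x=x_0$ from strand $i$ to strand $j$. For $a\in Q(L)$ and a crossing $b$, a chord path from $a$ to $b$ is a finite sequence of chords $\Lambda=(\lambda_1,\dots,\lambda_n)$ such that: (i) the $x$-values of the $\lambda_r$ belong to $\{x_m\}$, and the $x$-value of $\lambda_{r+1}$ is the element of $\{x_m\}$ immediately to the left of that of $\lambda_r$; (ii) if $a$ lies between $x_l$ and $x_{l+1}$ and involves strands $k,k+1$, then $\lambda_1=(x_l,[k,k+1])$; (iii) if $b$ lies between $x_p$ and $x_{p+1}$ and involves strands $k,k+1$, then either $\lambda_n=(x_{p+1},[i,k])$ with $\langle\delta_p e_i,e_k\rangle=1$,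 or $\lambda_n=(x_{p+1},[k+1,j])$ with $\langle\delta_pe_{k+1},e_j\rangle=1$; (iv) if $\lambda_r=(x_{m+1},[i,j])$ and $\lambda_{r+1}=(x_m,[i',j'])$, $1\le r<n$, then, according to what lies between $x_m$ and $x_{m+1}$: for a crossing of strands $k,k+1$, $[i,j]\ne[k,k+1]$ and $i'=\sigma(i)$, $j'=\sigma(j)$ with $\sigma=(k\ k{+}1)$; a left cusp does not occur since the front is nearly plat; for a right cusp with strands $k,k+1$, $i'=\tau(i)$, $j'=\tau(j)$, where $\tau(l)=l$ for $l<k$ and $\tau(l)=l+2$ for $l\ge k$; for an explicit handleslide mark between strands $k<l$, $(i',j')=(i,j)$, or, if $i=k$ and $l<j$, also $(i',j')=(l,j)$ is allowed, or, if $j=l$ and $i<k$, also $(i',j')=(i,k)$ is allowed. $\mathcal{M}^{\mathcal{C}}(a;b)$ is the set of chord paths from $a$ to $b$. **Linearized complex.** $A_{\mathcal{C}}$ is the graded $\mathbb{Z}_2$-vector space with basis $Q(L)$, and $d_1a=\sum_{b:\,|b|=|a|-1}\#\mathcal{M}^{\mathcal{C}}(a;b)\,b$, with $\#$ the count mod $2$; one has $d_1^2=0$. For $\mathcal{C}^{\pm}$ this differential is denoted $d_1^{\pm}$. Isomorphic means isomorphic as graded chain complexes. *)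

theory Defs
  imports "HOL-Analysis.Analysis" "HOL-Library.Z2" "HOL-Combinatorics.Transposition"
begin

section \<open>Based graded complexes over the field with two elements\<close>

text \<open>A vector of the space with basis \<^term>\<open>basis K\<close> is its family of coordinates; the
  pairing of \<^term>\<open>v\<close> with the basis vector of \<^term>\<open>a\<close> is \<^term>\<open>v a\<close>.\<close>

record 'a based_complex =
  basis :: "'a set"
  degr :: "'a \<Rightarrow> int"
  bd :: "('a \<Rightarrow> bit) \<Rightarrow> ('a \<Rightarrow> bit)"

definition chains :: "'a based_complex \<Rightarrow> ('a \<Rightarrow> bit) set" where
  "chains K = {v. \<forall>a. v a \<noteq> 0 \<longrightarrow> a \<in> basis K}"

definition homogeneous :: "'a based_complex \<Rightarrow> int \<Rightarrow> ('a \<Rightarrow> bit) \<Rightarrow> bool" where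
  "homogeneous K d v \<longleftrightarrow> v \<in> chains K \<and> (\<forall>a. v a \<noteq> 0 \<longrightarrow> degr K a = d)"

definition gen :: "'a \<Rightarrow> 'a \<Rightarrow> bit" where
  "gen a = (\<lambda>b. if b = a then 1 else 0)"

definition linear_ext :: "'a set \<Rightarrow> ('a \<Rightarrow> 'b \<Rightarrow> bit) \<Rightarrow> ('a \<Rightarrow> bit) \<Rightarrow> 'b \<Rightarrow> bit" where
  "linear_ext B f v = (\<lambda>b. \<Sum>a\<in>B. v a * f a b)"

definition linear_on_chains ::
    "'a based_complex \<Rightarrow> (('a \<Rightarrow> bit) \<Rightarrow> ('b \<Rightarrow> bit)) \<Rightarrow> bool" where
  "linear_on_chains K f \<longleftrightarrow>
     (\<forall>v \<in> chains K. \<forall>w \<in> chains K. \<forall>c. f (\<lambda>a. c * v a + w a) = (\<lambda>b. c * f v b + f w b))"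

definition chain_complex :: "'a based_complex \<Rightarrow> bool" where
  "chain_complex K \<longleftrightarrow>
     linear_on_chains K (bd K) \<and>
     (\<forall>d v. homogeneous K d v \<longrightarrow> homogeneous K (d - 1) (bd K v)) \<and>
     (\<forall>v \<in> chains K. bd K (bd K v) = (\<lambda>a. 0))"

definition complex_iso ::
    "'a based_complex \<Rightarrow> 'b based_complex \<Rightarrow> (('a \<Rightarrow> bit) \<Rightarrow> ('b \<Rightarrow> bit)) \<Rightarrow> bool" where
  "complex_iso K K' f \<longleftrightarrow>
     linear_on_chains K f \<and>
     bij_betw f (chains K) (chains K') \<and>
     (\<forall>d v. homogeneous K d v \<longrightarrow> homogeneous K' d (f v)) \<and>
     (\<forall>v \<in> chains K. f (bd K v) = bd K' (f v))"

definition isomorphic_complexes :: "'a based_complex \<Rightarrow> 'b based_complex \<Rightarrow> bool" where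
  "isomorphic_complexes K K' \<longleftrightarrow> (\<exists>f. complex_iso K K' f)"

definition coset :: "('a \<Rightarrow> bit) set \<Rightarrow> ('a \<Rightarrow> bit) \<Rightarrow> ('a \<Rightarrow> bit) set" where
  "coset S v = {(\<lambda>a. v a + s a) | s. s \<in> S}"

text \<open>For a subcomplex \<^term>\<open>S\<close> of \<^term>\<open>K'\<close>: the map sending \<^term>\<open>v\<close> to the class of
  \<^term>\<open>f v\<close> is an isomorphism of graded complexes from \<^term>\<open>K\<close> to the quotient of
  \<^term>\<open>K'\<close> by \<^term>\<open>S\<close>.\<close>

definition quotient_iso ::
    "'a based_complex \<Rightarrow> 'b based_complex \<Rightarrow> ('b \<Rightarrow> bit) set
      \<Rightarrow> (('a \<Rightarrow> bit) \<Rightarrow> ('b \<Rightarrow> bit)) \<Rightarrow> bool" where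
  "quotient_iso K K' S f \<longleftrightarrow>
     linear_on_chains K f \<and>
     bij_betw (\<lambda>v. coset S (f v)) (chains K) (coset S ` chains K') \<and>
     (\<forall>d v. homogeneous K d v \<longrightarrow> homogeneous K' d (f v)) \<and>
     (\<forall>v \<in> chains K. coset S (f (bd K v)) = coset S (bd K' (f v)))"

definition gen_bd_span :: "'a based_complex \<Rightarrow> 'a \<Rightarrow> ('a \<Rightarrow> bit) set" where
  "gen_bd_span K a = {(\<lambda>b. s * gen a b + t * bd K (gen a) b) | s t. True}"


section \<open>Legendrian knots and their fronts\<close>

type_synonym space_curve = "real \<Rightarrow> real \<times> real \<times> real"

definition cx :: "space_curve \<Rightarrow> real \<Rightarrow> real" where "cx \<gamma> t = fst (\<gamma> t)"
definition cy :: "space_curve \<Rightarrow> real \<Rightarrow> real" where "cy \<gamma> t = fst (snd (\<gamma> t))"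
definition cz :: "space_curve \<Rightarrow> real \<Rightarrow> real" where "cz \<gamma> t = snd (snd (\<gamma> t))"

definition smooth_fun :: "(real \<Rightarrow> real) \<Rightarrow> bool" where
  "smooth_fun f \<longleftrightarrow> (\<forall>n. (deriv ^^ n) f differentiable_on UNIV)"

text \<open>The knot is the image of \<^term>\<open>\<gamma>\<close>, which is a smooth embedding of the circle of
  length 1, tangent to the kernel of \<open>dz - y dx\<close>.\<close>

definition legendrian_knot :: "space_curve \<Rightarrow> bool" where
  "legendrian_knot \<gamma> \<longleftrightarrow>
     smooth_fun (cx \<gamma>) \<and> smooth_fun (cy \<gamma>) \<and> smooth_fun (cz \<gamma>) \<and>
     (\<forall>t. \<gamma> (t + 1) = \<gamma> t) \<and>
     (\<forall>s t. \<gamma> s = \<gamma> t \<longrightarrow> s - t \<in> \<int>) \<and>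
     (\<forall>t. (deriv (cx \<gamma>) t, deriv (cy \<gamma>) t, deriv (cz \<gamma>) t) \<noteq> (0, 0, 0)) \<and>
     (\<forall>t. deriv (cz \<gamma>) t = cy \<gamma> t * deriv (cx \<gamma>) t)"

definition front_proj :: "real \<times> real \<times> real \<Rightarrow> real \<times> real" where
  "front_proj p = (fst p, snd (snd p))"

definition front :: "space_curve \<Rightarrow> (real \<times> real) set" where
  "front \<gamma> = front_proj ` range \<gamma>"

definition cusp_param :: "space_curve \<Rightarrow> real \<Rightarrow> bool" where
  "cusp_param \<gamma> t \<longleftrightarrow> deriv (cx \<gamma>) t = 0 \<and> deriv (cz \<gamma>) t = 0"

text \<open>At a semicubical cusp \<open>x\<close> has a nondegenerate critical point: a minimum at a left
  cusp and a maximum at a right cusp.\<close>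

definition left_cusps :: "space_curve \<Rightarrow> (real \<times> real) set" where
  "left_cusps \<gamma> = {front_proj (\<gamma> t) | t. cusp_param \<gamma> t \<and> (deriv ^^ 2) (cx \<gamma>) t > 0}"

definition right_cusps :: "space_curve \<Rightarrow> (real \<times> real) set" where
  "right_cusps \<gamma> = {front_proj (\<gamma> t) | t. cusp_param \<gamma> t \<and> (deriv ^^ 2) (cx \<gamma>) t < 0}"

definition crossings :: "space_curve \<Rightarrow> (real \<times> real) set" where
  "crossings \<gamma> = {front_proj (\<gamma> t) | s t. s - t \<notin> \<int> \<and> front_proj (\<gamma> s) = front_proj (\<gamma> t)}"

text \<open>The only singularities of the front are transverse double points and semicubical
  cusps (second and third derivatives linearly independent).  Transversality also rules out
  a cusp lying on another branch of the front.\<close>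

definition generic_front :: "space_curve \<Rightarrow> bool" where
  "generic_front \<gamma> \<longleftrightarrow>
     (\<forall>t. cusp_param \<gamma> t \<longrightarrow>
        (deriv ^^ 2) (cx \<gamma>) t * (deriv ^^ 3) (cz \<gamma>) t
        \<noteq> (deriv ^^ 3) (cx \<gamma>) t * (deriv ^^ 2) (cz \<gamma>) t) \<and>
     (\<forall>s t. s - t \<notin> \<int> \<and> front_proj (\<gamma> s) = front_proj (\<gamma> t) \<longrightarrow>
        deriv (cx \<gamma>) s * deriv (cz \<gamma>) t \<noteq> deriv (cx \<gamma>) t * deriv (cz \<gamma>) s) \<and>
     (\<forall>r s t. front_proj (\<gamma> r) = front_proj (\<gamma> s) \<and> front_proj (\<gamma> s) = front_proj (\<gamma> t) \<longrightarrow>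
        r - s \<in> \<int> \<or> s - t \<in> \<int> \<or> r - t \<in> \<int>)"

text \<open>The position, from the top and starting with 1, of a point among the points of the
  front on its vertical line.  A crossing or cusp at position \<open>k\<close> involves the strands
  \<open>k\<close> and \<open>k + 1\<close>.\<close>

definition position :: "space_curve \<Rightarrow> real \<times> real \<Rightarrow> nat" where
  "position \<gamma> p = Suc (card {z. (fst p, z) \<in> front \<gamma> \<and> z > snd p})"

text \<open>Perturbing a plat front separates the \<open>x\<close>-coordinates of the left cusps (stacked on one
  vertical line, to the left of all crossings) and of the right cusps (stacked to the right of
  all crossings).  Since the cusps of a plat front are stacked and not nested, no cusp may lie
  between the two strands belonging to another cusp; this is the parity condition.\<close>

definition nearly_plat :: "space_curve \<Rightarrow> bool" where
  "nearly_plat \<gamma> \<longleftrightarrow>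
     generic_front \<gamma> \<and>
     inj_on fst (left_cusps \<gamma> \<union> crossings \<gamma> \<union> right_cusps \<gamma>) \<and>
     (\<forall>l \<in> left_cusps \<gamma>. \<forall>c \<in> crossings \<gamma>. fst l < fst c) \<and>
     (\<forall>c \<in> crossings \<gamma>. \<forall>r \<in> right_cusps \<gamma>. fst c < fst r) \<and>
     (\<forall>l \<in> left_cusps \<gamma>. \<forall>r \<in> right_cusps \<gamma>. fst l < fst r) \<and>
     (\<forall>p \<in> left_cusps \<gamma> \<union> right_cusps \<gamma>. odd (position \<gamma> p))"

text \<open>The value of a Maslov potential at a cusp point itself is irrelevant.\<close>

definition maslov_potential :: "space_curve \<Rightarrow> (real \<times> real \<times> real \<Rightarrow> int) \<Rightarrow> bool" where
  "maslov_potential \<gamma> \<mu> \<longleftrightarrow>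
     (\<forall>t. \<not> cusp_param \<gamma> t \<longrightarrow> (\<exists>\<epsilon>>0. \<forall>s. \<bar>s - t\<bar> < \<epsilon> \<longrightarrow> \<mu> (\<gamma> s) = \<mu> (\<gamma> t))) \<and>
     (\<forall>t. cusp_param \<gamma> t \<longrightarrow>
        (\<exists>\<epsilon>>0. \<forall>r s. 0 < \<bar>r - t\<bar> \<and> \<bar>r - t\<bar> < \<epsilon> \<and> 0 < \<bar>s - t\<bar> \<and> \<bar>s - t\<bar> < \<epsilon> \<and>
            cx \<gamma> r = cx \<gamma> s \<and> cz \<gamma> r > cz \<gamma> s \<longrightarrow> \<mu> (\<gamma> r) = \<mu> (\<gamma> s) + 1))"

text \<open>\<open>strands\<close>, \<open>strand_point\<close> and \<open>potential\<close> are only used on vertical lines missing the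
  crossings and cusps, where each point of the front lies on exactly one strand.\<close>

definition strands :: "space_curve \<Rightarrow> real \<Rightarrow> nat" where
  "strands \<gamma> x = card {z. (x, z) \<in> front \<gamma>}"

definition strand_point :: "space_curve \<Rightarrow> real \<Rightarrow> nat \<Rightarrow> real \<times> real \<times> real" where
  "strand_point \<gamma> x i = (THE p. p \<in> range \<gamma> \<and> fst p = x \<and> position \<gamma> (front_proj p) = i)"

definition potential ::
    "space_curve \<Rightarrow> (real \<times> real \<times> real \<Rightarrow> int) \<Rightarrow> real \<Rightarrow> nat \<Rightarrow> int" where
  "potential \<gamma> \<mu> x i = \<mu> (strand_point \<gamma> x i)"

definition QL :: "space_curve \<Rightarrow> (real \<times> real) set" where
  "QL \<gamma> = crossings \<gamma> \<union> right_cusps \<gamma>"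

text \<open>The slope of a strand of the front is the \<open>y\<close>-coordinate of the knot.\<close>

definition Q_degree ::
    "space_curve \<Rightarrow> (real \<times> real \<times> real \<Rightarrow> int) \<Rightarrow> real \<times> real \<Rightarrow> int" where
  "Q_degree \<gamma> \<mu> a =
     (if a \<in> right_cusps \<gamma> then 1
      else (THE d. \<exists>T \<in> range \<gamma>. \<exists>B \<in> range \<gamma>. front_proj T = a \<and> front_proj B = a \<and>
              fst (snd T) < fst (snd B) \<and> d = \<mu> T - \<mu> B))"


section \<open>Morse complex sequences\<close>

text \<open>A handleslide mark \<open>(x, i, j)\<close> joins the strands \<open>i < j\<close> on the vertical line through
  \<open>x\<close>.  The numbers \<open>dcoef C m i j\<close> are the coefficients of the differential of the \<open>m\<close>-th
  complex; \<open>line\<close> and \<open>dcoef\<close> are meaningful for indices from 1 to \<open>nlines\<close>.\<close>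

record mcs =
  nlines :: nat
  line :: "nat \<Rightarrow> real"
  dcoef :: "nat \<Rightarrow> nat \<Rightarrow> nat \<Rightarrow> bit"
  slides :: "(real \<times> nat \<times> nat) set"

datatype event = LeftCusp nat | RightCusp nat | Crossing nat | Slide nat nat

definition events :: "space_curve \<Rightarrow> mcs \<Rightarrow> (real \<times> event) set" where
  "events \<gamma> C =
     (\<lambda>p. (fst p, LeftCusp (position \<gamma> p))) ` left_cusps \<gamma> \<union>
     (\<lambda>p. (fst p, RightCusp (position \<gamma> p))) ` right_cusps \<gamma> \<union>
     (\<lambda>p. (fst p, Crossing (position \<gamma> p))) ` crossings \<gamma> \<union>
     (\<lambda>(x, i, j). (x, Slide i j)) ` slides C"

text \<open>Strip 0 lies to the left of all the lines, strip \<open>m\<close> between the lines \<open>m\<close> and \<open>m + 1\<close>,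
  and the last strip to the right of all the lines.\<close>

definition strip :: "mcs \<Rightarrow> nat \<Rightarrow> real set" where
  "strip C m =
     (if m = 0 then {..<line C 1}
      else if m < nlines C then {line C m<..<line C (Suc m)}
      else {line C m<..})"

definition strip_event :: "space_curve \<Rightarrow> mcs \<Rightarrow> nat \<Rightarrow> event" where
  "strip_event \<gamma> C m = snd (THE e. e \<in> events \<gamma> C \<and> fst e \<in> strip C m)"

definition mcs_lines :: "space_curve \<Rightarrow> mcs \<Rightarrow> bool" where
  "mcs_lines \<gamma> C \<longleftrightarrow>
     1 \<le> nlines C \<and>
     strict_mono_on {1..nlines C} (line C) \<and>
     (\<forall>m \<in> {1..nlines C}. (\<exists>z. (line C m, z) \<in> front \<gamma>) \<and> line C m \<notin> fst ` events \<gamma> C) \<and>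
     (\<forall>m \<le> nlines C. \<exists>!e. e \<in> events \<gamma> C \<and> fst e \<in> strip C m)"

text \<open>Marks on the vertical line of a crossing or cusp can be excluded since every piece
  contains only one of them.\<close>

definition handleslide_mark ::
    "space_curve \<Rightarrow> (real \<times> real \<times> real \<Rightarrow> int) \<Rightarrow> real \<times> nat \<times> nat \<Rightarrow> bool" where
  "handleslide_mark \<gamma> \<mu> = (\<lambda>(x, i, j).
     x \<notin> fst ` (left_cusps \<gamma> \<union> crossings \<gamma> \<union> right_cusps \<gamma>) \<and>
     1 \<le> i \<and> i < j \<and> j \<le> strands \<gamma> x \<and> potential \<gamma> \<mu> x i = potential \<gamma> \<mu> x j)"

definition strand_complex ::
    "space_curve \<Rightarrow> (real \<times> real \<times> real \<Rightarrow> int) \<Rightarrow> mcs \<Rightarrow> nat \<Rightarrow> nat based_complex" where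
  "strand_complex \<gamma> \<mu> C m =
     \<lparr>basis = {1..strands \<gamma> (line C m)},
      degr = potential \<gamma> \<mu> (line C m),
      bd = linear_ext {1..strands \<gamma> (line C m)} (dcoef C m)\<rparr>"

definition skip_cusp :: "nat \<Rightarrow> nat \<Rightarrow> nat" where
  "skip_cusp k i = (if i < k then i else i + 2)"

definition index_map :: "nat based_complex \<Rightarrow> (nat \<Rightarrow> nat) \<Rightarrow> (nat \<Rightarrow> bit) \<Rightarrow> (nat \<Rightarrow> bit)" where
  "index_map K f = linear_ext (basis K) (\<lambda>i. gen (f i))"

definition handleslide_map ::
    "nat based_complex \<Rightarrow> nat \<Rightarrow> nat \<Rightarrow> (nat \<Rightarrow> bit) \<Rightarrow> (nat \<Rightarrow> bit)" where
  "handleslide_map K k l =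
     linear_ext (basis K) (\<lambda>i. if i = k then (\<lambda>b. gen k b + gen l b) else gen i)"

text \<open>Here \<open>K\<close> and \<open>K'\<close> are the complexes to the left and to the right of the event.\<close>

fun consecutive :: "event \<Rightarrow> nat based_complex \<Rightarrow> nat based_complex \<Rightarrow> bool" where
  "consecutive (Crossing k) K K' = complex_iso K K' (index_map K (Transposition.transpose k (Suc k)))"
| "consecutive (LeftCusp k) K K' = quotient_iso K K' (gen_bd_span K' k) (index_map K (skip_cusp k))"
| "consecutive (RightCusp k) K K' = quotient_iso K' K (gen_bd_span K k) (index_map K' (skip_cusp k))"
| "consecutive (Slide k l) K K' = complex_iso K K' (handleslide_map K k l)"

definition is_mcs :: "space_curve \<Rightarrow> (real \<times> real \<times> real \<Rightarrow> int) \<Rightarrow> mcs \<Rightarrow> bool" where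
  "is_mcs \<gamma> \<mu> C \<longleftrightarrow>
     (\<forall>h \<in> slides C. handleslide_mark \<gamma> \<mu> h) \<and>
     mcs_lines \<gamma> C \<and>
     (\<forall>m \<in> {1..nlines C}.
        chain_complex (strand_complex \<gamma> \<mu> C m) \<and>
        (\<forall>i j. dcoef C m i j \<noteq> 0 \<longrightarrow> 1 \<le> i \<and> i < j \<and> j \<le> strands \<gamma> (line C m))) \<and>
     (\<forall>m \<in> {1..<nlines C}. \<forall>k. strip_event \<gamma> C m = LeftCusp k \<longrightarrow> dcoef C (Suc m) k (Suc k) = 1) \<and>
     (\<forall>m \<in> {1..nlines C}. \<forall>k. strip_event \<gamma> C m = RightCusp k \<longrightarrow> dcoef C m k (Suc k) = 1) \<and>
     (\<forall>m \<in> {1..<nlines C}. \<forall>k. strip_event \<gamma> C m = Crossing k \<longrightarrow> dcoef C m k (Suc k) = 0) \<and>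
     dcoef C 1 1 2 = 1 \<and>
     (\<forall>m \<in> {1..<nlines C}.
        consecutive (strip_event \<gamma> C m) (strand_complex \<gamma> \<mu> C m) (strand_complex \<gamma> \<mu> C (Suc m)))"


section \<open>Marked fronts and equivalence\<close>

definition implicit_at :: "(nat \<Rightarrow> nat \<Rightarrow> bit) \<Rightarrow> nat \<Rightarrow> (nat \<times> nat) set" where
  "implicit_at c k = {(i, k) | i. i < k \<and> c i (Suc k) = 1} \<union> {(Suc k, j) | j. Suc k < j \<and> c k j = 1}"

definition implicit_marks :: "space_curve \<Rightarrow> mcs \<Rightarrow> nat \<Rightarrow> (nat \<times> nat) set" where
  "implicit_marks \<gamma> C m =
     (case strip_event \<gamma> C m of
        LeftCusp k \<Rightarrow> implicit_at (dcoef C (Suc m)) k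
      | RightCusp k \<Rightarrow> implicit_at (dcoef C m) k
      | _ \<Rightarrow> {})"

text \<open>The marked front, read from left to right: its crossings, cusps and explicit marks, each
  cusp together with its set of implicit marks (for crossings and explicit marks the set is
  empty).  The entry number \<open>m\<close>, counted from 0, belongs to strip \<open>m\<close>.  Marked fronts are
  thereby considered up to sliding marks horizontally without meeting crossings, cusps or other
  marks, and up to the choice of the vertical lines.\<close>

type_synonym marked_front = "(event \<times> (nat \<times> nat) set) list"

definition marked_front :: "space_curve \<Rightarrow> mcs \<Rightarrow> marked_front" where
  "marked_front \<gamma> C = map (\<lambda>m. (strip_event \<gamma> C m, implicit_marks \<gamma> C m)) [0..<Suc (nlines C)]"

abbreviation mark :: "nat \<Rightarrow> nat \<Rightarrow> event \<times> (nat \<times> nat) set" where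
  "mark i j \<equiv> (Slide i j, {})"

definition toggle :: "nat \<times> nat \<Rightarrow> (nat \<times> nat) set \<Rightarrow> (nat \<times> nat) set" where
  "toggle p I = (if p \<in> I then I - {p} else insert p I)"

definition pass_cusp :: "nat \<Rightarrow> nat \<Rightarrow> nat \<Rightarrow> (nat \<times> nat) set \<Rightarrow> (nat \<times> nat) set" where
  "pass_cusp k i j I =
     (if j < k \<and> (j, k) \<in> I then toggle (i, k) I
      else if Suc k < i \<and> (Suc k, i) \<in> I then toggle (Suc k, j) I
      else I)"

text \<open>The two marked fronts of a move inside the strip where they differ.  \<open>move6\<close> has as its
  reflection, about either axis, \<open>move6_reflected\<close>; the reflections of the other moves are again
  instances of these rules or of their inverses.  In the rules for passing a cusp, \<open>i\<close> and \<open>j\<close>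
  number the strands on the side without the two cusp strands.\<close>

inductive local_move :: "marked_front \<Rightarrow> marked_front \<Rightarrow> bool" where
  move1: "k < l \<Longrightarrow> local_move [] [mark k l, mark k l]"
| move2_5: "\<lbrakk>k < l; k' < l'; l \<noteq> k'; k \<noteq> l'\<rbrakk>
    \<Longrightarrow> local_move [mark k l, mark k' l'] [mark k' l', mark k l]"
| move6: "\<lbrakk>k < l; l < m\<rbrakk>
    \<Longrightarrow> local_move [mark k l, mark l m] [mark l m, mark k m, mark k l]"
| move6_reflected: "\<lbrakk>k < l; l < m\<rbrakk>
    \<Longrightarrow> local_move [mark l m, mark k l] [mark k l, mark k m, mark l m]"
| move7_8_10: "\<lbrakk>i < j; (i, j) \<noteq> (k, Suc k)\<rbrakk>
    \<Longrightarrow> local_move [mark i j, (Crossing k, {})]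
          [(Crossing k, {}), mark (Transposition.transpose k (Suc k) i) (Transposition.transpose k (Suc k) j)]"
| pass_right_cusp: "i < j
    \<Longrightarrow> local_move [mark (skip_cusp k i) (skip_cusp k j), (RightCusp k, I)]
          [(RightCusp k, pass_cusp k (skip_cusp k i) (skip_cusp k j) I), mark i j]"
| pass_left_cusp: "i < j
    \<Longrightarrow> local_move [(LeftCusp k, I), mark (skip_cusp k i) (skip_cusp k j)]
          [mark i j, (LeftCusp k, pass_cusp k (skip_cusp k i) (skip_cusp k j) I)]"
| absorb_right_cusp: "i < k \<and> j = k \<or> i = Suc k \<and> Suc k < j
    \<Longrightarrow> local_move [mark i j, (RightCusp k, I)] [(RightCusp k, toggle (i, j) I)]"
| absorb_left_cusp: "i < k \<and> j = k \<or> i = Suc k \<and> Suc k < j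
    \<Longrightarrow> local_move [(LeftCusp k, I), mark i j] [(LeftCusp k, toggle (i, j) I)]"

definition moves1_14 :: "marked_front \<Rightarrow> marked_front \<Rightarrow> bool" where
  "moves1_14 W W' \<longleftrightarrow> (\<exists>A B U U'. local_move U U' \<and> W = A @ U @ B \<and> W' = A @ U' @ B)"

text \<open>The reflection about either axis preserves the two families of marks of this move, but
  may interchange their order.  The entries left of line \<open>p\<close> of a marked front are the first
  \<open>p\<close> ones.\<close>

definition move15 ::
    "space_curve \<Rightarrow> (real \<times> real \<times> real \<Rightarrow> int) \<Rightarrow> mcs \<Rightarrow> mcs \<Rightarrow> bool" where
  "move15 \<gamma> \<mu> C C' \<longleftrightarrow>
     (\<exists>p i j us vs A B.
        1 \<le> p \<and> p \<le> nlines C \<and>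
        1 \<le> i \<and> i < j \<and> j \<le> strands \<gamma> (line C p) \<and>
        potential \<gamma> \<mu> (line C p) i = potential \<gamma> \<mu> (line C p) j - 1 \<and>
        distinct us \<and> set us = {u. dcoef C p u i = 1} \<and>
        distinct vs \<and> set vs = {v. dcoef C p j v = 1} \<and>
        length us + length vs > 0 \<and>
        marked_front \<gamma> C = A @ B \<and> length A = p \<and>
        (marked_front \<gamma> C' = A @ map (\<lambda>u. mark u j) us @ map (\<lambda>v. mark i v) vs @ B \<or>
         marked_front \<gamma> C' = A @ map (\<lambda>v. mark i v) vs @ map (\<lambda>u. mark u j) us @ B))"

text \<open>The first alternative identifies MCSs having the same marks.\<close>

definition mcs_step ::
    "space_curve \<Rightarrow> (real \<times> real \<times> real \<Rightarrow> int) \<Rightarrow> mcs \<Rightarrow> mcs \<Rightarrow> bool" where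
  "mcs_step \<gamma> \<mu> C C' \<longleftrightarrow>
     is_mcs \<gamma> \<mu> C \<and> is_mcs \<gamma> \<mu> C' \<and>
     (marked_front \<gamma> C = marked_front \<gamma> C' \<or>
      moves1_14 (marked_front \<gamma> C) (marked_front \<gamma> C') \<or>
      moves1_14 (marked_front \<gamma> C') (marked_front \<gamma> C) \<or>
      move15 \<gamma> \<mu> C C' \<or> move15 \<gamma> \<mu> C' C)"

definition mcs_equivalent ::
    "space_curve \<Rightarrow> (real \<times> real \<times> real \<Rightarrow> int) \<Rightarrow> mcs \<Rightarrow> mcs \<Rightarrow> bool" where
  "mcs_equivalent \<gamma> \<mu> = (mcs_step \<gamma> \<mu>)\<^sup>*\<^sup>*"


section \<open>Chord paths and the linearized complex\<close>

text \<open>The chord \<open>(m, i, j)\<close> is the vertical segment from strand \<open>i\<close> to strand \<open>j\<close> on the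
  \<open>m\<close>-th vertical line.\<close>

type_synonym chord = "nat \<times> nat \<times> nat"

definition mcs_chords :: "space_curve \<Rightarrow> mcs \<Rightarrow> chord set" where
  "mcs_chords \<gamma> C =
     {(m, i, j). 1 \<le> m \<and> m \<le> nlines C \<and> 1 \<le> i \<and> i < j \<and> j \<le> strands \<gamma> (line C m)}"

text \<open>How a chord \<open>[i, j]\<close> to the right of an event may continue to the left of it.\<close>

fun continues :: "event \<Rightarrow> nat \<times> nat \<Rightarrow> nat \<times> nat \<Rightarrow> bool" where
  "continues (Crossing k) (i, j) (i', j') \<longleftrightarrow>
     (i, j) \<noteq> (k, Suc k) \<and> i' = Transposition.transpose k (Suc k) i \<and> j' = Transposition.transpose k (Suc k) j"
| "continues (LeftCusp k) (i, j) (i', j') \<longleftrightarrow> False"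
| "continues (RightCusp k) (i, j) (i', j') \<longleftrightarrow> i' = skip_cusp k i \<and> j' = skip_cusp k j"
| "continues (Slide k l) (i, j) (i', j') \<longleftrightarrow>
     (i', j') = (i, j) \<or>
     i = k \<and> l < j \<and> (i', j') = (l, j) \<or>
     j = l \<and> i < k \<and> (i', j') = (i, k)"

definition chord_step :: "space_curve \<Rightarrow> mcs \<Rightarrow> chord \<Rightarrow> chord \<Rightarrow> bool" where
  "chord_step \<gamma> C = (\<lambda>(m', i, j) (m, i', j').
     m' = Suc m \<and> continues (strip_event \<gamma> C m) (i, j) (i', j'))"

definition chord_paths ::
    "space_curve \<Rightarrow> mcs \<Rightarrow> real \<times> real \<Rightarrow> real \<times> real \<Rightarrow> chord list set" where
  "chord_paths \<gamma> C a b =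
     {\<Lambda>. \<Lambda> \<noteq> [] \<and> set \<Lambda> \<subseteq> mcs_chords \<gamma> C \<and>
        (\<exists>l \<le> nlines C. fst a \<in> strip C l \<and> hd \<Lambda> = (l, position \<gamma> a, Suc (position \<gamma> a))) \<and>
        (\<exists>p \<le> nlines C. fst b \<in> strip C p \<and>
           (let k = position \<gamma> b in
              (\<exists>i. last \<Lambda> = (Suc p, i, k) \<and> dcoef C p i k = 1) \<or>
              (\<exists>j. last \<Lambda> = (Suc p, Suc k, j) \<and> dcoef C p (Suc k) j = 1))) \<and>
        (\<forall>r. Suc r < length \<Lambda> \<longrightarrow> chord_step \<gamma> C (\<Lambda> ! r) (\<Lambda> ! Suc r))}"

text \<open>Chord paths end at crossings only, so a right cusp never occurs in \<open>d1\<close>.\<close>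

definition d1_coef ::
    "space_curve \<Rightarrow> (real \<times> real \<times> real \<Rightarrow> int) \<Rightarrow> mcs \<Rightarrow> real \<times> real \<Rightarrow> real \<times> real \<Rightarrow> bit" where
  "d1_coef \<gamma> \<mu> C a b =
     (if b \<in> crossings \<gamma> \<and> Q_degree \<gamma> \<mu> b = Q_degree \<gamma> \<mu> a - 1
      then of_nat (card (chord_paths \<gamma> C a b)) else 0)"

definition linearized_complex ::
    "space_curve \<Rightarrow> (real \<times> real \<times> real \<Rightarrow> int) \<Rightarrow> mcs \<Rightarrow> (real \<times> real) based_complex" where
  "linearized_complex \<gamma> \<mu> C =
     \<lparr>basis = QL \<gamma>, degr = Q_degree \<gamma> \<mu>, bd = linear_ext (QL \<gamma>) (d1_coef \<gamma> \<mu> C)\<rparr>"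

end

theory Submission
  imports Defs
begin

text \<open>
  The linearized complex of an MCS is computed by reading its marked front once from left to
  right.  Let \<open>D\<close> be the strictly upper triangular matrix of the differential on the current
  vertical line, acting on row vectors.  For every crossing \<open>b\<close> that has been passed let \<open>\<Phi> b\<close> be
  the strictly upper triangular matrix whose entry \<open>(i, j)\<close> is the number, modulo 2, of chord
  paths from the chord \<open>[i, j]\<close> on the current line to \<open>b\<close>.  The rules for continuing chords say
  how these matrices change.  A handleslide with matrix \<open>H = 1 + E\<^bsub>kl\<^esub>\<close> conjugates all of them by
  \<open>H\<close>.  A crossing of the strands \<open>k\<close> and \<open>k + 1\<close> conjugates \<open>D\<close> by the transposition matrix,
  and likewise \<open>\<Phi> b\<close>, from which the entry that came from the chord \<open>[k, k + 1]\<close> is then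
  removed.  The end condition for chord paths gives \<open>\<Phi>\<close> of the new crossing as the commutator
  \<open>[D, E]\<close>, \<open>E = E\<^bsub>k+1,k\<^esub>\<close>.  The coefficient of \<open>b\<close> in \<open>d\<^sub>1 a\<close> is the entry \<open>(k, k + 1)\<close> of \<open>\<Phi> b\<close> on
  the line left of \<open>a\<close>.

  Regard \<open>\<Phi> = \<Sum>\<^sub>b \<Phi> b \<cdot> b\<close> as one matrix with coefficients in the space \<open>A\<close> spanned by the
  crossings.  Removing the entry \<open>Y\<^sub>k\<^sub>,\<^sub>k\<^sub>+\<^sub>1\<close> in transporting a matrix \<open>Y\<close> through a crossing makes
  the transport commute with the commutators \<open>[D, _]\<close> only up to \<open>Y\<^sub>k\<^sub>,\<^sub>k\<^sub>+\<^sub>1 [D, E]\<close> (lemma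
  \<open>comm_cross\<close>).  By induction along the front this yields \<open>d\<^sub>1 \<Phi> = [D, \<Phi>]\<close> (lemma
  \<open>reading_advance\<close>), which contains \<open>d\<^sub>1\<^sup>2 = 0\<close>, and the following principle, which is what the
  theorem rests on.  Suppose that at some line two readings have the same \<open>D\<close> and the same
  \<open>d\<^sub>1\<close>, and that there is a matrix \<open>Y\<close> with
  \<open>\<Phi>\<^sup>+ = \<Phi>\<^sup>- + [D, Y] + d\<^sub>1 Y\<close>.
  Continue both readings by the same events, transport \<open>Y\<close> with them, and put
  \<open>f a = a + Y\<^sub>k\<^sub>,\<^sub>k\<^sub>+\<^sub>1\<close> for each later generator \<open>a\<close> on the strands \<open>k, k + 1\<close>.  Then
  \<open>f(\<Phi>\<^sup>+) = \<Phi>\<^sup>- + [D, Y] + d\<^sub>1\<^sup>- Y\<close> persists (lemma \<open>equivalent_readings_advance\<close>); its entry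
  \<open>(k, k + 1)\<close>, where commutators of strictly upper triangular matrices vanish, says
  \<open>f d\<^sub>1\<^sup>+ a = d\<^sub>1\<^sup>- f a\<close>.  Being unitriangular, \<open>f\<close> is an isomorphism.

  Each move supplies such a \<open>Y\<close>.  Cancelling, exchanging or splitting explicit marks is a relation
  between elementary matrices, and a move at a left cusp does not change \<open>D\<close> behind it since
  \<open>D\<close> is determined by the complex in front of the cusp and the implicit marks (lemma
  \<open>left_cusp_rel_unique\<close>); here \<open>Y = 0\<close>.
  Pushing a mark through a crossing \<open>b\<close> gives \<open>Y = (E + H' E H') b\<close>, where \<open>H'\<close> is the matrix
  of the mark after the crossing (lemma \<open>close_slide_crossing\<close>).  The marks of \<open>move15\<close> conjugate
  by \<open>G = 1 + [D, K]\<close> with \<open>K\<close> a matrix unit, and the Jacobi identity together with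
  \<open>d\<^sub>1 \<Phi> = [D, \<Phi>]\<close> gives \<open>Y = [K, \<Phi>] G\<close> (lemma \<open>close_homotopy_marks\<close>).  Behind the
  leftmost right cusp only the entries \<open>(k, k + 1)\<close> with \<open>k\<close> odd matter, because the front is
  nearly plat, and no mark affects them.

  The grading is dealt with at the end.  Chords carry a degree, the difference of the potentials
  of their ends, which is constant along chord paths.  Hence the matrix read off is homogeneous of
  degree \<open>- 1\<close>, and the part of \<open>f\<close> of degree 0 is again a unitriangular chain map.  This needs the
  degree of a crossing to be the difference of the potentials of the strands \<open>k\<close> and \<open>k + 1\<close> on
  the line left of it.  That is a statement about the smooth curve, obtained by following the two
  branches from the line to the crossing (lemma \<open>crossing_degree\<close>).
\<close>

declare add_bit_eq_xor [simp del] mult_bit_eq_and [simp del]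

section \<open>The ring of column-finite matrices over the field with two elements\<close>

text \<open>Columns are finite, so that products are finite sums and matrices of all sizes lie in
  one ring with unit.  Identities between differentials, handleslides and crossings then are ring
  identities in which the number of strands does not appear.\<close>

typedef bmat = "{f :: nat \<Rightarrow> nat \<Rightarrow> bit. \<forall>j. finite {i. f i j \<noteq> 0}}"
  morphisms entry Bmat
  by (rule exI[of _ "\<lambda>_ _. 0"]) simp

lemma bmat_eqI: "(\<And>i j. entry X i j = entry Y i j) \<Longrightarrow> X = Y"
  by (metis entry_inject ext)

lemma finite_column: "finite {i. entry X i j \<noteq> 0}"
  using entry[of X] by simp

lemma entry_Bmat: "(\<And>j. finite {i. f i j \<noteq> 0}) \<Longrightarrow> entry (Bmat f) = f"
  by (simp add: Bmat_inverse)

instantiation bmat :: ring_1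
begin

definition zero_bmat :: bmat where "0 = Bmat (\<lambda>i j. 0)"
definition one_bmat :: bmat where "1 = Bmat (\<lambda>i j. if i = j then 1 else 0)"
definition plus_bmat :: "bmat \<Rightarrow> bmat \<Rightarrow> bmat" where
  "X + Y = Bmat (\<lambda>i j. entry X i j + entry Y i j)"
definition minus_bmat :: "bmat \<Rightarrow> bmat \<Rightarrow> bmat" where "X - Y = X + (Y :: bmat)"
definition uminus_bmat :: "bmat \<Rightarrow> bmat" where "- X = (X :: bmat)"
definition times_bmat :: "bmat \<Rightarrow> bmat \<Rightarrow> bmat" where
  "X * Y = Bmat (\<lambda>i j. \<Sum>l | entry Y l j \<noteq> 0. entry X i l * entry Y l j)"

lemma entry_zero [simp]: "entry 0 i j = 0"
  unfolding zero_bmat_def by (subst entry_Bmat) auto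

lemma entry_one: "entry 1 i j = (if i = j then 1 else 0)"
  unfolding one_bmat_def by (subst entry_Bmat) auto

lemma entry_plus [simp]: "entry (X + Y) i j = entry X i j + entry Y i j"
  unfolding plus_bmat_def
proof (subst entry_Bmat)
  fix j
  have "{i. entry X i j + entry Y i j \<noteq> 0} \<subseteq> {i. entry X i j \<noteq> 0} \<union> {i. entry Y i j \<noteq> 0}"
    by auto
  then show "finite {i. entry X i j + entry Y i j \<noteq> 0}"
    by (rule finite_subset) (simp only: finite_Un finite_column simp_thms)
qed simp

lemma entry_times_raw:
  "entry (X * Y) i j = (\<Sum>l | entry Y l j \<noteq> 0. entry X i l * entry Y l j)"
  unfolding times_bmat_def
proof (subst entry_Bmat)
  fix j
  have "{i. (\<Sum>l | entry Y l j \<noteq> 0. entry X i l * entry Y l j) \<noteq> 0}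
      \<subseteq> (\<Union>l \<in> {l. entry Y l j \<noteq> 0}. {i. entry X i l \<noteq> 0})" (is "?A \<subseteq> ?B")
  proof
    fix i assume "i \<in> ?A"
    then obtain l where "l \<in> {l. entry Y l j \<noteq> 0}" "entry X i l * entry Y l j \<noteq> 0"
      by (metis (mono_tags, lifting) mem_Collect_eq sum.neutral)
    then show "i \<in> ?B" by auto
  qed
  moreover have "finite ?B"
    by (intro finite_UN_I finite_column)
  ultimately show "finite ?A"
    by (rule finite_subset)
qed simp

lemma entry_times:
  assumes "finite S" "\<And>l. entry Y l j \<noteq> 0 \<Longrightarrow> l \<in> S"
  shows "entry (X * Y) i j = (\<Sum>l\<in>S. entry X i l * entry Y l j)"
  unfolding entry_times_raw using assms by (intro sum.mono_neutral_left) auto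

instance
proof
  fix X Y Z :: bmat
  show "X * Y * Z = X * (Y * Z)"
  proof (rule bmat_eqI)
    fix i j
    let ?S = "{l. entry Z l j \<noteq> 0}"
    let ?R = "\<Union>l\<in>?S. {m. entry Y m l \<noteq> 0}"
    have fin: "finite ?S" "finite ?R"
      by (intro finite_UN_I finite_column)+
    have YZ: "entry (Y * Z) m j = (\<Sum>l\<in>?S. entry Y m l * entry Z l j)" for m
      by (rule entry_times[OF fin(1)]) simp
    have R: "m \<in> ?R" if "entry (Y * Z) m j \<noteq> 0" for m
    proof (rule ccontr)
      assume "m \<notin> ?R"
      then have "\<forall>l\<in>?S. entry Y m l = 0" by blast
      then have "entry (Y * Z) m j = 0" unfolding YZ by simp
      with that show False by simp
    qed
    have "entry (X * Y * Z) i j = (\<Sum>l\<in>?S. entry (X * Y) i l * entry Z l j)"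
      by (rule entry_times[OF fin(1)]) simp
    also have "\<dots> = (\<Sum>l\<in>?S. (\<Sum>m\<in>?R. entry X i m * entry Y m l) * entry Z l j)"
      by (intro sum.cong refl arg_cong2[of _ _ _ _ "(*)"] entry_times[OF fin(2)]) auto
    also have "\<dots> = (\<Sum>l\<in>?S. \<Sum>m\<in>?R. entry X i m * (entry Y m l * entry Z l j))"
      by (simp add: sum_distrib_right mult.assoc)
    also have "\<dots> = (\<Sum>m\<in>?R. \<Sum>l\<in>?S. entry X i m * (entry Y m l * entry Z l j))"
      by (rule sum.swap)
    also have "\<dots> = (\<Sum>m\<in>?R. entry X i m * entry (Y * Z) m j)"
      by (simp add: YZ sum_distrib_left)
    also have "\<dots> = entry (X * (Y * Z)) i j"
      by (rule entry_times[OF fin(2) R, symmetric])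
    finally show "entry (X * Y * Z) i j = entry (X * (Y * Z)) i j" .
  qed
  show "1 * X = X"
  proof (rule bmat_eqI)
    fix i j
    have "entry (1 * X) i j = (\<Sum>l\<in>insert i {l. entry X l j \<noteq> 0}. entry 1 i l * entry X l j)"
      by (rule entry_times) (use finite_column in auto)
    also have "\<dots> = (\<Sum>l\<in>insert i {l. entry X l j \<noteq> 0}. if l = i then entry X l j else 0)"
      by (intro sum.cong) (auto simp: entry_one)
    also have "\<dots> = entry X i j"
      using finite_column[of X j] by (subst sum.delta) auto
    finally show "entry (1 * X) i j = entry X i j" .
  qed
  show "X * 1 = X"
  proof (rule bmat_eqI)
    fix i j
    have "entry (X * 1) i j = (\<Sum>l\<in>{j}. entry X i l * entry 1 l j)"
      by (rule entry_times) (auto simp: entry_one split: if_splits)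
    then show "entry (X * 1) i j = entry X i j" by (simp add: entry_one)
  qed
  show "(X + Y) * Z = X * Z + Y * Z"
    by (rule bmat_eqI) (simp add: entry_times_raw distrib_right sum.distrib)
  show "X * (Y + Z) = X * Y + X * Z"
  proof (rule bmat_eqI)
    fix i j
    let ?S = "{l. entry Y l j \<noteq> 0} \<union> {l. entry Z l j \<noteq> 0}"
    have fin: "finite ?S" by (simp only: finite_Un finite_column simp_thms)
    have "entry (X * (Y + Z)) i j = (\<Sum>l\<in>?S. entry X i l * entry (Y + Z) l j)"
      by (rule entry_times[OF fin]) auto
    also have "\<dots> = (\<Sum>l\<in>?S. entry X i l * entry Y l j) + (\<Sum>l\<in>?S. entry X i l * entry Z l j)"
      by (simp add: distrib_left sum.distrib)
    also have "\<dots> = entry (X * Y) i j + entry (X * Z) i j"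
      by (intro arg_cong2[of _ _ _ _ "(+)"] entry_times[OF fin, symmetric]) auto
    finally show "entry (X * (Y + Z)) i j = entry (X * Y + X * Z) i j" by simp
  qed
  show "(0::bmat) \<noteq> 1"
  proof
    assume "(0::bmat) = 1"
    then have "entry 0 0 0 = entry 1 0 0" by simp
    then show False by (simp add: entry_one)
  qed
  show "- X + X = 0"
    by (rule bmat_eqI) (simp add: uminus_bmat_def)
qed (auto intro!: bmat_eqI simp: minus_bmat_def uminus_bmat_def add_ac)

end

lemma bit_sum_zero_iff: "a + b = 0 \<longleftrightarrow> a = (b :: bit)"
  by (cases a; cases b) auto

lemma bit_eqI: "(a = 1 \<longleftrightarrow> b = 1) \<Longrightarrow> a = (b :: bit)"
  by (cases a; cases b) auto

lemma bmat_add_self [simp]: "X + X = (0 :: bmat)"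
  by (rule bmat_eqI) simp

lemma bmat_add_left_self [simp]: "X + (X + Y) = (Y :: bmat)"
  by (simp flip: add.assoc)

lemma entry_sum: "entry (\<Sum>x\<in>A. f x) i j = (\<Sum>x\<in>A. entry (f x) i j)"
  by (induction A rule: infinite_finite_induct) auto

definition bscale :: "bit \<Rightarrow> bmat \<Rightarrow> bmat" where
  "bscale c X = (if c = 0 then 0 else X)"

lemma bscale_0 [simp]: "bscale 0 X = 0" and bscale_1 [simp]: "bscale 1 X = X"
  and bscale_zero [simp]: "bscale c 0 = 0"
  by (auto simp: bscale_def)

lemma bscale_add: "bscale (c + e) X = bscale c X + bscale e X"
  by (cases c; cases e) auto

lemma bscale_plus: "bscale c (X + Y) = bscale c X + bscale c Y"
  by (auto simp: bscale_def)

lemma bscale_mult_left: "X * bscale c Y = bscale c (X * Y)"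
  and bscale_mult_right: "bscale c X * Y = bscale c (X * Y)"
  by (auto simp: bscale_def)

lemma entry_bscale [simp]: "entry (bscale c X) i j = c * entry X i j"
  by (cases c) auto

lemma bscale_bscale: "bscale c (bscale e X) = bscale (c * e) X"
  by (cases c; cases e) auto

section \<open>Matrix units, handleslides, crossings and cusps\<close>

definition unit :: "nat \<Rightarrow> nat \<Rightarrow> bmat" where
  "unit k l = Bmat (\<lambda>i j. if i = k \<and> j = l then 1 else 0)"

lemma entry_unit: "entry (unit k l) i j = (if i = k \<and> j = l then 1 else 0)"
  unfolding unit_def by (subst entry_Bmat) auto

lemma entry_unit_times [simp]: "entry (unit k l * X) i j = (if i = k then entry X l j else 0)"
proof -
  have "entry (unit k l * X) i j =
      (\<Sum>m\<in>insert l {m. entry X m j \<noteq> 0}. entry (unit k l) i m * entry X m j)"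
    by (rule entry_times) (use finite_column in auto)
  also have "\<dots> = (\<Sum>m\<in>insert l {m. entry X m j \<noteq> 0}. if m = l then (if i = k then entry X l j else 0) else 0)"
    by (intro sum.cong) (auto simp: entry_unit)
  also have "\<dots> = (if i = k then entry X l j else 0)"
    using finite_column[of X j] by (subst sum.delta) auto
  finally show ?thesis .
qed

lemma entry_times_unit [simp]: "entry (X * unit k l) i j = (if j = l then entry X i k else 0)"
proof -
  have "entry (X * unit k l) i j = (\<Sum>m\<in>{k}. entry X i m * entry (unit k l) m j)"
    by (rule entry_times) (auto simp: entry_unit split: if_splits)
  then show ?thesis by (simp add: entry_unit)
qed

lemma unit_times_unit: "unit i j * unit k l = (if j = k then unit i l else 0)"
  by (rule bmat_eqI) (auto simp: entry_unit)

abbreviation swap :: "nat \<Rightarrow> nat \<Rightarrow> nat" where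
  "swap k \<equiv> Transposition.transpose k (Suc k)"

text \<open>Basis vectors are rows, and \<open>perm k\<close> interchanges those numbered \<open>k\<close> and \<open>k + 1\<close>.\<close>

definition perm :: "nat \<Rightarrow> bmat" where
  "perm k = Bmat (\<lambda>i j. if j = swap k i then 1 else 0)"

lemma entry_perm: "entry (perm k) i j = (if j = swap k i then 1 else 0)"
  unfolding perm_def
proof (subst entry_Bmat)
  fix j
  have "{i. (if j = swap k i then 1 else 0) \<noteq> (0::bit)}
      \<subseteq> {swap k j}"
    by auto
  then show "finite {i. (if j = swap k i then 1 else 0) \<noteq> (0::bit)}"
    by (rule finite_subset) simp
qed simp

lemma entry_perm_times [simp]:
  "entry (perm k * X) i j = entry X (swap k i) j"
proof -
  let ?l = "swap k i"
  have "entry (perm k * X) i j =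
      (\<Sum>m\<in>insert ?l {m. entry X m j \<noteq> 0}. entry (perm k) i m * entry X m j)"
    by (rule entry_times) (use finite_column in auto)
  also have "\<dots> = (\<Sum>m\<in>insert ?l {m. entry X m j \<noteq> 0}. if m = ?l then entry X ?l j else 0)"
    by (intro sum.cong) (auto simp: entry_perm)
  also have "\<dots> = entry X ?l j"
    using finite_column[of X j] by (subst sum.delta) auto
  finally show ?thesis .
qed

lemma entry_times_perm [simp]:
  "entry (X * perm k) i j = entry X i (swap k j)"
proof -
  let ?l = "swap k j"
  have "entry (X * perm k) i j = (\<Sum>m\<in>{?l}. entry X i m * entry (perm k) m j)"
    by (rule entry_times) (auto simp: entry_perm split: if_splits)
  then show ?thesis by (simp add: entry_perm)
qed

lemma perm_perm [simp]: "perm k * perm k = 1"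
  by (rule bmat_eqI) (simp add: entry_perm entry_one inj_eq[OF inj_transpose] eq_commute)

lemma perm_perm_left [simp]: "perm k * (perm k * X) = X"
  by (simp flip: mult.assoc)

lemma perm_unit_perm:
  "perm k * unit i j * perm k = unit (swap k i) (swap k j)"
proof (rule bmat_eqI)
  fix i' j'
  have "swap k a = b \<longleftrightarrow> a = swap k b" for a b
    by (metis transpose_involutory)
  then show "entry (perm k * unit i j * perm k) i' j' =
      entry (unit (swap k i) (swap k j)) i' j'"
    by (simp only: entry_perm_times entry_times_perm entry_unit)
qed

definition strict_upper :: "bmat \<Rightarrow> bool" where
  "strict_upper X \<longleftrightarrow> (\<forall>i j. entry X i j \<noteq> 0 \<longrightarrow> i < j)"

lemma strict_upperD: "strict_upper X \<Longrightarrow> j \<le> i \<Longrightarrow> entry X i j = 0"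
  unfolding strict_upper_def using leD by blast

lemma strict_upper_zero [simp]: "strict_upper 0"
  by (simp add: strict_upper_def)

lemma strict_upper_plus [intro]: "strict_upper X \<Longrightarrow> strict_upper Y \<Longrightarrow> strict_upper (X + Y)"
  unfolding strict_upper_def by (metis add_0 add_0_right entry_plus)

lemma strict_upper_unit: "k < l \<Longrightarrow> strict_upper (unit k l)"
  by (simp add: strict_upper_def entry_unit)

text \<open>In a product of strictly upper triangular matrices an entry only meets indices that
  lie strictly between its row and its column.\<close>

lemma entry_times_strict_upper:
  assumes "strict_upper X" "strict_upper Y"
  shows "entry (X * Y) i j = (\<Sum>l\<in>{i<..<j}. entry X i l * entry Y l j)"
proof -
  have "entry (X * Y) i j = (\<Sum>l\<in>{..<j}. entry X i l * entry Y l j)"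
    by (rule entry_times) (use assms in \<open>auto simp: strict_upper_def\<close>)
  also have "\<dots> = (\<Sum>l\<in>{i<..<j}. entry X i l * entry Y l j)"
    by (rule sum.mono_neutral_right) (auto simp: strict_upperD[OF assms(1)])
  finally show ?thesis .
qed

lemma strict_upper_times [intro]:
  assumes "strict_upper X" "strict_upper Y" shows "strict_upper (X * Y)"
  unfolding strict_upper_def
proof (intro allI impI)
  fix i j assume nz: "entry (X * Y) i j \<noteq> 0"
  show "i < j"
  proof (rule ccontr)
    assume "\<not> i < j"
    then have "{i<..<j} = {}" by auto
    then have "entry (X * Y) i j = 0"
      using entry_times_strict_upper[OF assms] by simp
    with nz show False by simp
  qed
qed

lemma entry_times_superdiagonal:
  assumes "strict_upper X" "strict_upper Y" shows "entry (X * Y) k (Suc k) = 0"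
proof -
  have "{k<..<Suc k} = {}" by auto
  then show ?thesis using entry_times_strict_upper[OF assms] by simp
qed

text \<open>In characteristic 2 this is the commutator; for a differential \<open>X\<close> it is the
  differential induced on endomorphisms.\<close>

definition comm :: "bmat \<Rightarrow> bmat \<Rightarrow> bmat" where
  "comm X Y = X * Y + Y * X"

lemma comm_add: "comm X (Y + Z) = comm X Y + comm X Z"
  by (simp add: comm_def algebra_simps)

lemma comm_zero [simp]: "comm X 0 = 0"
  by (simp add: comm_def)

lemma comm_bscale: "comm X (bscale c Y) = bscale c (comm X Y)"
  by (simp add: comm_def bscale_mult_left bscale_mult_right bscale_plus)

lemma comm_sum: "comm X (\<Sum>x\<in>A. f x) = (\<Sum>x\<in>A. comm X (f x))"
  by (induction A rule: infinite_finite_induct) (auto simp: comm_add)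

lemma strict_upper_comm: "strict_upper X \<Longrightarrow> strict_upper Y \<Longrightarrow> strict_upper (comm X Y)"
  unfolding comm_def by blast

lemma comm_superdiagonal: "strict_upper X \<Longrightarrow> strict_upper Y \<Longrightarrow> entry (comm X Y) k (Suc k) = 0"
  by (simp add: comm_def entry_times_superdiagonal)

text \<open>The matrix \<open>1 + unit k l\<close> of a handleslide is its own inverse.  The conjugation is the
  change of a differential in the presence of a mark \<open>(k, l)\<close>, and on strictly upper triangular
  matrices it is also the transpose of the rule that continues chords to the left of the mark.\<close>

definition slide :: "nat \<Rightarrow> nat \<Rightarrow> bmat \<Rightarrow> bmat" where
  "slide k l X = (1 + unit k l) * X * (1 + unit k l)"

lemma entry_slide:
  "strict_upper X \<Longrightarrow> k < l \<Longrightarrow> entry (slide k l X) i j =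
     entry X i j + (if i = k then entry X l j else 0) + (if j = l then entry X i k else 0)"
  by (auto simp: slide_def algebra_simps strict_upperD)

lemma strict_upper_slide: "strict_upper X \<Longrightarrow> k < l \<Longrightarrow> strict_upper (slide k l X)"
  unfolding slide_def
  by (auto simp: algebra_simps intro!: strict_upper_plus strict_upper_times strict_upper_unit)

text \<open>A handleslide adds to the entry \<open>(i, i + 1)\<close> only entries on or below the diagonal.  For
  this reason marks to the right of all crossings have no effect on the linearized complex.\<close>

lemma slide_superdiagonal:
  "strict_upper X \<Longrightarrow> k < l \<Longrightarrow> entry (slide k l X) i (Suc i) = entry X i (Suc i)"
  by (auto simp: entry_slide strict_upperD)

lemma slide_unit_square [simp]: "k \<noteq> l \<Longrightarrow> (1 + unit k l) * (1 + unit k l) = 1"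
  by (simp add: algebra_simps unit_times_unit)

lemma slide_unit_square_left [simp]: "k \<noteq> l \<Longrightarrow> (1 + unit k l) * ((1 + unit k l) * X) = X"
  by (simp flip: mult.assoc)

lemma slide_zero [simp]: "slide k l 0 = 0"
  by (simp add: slide_def)

lemma slide_add: "slide k l (X + Y) = slide k l X + slide k l Y"
  by (simp add: slide_def algebra_simps)

lemma slide_bscale: "slide k l (bscale c X) = bscale c (slide k l X)"
  by (simp add: slide_def bscale_mult_left bscale_mult_right)

lemma slide_sum: "slide k l (\<Sum>x\<in>A. f x) = (\<Sum>x\<in>A. slide k l (f x))"
  by (induction A rule: infinite_finite_induct) (auto simp: slide_add)

lemma slide_mult: "k \<noteq> l \<Longrightarrow> slide k l X * slide k l Y = slide k l (X * Y)"
  unfolding slide_def by (simp add: mult.assoc del: distrib_left distrib_right)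

lemma slide_comm: "k \<noteq> l \<Longrightarrow> comm (slide k l X) (slide k l Y) = slide k l (comm X Y)"
  by (simp add: comm_def slide_mult slide_add)

definition conj_perm :: "nat \<Rightarrow> bmat \<Rightarrow> bmat" where
  "conj_perm k X = perm k * X * perm k"

lemma entry_conj_perm: "entry (conj_perm k X) i j =
    entry X (swap k i) (swap k j)"
  by (simp add: conj_perm_def)

lemma conj_perm_zero [simp]: "conj_perm k 0 = 0"
  by (simp add: conj_perm_def)

lemma conj_perm_add: "conj_perm k (X + Y) = conj_perm k X + conj_perm k Y"
  by (simp add: conj_perm_def algebra_simps)

lemma conj_perm_bscale: "conj_perm k (bscale c X) = bscale c (conj_perm k X)"
  by (simp add: conj_perm_def bscale_mult_left bscale_mult_right)

lemma conj_perm_mult: "conj_perm k X * conj_perm k Y = conj_perm k (X * Y)"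
  by (simp add: conj_perm_def mult.assoc)

lemma conj_perm_comm: "comm (conj_perm k X) (conj_perm k Y) = conj_perm k (comm X Y)"
  by (simp add: comm_def conj_perm_mult conj_perm_add)

lemma transpose_Suc_less:
  assumes "i < j" "(i, j) \<noteq> (k, Suc k)"
  shows "swap k i < swap k j"
  using assms by (auto simp: Transposition.transpose_def)

lemma strict_upper_conj_perm:
  assumes "strict_upper X" "entry X k (Suc k) = 0"
  shows "strict_upper (conj_perm k X)"
  unfolding strict_upper_def entry_conj_perm
proof (intro allI impI)
  fix i j
  let ?t = "swap k"
  assume nz: "entry X (?t i) (?t j) \<noteq> 0"
  then have lt: "?t i < ?t j" using assms(1) by (auto simp: strict_upper_def)
  have ne: "(?t i, ?t j) \<noteq> (k, Suc k)" using nz assms(2) by auto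
  have "?t (?t i) < ?t (?t j)" by (rule transpose_Suc_less[OF lt ne])
  then show "i < j" by simp
qed

text \<open>Chords cannot be continued through a crossing if they join the two crossing strands;
  \<^term>\<open>cross k X\<close> is \<^term>\<open>conj_perm k X\<close> without the entry coming from those chords.\<close>

definition cross :: "nat \<Rightarrow> bmat \<Rightarrow> bmat" where
  "cross k X = conj_perm k X + bscale (entry X k (Suc k)) (unit (Suc k) k)"

lemma entry_cross:
  assumes "strict_upper X"
  shows "entry (cross k X) i j = (if i < j \<and> (i, j) \<noteq> (k, Suc k)
     then entry X (swap k i) (swap k j) else 0)"
proof (cases "i < j")
  case True
  then show ?thesis
    using strict_upperD[OF assms, of k "Suc k"]
    by (auto simp: cross_def entry_conj_perm entry_unit)
next
  case False
  then show ?thesis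
    using strict_upperD[OF assms, of "swap k j" "swap k i"]
    by (auto simp: cross_def entry_conj_perm entry_unit Transposition.transpose_def strict_upperD[OF assms] split: if_splits)
qed

lemma strict_upper_cross: "strict_upper X \<Longrightarrow> strict_upper (cross k X)"
  unfolding strict_upper_def[of "cross k X"] by (auto simp: entry_cross split: if_splits)

lemma cross_zero [simp]: "cross k 0 = 0"
  by (simp add: cross_def)

lemma cross_add: "cross k (X + Y) = cross k X + cross k Y"
  by (simp add: cross_def conj_perm_add bscale_add add_ac)

lemma cross_bscale: "cross k (bscale c X) = bscale c (cross k X)"
  by (simp add: cross_def conj_perm_bscale bscale_plus bscale_bscale)

lemma cross_sum: "cross k (\<Sum>x\<in>A. f x) = (\<Sum>x\<in>A. cross k (f x))"
  by (induction A rule: infinite_finite_induct) (auto simp: cross_add)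

text \<open>The defect is the coefficient of the chord that cannot pass the crossing, times the
  matrix with which the crossing itself starts in the function \<open>advance\<close> below.\<close>

lemma comm_cross:
  assumes "strict_upper D" "strict_upper Y"
  shows "comm (conj_perm k D) (cross k Y) =
    cross k (comm D Y) + bscale (entry Y k (Suc k)) (comm (conj_perm k D) (unit (Suc k) k))"
  by (simp add: cross_def comm_add comm_bscale conj_perm_comm comm_superdiagonal[OF assms])

lemma comm_comm_zero: "X * X = 0 \<Longrightarrow> comm X (comm X Y) = 0"
proof -
  assume sq: "X * X = 0"
  have "X * (X * Y) = 0" using sq by (simp flip: mult.assoc)
  then show ?thesis using sq by (simp add: comm_def algebra_simps)
qed

lemma skip_cusp_less_iff [simp]: "skip_cusp k i < skip_cusp k j \<longleftrightarrow> i < j"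
  by (auto simp: skip_cusp_def)

lemma skip_cusp_eq_iff [simp]: "skip_cusp k i = skip_cusp k j \<longleftrightarrow> i = j"
  by (auto simp: skip_cusp_def)

lemma skip_cusp_neq [simp]: "skip_cusp k i \<noteq> k" "skip_cusp k i \<noteq> Suc k"
  "k \<noteq> skip_cusp k i" "Suc k \<noteq> skip_cusp k i"
  by (auto simp: skip_cusp_def)

lemma skip_cusp_surj: "j \<noteq> k \<Longrightarrow> j \<noteq> Suc k \<Longrightarrow> \<exists>i. j = skip_cusp k i"
  by (rule exI[of _ "if j < k then j else j - 2"]) (auto simp: skip_cusp_def)

lemma finite_skip_vimage: "finite {i. P i} \<Longrightarrow> finite {i. P (skip_cusp k i)}"
proof -
  assume fin: "finite {i. P i}"
  have "finite (skip_cusp k -` {i. P i})"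
    by (rule finite_vimageI[OF fin]) (simp add: inj_def)
  then show ?thesis by (simp add: vimage_def)
qed

definition restrict :: "nat \<Rightarrow> bmat \<Rightarrow> bmat" where
  "restrict k X = Bmat (\<lambda>i j. entry X (skip_cusp k i) (skip_cusp k j))"

lemma entry_restrict [simp]: "entry (restrict k X) i j = entry X (skip_cusp k i) (skip_cusp k j)"
  unfolding restrict_def by (subst entry_Bmat) (rule finite_skip_vimage[OF finite_column], rule refl)

lemma strict_upper_restrict: "strict_upper X \<Longrightarrow> strict_upper (restrict k X)"
  unfolding strict_upper_def entry_restrict by (metis skip_cusp_less_iff)

text \<open>The differential induced on the quotient by the subcomplex spanned by the two strands
  of a cusp.\<close>

definition reduce :: "nat \<Rightarrow> bmat \<Rightarrow> bmat" where
  "reduce k X = Bmat (\<lambda>i j. entry X (skip_cusp k i) (skip_cusp k j) +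
     entry X (skip_cusp k i) (Suc k) * entry X k (skip_cusp k j))"

lemma entry_reduce [simp]: "entry (reduce k X) i j = entry X (skip_cusp k i) (skip_cusp k j) +
     entry X (skip_cusp k i) (Suc k) * entry X k (skip_cusp k j)"
  unfolding reduce_def
proof (subst entry_Bmat)
  fix j
  have "{i. entry X (skip_cusp k i) (skip_cusp k j) +
     entry X (skip_cusp k i) (Suc k) * entry X k (skip_cusp k j) \<noteq> 0}
    \<subseteq> {i. entry X (skip_cusp k i) (skip_cusp k j) \<noteq> 0} \<union> {i. entry X (skip_cusp k i) (Suc k) \<noteq> 0}"
    by auto
  moreover have "finite \<dots>"
    unfolding finite_Un by (intro conjI finite_skip_vimage[OF finite_column])
  ultimately show "finite {i. entry X (skip_cusp k i) (skip_cusp k j) +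
     entry X (skip_cusp k i) (Suc k) * entry X k (skip_cusp k j) \<noteq> 0}"
    by (rule finite_subset)
qed simp

section \<open>Reading a marked front from left to right\<close>

text \<open>What is known on a vertical line after reading the front to the left of it: the matrix
  of the differential; the number of generators (crossings and right cusps) passed so far, which
  are numbered from left to right; for the generator number \<open>r\<close> the matrix \<open>paths r\<close> counting, modulo
  2, the chord paths from each chord on the line to it; the coefficients \<open>lin q r\<close> of the
  generator \<open>r\<close> in the linearized differential of the generator \<open>q\<close>; and whether a right cusp has
  been passed.\<close>

record cstate =
  diff :: bmat
  ngen :: nat
  paths :: "nat \<Rightarrow> bmat"
  lin :: "nat \<Rightarrow> nat \<Rightarrow> bit"
  late :: bool

text \<open>The relation between the differentials \<open>D\<close> and \<open>D'\<close> on the left and on the right of a left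
  cusp with implicit marks \<open>I\<close>.\<close>

definition left_cusp_rel :: "nat \<Rightarrow> (nat \<times> nat) set \<Rightarrow> bmat \<Rightarrow> bmat \<Rightarrow> bool" where
  "left_cusp_rel k I D D' \<longleftrightarrow>
     strict_upper D' \<and> D' * D' = 0 \<and> entry D' k (Suc k) = 1 \<and> reduce k D' = D \<and>
     implicit_at (entry D') k = I"

text \<open>A new crossing starts with the matrix \<open>[D, unit (k + 1) k]\<close>, where \<open>D\<close> is the
  differential to the right of it: its entries \<open>(i, k)\<close> and \<open>(k + 1, j)\<close> are the coefficients in
  the end condition of chord paths.  A new right cusp starts with 0, as chord paths do not end at
  cusps.  In both cases the chord paths starting at the new generator are those
  from the chord \<open>[k, k + 1]\<close> on the line left of it.\<close>

fun advance :: "event \<times> (nat \<times> nat) set \<Rightarrow> cstate \<Rightarrow> cstate" where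
  "advance (Slide k l, I) s =
     s\<lparr>diff := slide k l (diff s), paths := (\<lambda>r. slide k l (paths s r))\<rparr>"
| "advance (Crossing k, I) s =
     s\<lparr>diff := conj_perm k (diff s),
       ngen := Suc (ngen s),
       paths := (\<lambda>r. if r = ngen s then comm (conj_perm k (diff s)) (unit (Suc k) k)
                     else cross k (paths s r)),
       lin := (lin s)(ngen s := (\<lambda>r. entry (paths s r) k (Suc k)))\<rparr>"
| "advance (LeftCusp k, I) s =
     s\<lparr>diff := (THE D'. left_cusp_rel k I (diff s) D'), paths := (\<lambda>r. 0)\<rparr>"
| "advance (RightCusp k, I) s =
     s\<lparr>diff := reduce k (diff s),
       ngen := Suc (ngen s),
       paths := (\<lambda>r. restrict k (paths s r)),
       lin := (lin s)(ngen s := (\<lambda>r. entry (paths s r) k (Suc k))),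
       late := True\<rparr>"

text \<open>Besides the conditions on single events this requires the order of events in a nearly
  plat front: left cusps, crossings, right cusps.\<close>

fun admissible :: "event \<times> (nat \<times> nat) set \<Rightarrow> cstate \<Rightarrow> bool" where
  "admissible (Slide k l, I) s \<longleftrightarrow> k < l"
| "admissible (Crossing k, I) s \<longleftrightarrow> \<not> late s \<and> entry (diff s) k (Suc k) = 0"
| "admissible (LeftCusp k, I) s \<longleftrightarrow>
     \<not> late s \<and> ngen s = 0 \<and> (\<exists>D'. left_cusp_rel k I (diff s) D')"
| "admissible (RightCusp k, I) s \<longleftrightarrow> odd k"

abbreviation run :: "marked_front \<Rightarrow> cstate \<Rightarrow> cstate" where
  "run W s \<equiv> fold advance W s"

primrec good :: "marked_front \<Rightarrow> cstate \<Rightarrow> bool" where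
  "good [] s \<longleftrightarrow> True"
| "good (e # W) s \<longleftrightarrow> admissible e s \<and> good W (advance e s)"

lemma good_append: "good (V @ W) s \<longleftrightarrow> good V s \<and> good W (run V s)"
  by (induction V arbitrary: s) auto

definition start :: cstate where
  "start = \<lparr>diff = 0, ngen = 0, paths = (\<lambda>_. 0), lin = (\<lambda>_ _. 0), late = False\<rparr>"

text \<open>The entries of \<open>D'\<close> in the rows and columns of the cusp strands are given by the
  implicit marks, or forced by \<open>D' * D' = 0\<close> from the unit entry \<open>(k, k + 1)\<close>; the others are then
  determined by \<open>D\<close>.  This is the reason why an MCS is determined by its marks.\<close>

lemma left_cusp_rel_unique:
  assumes "left_cusp_rel k I D D'" "left_cusp_rel k I D D''"
  shows "D' = D''"
proof (rule bmat_eqI)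
  from assms[unfolded left_cusp_rel_def]
  have SU: "strict_upper D'" "strict_upper D''"
    and sq: "D' * D' = 0" "D'' * D'' = 0"
    and one: "entry D' k (Suc k) = 1" "entry D'' k (Suc k) = 1"
    and red2: "reduce k D' = D" "reduce k D'' = D"
    and imp2: "implicit_at (entry D') k = I" "implicit_at (entry D'') k = I"
    by blast+
  have red: "reduce k D' = reduce k D''" using red2 by (rule trans[OF _ sym])
  have imp: "implicit_at (entry D') k = implicit_at (entry D'') k" using imp2 by (rule trans[OF _ sym])
  have top: "entry D' i (Suc k) = entry D'' i (Suc k)" for i
  proof (cases "i < k")
    case True
    have "(i, k) \<in> implicit_at (entry D') k \<longleftrightarrow> entry D' i (Suc k) = 1"
      "(i, k) \<in> implicit_at (entry D'') k \<longleftrightarrow> entry D'' i (Suc k) = 1"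
      using True by (auto simp: implicit_at_def)
    then show ?thesis using imp by (intro bit_eqI) simp
  next
    case False
    then show ?thesis using one by (cases "i = k") (auto simp: strict_upperD[OF SU(1)] strict_upperD[OF SU(2)])
  qed
  have bot: "entry D' k j = entry D'' k j" for j
  proof (cases "Suc k < j")
    case True
    have "(Suc k, j) \<in> implicit_at (entry D') k \<longleftrightarrow> entry D' k j = 1"
      "(Suc k, j) \<in> implicit_at (entry D'') k \<longleftrightarrow> entry D'' k j = 1"
      using True by (auto simp: implicit_at_def)
    then show ?thesis using imp by (intro bit_eqI) simp
  next
    case False
    then show ?thesis using one by (cases "j = Suc k") (auto simp: strict_upperD[OF SU(1)] strict_upperD[OF SU(2)])
  qed
  have mid: "entry D' i j = entry D'' i j" if ne: "i \<noteq> k" "i \<noteq> Suc k" "j \<noteq> k" "j \<noteq> Suc k" for i j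
  proof -
    obtain i' where i: "i = skip_cusp k i'" using skip_cusp_surj ne(1,2) by blast
    obtain j' where j: "j = skip_cusp k j'" using skip_cusp_surj ne(3,4) by blast
    have "entry (reduce k D') i' j' = entry (reduce k D'') i' j'" using red by (rule arg_cong)
    then show ?thesis unfolding entry_reduce i[symmetric] j[symmetric] top bot by simp
  qed
  \<comment> \<open>The two remaining families of entries are forced by \<open>D' * D' = 0\<close>.\<close>
  have split_top: "entry X i k = (\<Sum>l\<in>{i<..<k}. entry X i l * entry X l (Suc k))"
    if "strict_upper X" "X * X = 0" "entry X k (Suc k) = 1" "i < k" for X i
  proof -
    have "{i<..<Suc k} = insert k {i<..<k}" using that by auto
    then have "0 = entry X i k + (\<Sum>l\<in>{i<..<k}. entry X i l * entry X l (Suc k))"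
      using entry_times_strict_upper[OF that(1,1), of i "Suc k"] that(2,3) by simp
    from this[symmetric] show ?thesis by (simp only: bit_sum_zero_iff)
  qed
  have split_bot: "entry X (Suc k) j = (\<Sum>l\<in>{Suc k<..<j}. entry X k l * entry X l j)"
    if "strict_upper X" "X * X = 0" "entry X k (Suc k) = 1" "Suc k < j" for X j
  proof -
    have "{k<..<j} = insert (Suc k) {Suc k<..<j}" using that by auto
    then have "0 = entry X (Suc k) j + (\<Sum>l\<in>{Suc k<..<j}. entry X k l * entry X l j)"
      using entry_times_strict_upper[OF that(1,1), of k j] that(2,3) by simp
    from this[symmetric] show ?thesis by (simp only: bit_sum_zero_iff)
  qed
  fix i j
  consider "i = k \<or> j = Suc k \<or> j \<le> i" | "j = k" "i < k" | "i = Suc k" "Suc k < j" |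
    "i \<noteq> k" "i \<noteq> Suc k" "j \<noteq> k" "j \<noteq> Suc k"
    by (cases "i = k \<or> j = Suc k \<or> j \<le> i"; cases "j = k"; cases "i = Suc k") auto
  then show "entry D' i j = entry D'' i j"
  proof cases
    case 1
    then show ?thesis
      by (elim disjE) (simp_all add: top bot strict_upperD[OF SU(1)] strict_upperD[OF SU(2)])
  next
    case 2
    have "(\<Sum>l\<in>{i<..<k}. entry D' i l * entry D' l (Suc k)) =
        (\<Sum>l\<in>{i<..<k}. entry D'' i l * entry D'' l (Suc k))"
      using 2 by (intro sum.cong refl arg_cong2[of _ _ _ _ "(*)"] mid top) auto
    then show ?thesis
      unfolding 2(1) split_top[OF SU(1) sq(1) one(1) 2(2)] split_top[OF SU(2) sq(2) one(2) 2(2)] .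
  next
    case 3
    have "(\<Sum>l\<in>{Suc k<..<j}. entry D' k l * entry D' l j) =
        (\<Sum>l\<in>{Suc k<..<j}. entry D'' k l * entry D'' l j)"
      using 3 by (intro sum.cong refl arg_cong2[of _ _ _ _ "(*)"] mid bot) auto
    then show ?thesis
      unfolding 3(1) split_bot[OF SU(1) sq(1) one(1) 3(2)] split_bot[OF SU(2) sq(2) one(2) 3(2)] .
  next
    case 4
    then show ?thesis by (rule mid)
  qed
qed

lemma the_left_cusp_rel: "left_cusp_rel k I D D' \<Longrightarrow> (THE D'. left_cusp_rel k I D D') = D'"
  using left_cusp_rel_unique by blast

text \<open>The last clause, \<open>d\<^sub>1 \<Phi> = [D, \<Phi>]\<close> for the matrix \<open>\<Phi>\<close> with coefficients in the span of
  the generators, is the form of \<open>d\<^sub>1\<^sup>2 = 0\<close> that can be carried along the front.\<close>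

definition reading :: "cstate \<Rightarrow> bool" where
  "reading s \<longleftrightarrow>
     (\<forall>r. strict_upper (paths s r)) \<and>
     (\<forall>r \<ge> ngen s. paths s r = 0) \<and>
     (\<forall>q < ngen s. \<forall>r \<ge> q. lin s q r = 0) \<and>
     (\<not> late s \<longrightarrow>
        strict_upper (diff s) \<and> diff s * diff s = 0 \<and>
        (\<forall>r. (\<Sum>q<ngen s. bscale (lin s q r) (paths s q)) = comm (diff s) (paths s r)))"

lemma readingD:
  assumes "reading s"
  shows "strict_upper (paths s r)" "ngen s \<le> r \<Longrightarrow> paths s r = 0"
    "q < ngen s \<Longrightarrow> q \<le> r \<Longrightarrow> lin s q r = 0"
    "\<not> late s \<Longrightarrow> strict_upper (diff s)" "\<not> late s \<Longrightarrow> diff s * diff s = 0"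
    "\<not> late s \<Longrightarrow> (\<Sum>q<ngen s. bscale (lin s q r) (paths s q)) = comm (diff s) (paths s r)"
  using assms unfolding reading_def by auto

lemma reading_start: "reading start"
  by (simp add: reading_def start_def)

lemma reading_advance:
  assumes "reading s" "admissible e s"
  shows "reading (advance e s)"
proof -
  obtain ev I where e: "e = (ev, I)" by (cases e)
  note R = readingD[OF assms(1)]
  note SU = R(1) and Z = R(2)
  show ?thesis
  proof (cases ev)
    case (Slide k l)
    then have kl: "k < l" using assms(2) e by simp
    have "slide k l (diff s) * slide k l (diff s) = 0" if "\<not> late s"
      using R(5)[OF that] kl by (simp add: slide_mult)
    moreover have "(\<Sum>q<ngen s. bscale (lin s q r) (slide k l (paths s q))) =
        comm (slide k l (diff s)) (slide k l (paths s r))" if "\<not> late s" for r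
    proof -
      have "(\<Sum>q<ngen s. bscale (lin s q r) (slide k l (paths s q)))
          = slide k l (\<Sum>q<ngen s. bscale (lin s q r) (paths s q))"
        by (simp add: slide_sum slide_bscale)
      also have "\<dots> = slide k l (comm (diff s) (paths s r))" by (simp only: R(6)[OF that])
      finally show ?thesis using kl by (simp add: slide_comm)
    qed
    ultimately show ?thesis
      using kl unfolding reading_def
      by (simp add: e Slide strict_upper_slide R(1-4))
  next
    case (Crossing k)
    define n where "n = ngen s"
    define D1 where "D1 = conj_perm k (diff s)"
    define M where "M = comm D1 (unit (Suc k) k)"
    have late: "\<not> late s" and D0: "entry (diff s) k (Suc k) = 0"
      using assms(2) by (auto simp: e Crossing)
    have DSU: "strict_upper (diff s)" and sq: "diff s * diff s = 0" using R(4,5)[OF late] by auto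
    have D1SU: "strict_upper D1"
      unfolding D1_def by (rule strict_upper_conj_perm[OF DSU D0])
    have sq1: "D1 * D1 = 0" by (simp add: D1_def conj_perm_mult sq)
    have MSU: "strict_upper M"
      unfolding strict_upper_def
    proof (intro allI impI)
      fix i j assume "entry M i j \<noteq> 0"
      then have nz: "(if j = k then entry D1 i (Suc k) else 0) + (if i = Suc k then entry D1 k j else 0) \<noteq> 0"
        by (simp add: M_def comm_def)
      have "entry D1 k (Suc k) = 0"
        using strict_upperD[OF DSU, of k "Suc k"] by (simp add: D1_def entry_conj_perm)
      then have *: "i < k" if "entry D1 i (Suc k) \<noteq> 0" for i
        using D1SU that by (metis less_SucE strict_upper_def)
      have **: "Suc k < j" if "entry D1 k j \<noteq> 0" for j
        using D1SU that \<open>entry D1 k (Suc k) = 0\<close> by (metis Suc_lessI strict_upper_def)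
      show "i < j" using nz * ** by (auto simp: strict_upperD[OF D1SU] split: if_splits)
    qed
    have adv: "diff (advance e s) = D1" "ngen (advance e s) = Suc n"
      "paths (advance e s) = (\<lambda>r. if r = n then M else cross k (paths s r))"
      "lin (advance e s) = (lin s)(n := (\<lambda>r. entry (paths s r) k (Suc k)))"
      "late (advance e s) = late s"
      unfolding e Crossing D1_def M_def n_def by simp_all
    have lin0: "lin s q r = 0" if "q < n" "q \<le> r" for q r using R(3) that n_def by simp
    have leib: "(\<Sum>q<Suc n. bscale (lin (advance e s) q r) (paths (advance e s) q)) =
        comm D1 (paths (advance e s) r)" for r
    proof (cases "r = n")
      case True
      then show ?thesis
        by (simp add: adv lin0 Z n_def M_def comm_comm_zero sq1)
    next
      case False
      have "(\<Sum>q<n. bscale (lin s q r) (cross k (paths s q)))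
          = cross k (\<Sum>q<n. bscale (lin s q r) (paths s q))"
        by (simp add: cross_sum cross_bscale)
      also have "\<dots> = cross k (comm (diff s) (paths s r))"
        using R(6)[OF late] by (simp add: n_def)
      finally show ?thesis
        using False comm_cross[OF DSU SU[of r], of k] by (simp add: adv D1_def M_def)
    qed
    show ?thesis
      unfolding reading_def adv(1,2,5)
    proof (intro conjI allI impI)
      show "strict_upper (paths (advance e s) r)" for r
        by (simp add: adv MSU SU strict_upper_cross)
      show "paths (advance e s) r = 0" if "Suc n \<le> r" for r
        using that Z by (simp add: adv n_def)
      show "lin (advance e s) q r = 0" if "q < Suc n" "q \<le> r" for q r
        using that lin0 Z by (auto simp: adv n_def less_Suc_eq)
    qed (simp_all only: D1SU sq1 leib)
  next
    case (LeftCusp k)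
    then obtain D' where D': "left_cusp_rel k I (diff s) D'" "ngen s = 0"
      using assms(2) by (auto simp: e)
    have "diff (advance e s) = D'" by (simp add: e LeftCusp the_left_cusp_rel[OF D'(1)])
    moreover have "strict_upper D'" "D' * D' = 0"
      using D'(1) by (simp_all add: left_cusp_rel_def)
    ultimately show ?thesis
      unfolding reading_def using D'(2) by (simp add: e LeftCusp)
  next
    case (RightCusp k)
    have "strict_upper (restrict k (paths s r))" for r
      by (rule strict_upper_restrict[OF SU])
    moreover have "restrict k (paths s r) = 0" if "ngen s \<le> r" for r
      by (rule bmat_eqI) (simp add: Z that)
    ultimately show ?thesis
      unfolding reading_def using R(2,3) by (auto simp: e RightCusp less_Suc_eq)
  qed
qed

lemma reading_run: "reading s \<Longrightarrow> good W s \<Longrightarrow> reading (run W s)"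
  by (induction W arbitrary: s) (auto intro: reading_advance)

section \<open>Comparing two readings\<close>

definition unitriangular :: "nat \<Rightarrow> (nat \<Rightarrow> nat \<Rightarrow> bit) \<Rightarrow> bool" where
  "unitriangular n F \<longleftrightarrow> (\<forall>q<n. F q q = 1 \<and> (\<forall>r>q. F q r = 0))"

definition intertwines :: "nat \<Rightarrow> (nat \<Rightarrow> nat \<Rightarrow> bit) \<Rightarrow> (nat \<Rightarrow> nat \<Rightarrow> bit) \<Rightarrow> (nat \<Rightarrow> nat \<Rightarrow> bit) \<Rightarrow> bool" where
  "intertwines n d d' F \<longleftrightarrow>
     (\<forall>q<n. \<forall>r. (\<Sum>t<n. d q t * F t r) = (\<Sum>t<n. F q t * d' t r))"

text \<open>With \<open>\<Phi>\<close> as above and \<open>F\<close> acting on generators: \<open>F(\<Phi>) = \<Phi>' + [D, Y] + d'(Y)\<close>.\<close>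

definition homotopic :: "cstate \<Rightarrow> cstate \<Rightarrow> (nat \<Rightarrow> nat \<Rightarrow> bit) \<Rightarrow> (nat \<Rightarrow> bmat) \<Rightarrow> bool" where
  "homotopic s s' F Y \<longleftrightarrow>
     \<not> late s \<and> \<not> late s' \<and> diff s = diff s' \<and>
     (\<forall>r. (\<Sum>q<ngen s. bscale (F q r) (paths s q)) =
        paths s' r + comm (diff s) (Y r) + (\<Sum>q<ngen s. bscale (lin s' q r) (Y q)))"

text \<open>What survives of the homotopy behind a right cusp.  The right cusps of a nearly plat front
  have odd positions, so a chord \<open>[k, k + 1]\<close> with \<open>k\<close> odd continues to the left past other right
  cusps to a chord of the same kind.\<close>

definition superdiagonal_homotopic ::
    "cstate \<Rightarrow> cstate \<Rightarrow> (nat \<Rightarrow> nat \<Rightarrow> bit) \<Rightarrow> (nat \<Rightarrow> bmat) \<Rightarrow> bool" where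
  "superdiagonal_homotopic s s' F Y \<longleftrightarrow>
     (\<forall>r k. odd k \<longrightarrow> (\<Sum>q<ngen s. F q r * entry (paths s q) k (Suc k)) =
        entry (paths s' r) k (Suc k) + (\<Sum>q<ngen s. lin s' q r * entry (Y q) k (Suc k)))"

definition equivalent_readings :: "cstate \<Rightarrow> cstate \<Rightarrow> bool" where
  "equivalent_readings s s' \<longleftrightarrow>
     ngen s = ngen s' \<and>
     (\<exists>F Y. unitriangular (ngen s) F \<and> intertwines (ngen s) (lin s) (lin s') F \<and>
        (\<forall>r. strict_upper (Y r)) \<and> (\<forall>r \<ge> ngen s. Y r = 0) \<and>
        (homotopic s s' F Y \<or> late s \<and> late s' \<and> superdiagonal_homotopic s s' F Y))"

lemma homotopic_superdiagonal:
  assumes "homotopic s s' F Y" "reading s" "\<And>r. strict_upper (Y r)"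
  shows "(\<Sum>q<ngen s. F q r * entry (paths s q) k (Suc k)) =
        entry (paths s' r) k (Suc k) + (\<Sum>q<ngen s. lin s' q r * entry (Y q) k (Suc k))"
proof -
  have SU: "strict_upper (diff s)" using assms(1,2) by (auto simp: homotopic_def reading_def)
  have "entry (\<Sum>q<ngen s. bscale (F q r) (paths s q)) k (Suc k) =
        entry (paths s' r + comm (diff s) (Y r) + (\<Sum>q<ngen s. bscale (lin s' q r) (Y q))) k (Suc k)"
    using assms(1) by (simp only: homotopic_def)
  then show ?thesis
    by (simp add: entry_sum comm_superdiagonal[OF SU assms(3)])
qed

text \<open>The chain map on a new generator, numbered \<open>n\<close>, is the generator itself plus the
  entry \<open>y\<close> of the homotopy between its two strands.  The equation \<open>eq\<close>, in which no commutator
  appears any more, is precisely the chain map equation on the new generator.\<close>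

lemma intertwines_new_row:
  assumes F: "unitriangular n F" "intertwines n d d' F"
    and d: "\<And>q r. q < n \<Longrightarrow> q \<le> r \<Longrightarrow> d q r = 0"
    and z: "\<phi> n = 0" "\<And>r. n \<le> r \<Longrightarrow> y r = 0"
    and eq: "\<And>r. (\<Sum>q<n. F q r * \<phi> q) = \<phi>' r + (\<Sum>q<n. d' q r * y q)"
  defines "F' \<equiv> F(n := (\<lambda>r. (if r = n then 1 else 0) + y r))"
  shows "unitriangular (Suc n) F'" "intertwines (Suc n) (d(n := \<phi>)) (d'(n := \<phi>')) F'"
proof -
  show "unitriangular (Suc n) F'"
    using F(1) z(2) by (auto simp: unitriangular_def F'_def less_Suc_eq)
  show "intertwines (Suc n) (d(n := \<phi>)) (d'(n := \<phi>')) F'"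
    unfolding intertwines_def
  proof (intro allI impI)
    fix q r assume "q < Suc n"
    then consider "q < n" | "q = n" by linarith
    then show "(\<Sum>t<Suc n. (d(n := \<phi>)) q t * F' t r) = (\<Sum>t<Suc n. F' q t * (d'(n := \<phi>')) t r)"
    proof cases
      case 1
      then have "F q n = 0" "d q n = 0" using F(1) d by (auto simp: unitriangular_def)
      then show ?thesis using 1 F(2) by (simp add: F'_def intertwines_def)
    next
      case 2
      have "(\<Sum>t<n. \<phi> t * F t r) = \<phi>' r + (\<Sum>t<n. y t * d' t r)"
        using eq[of r] by (simp add: mult.commute)
      then show ?thesis using 2 z by (simp add: F'_def add.commute)
    qed
  qed
qed

text \<open>The homotopy \<open>Y\<close> is transported like the matrices of paths.  At a crossing the defect in
  \<open>comm_cross\<close> is \<open>Y\<^sub>k\<^sub>,\<^sub>k\<^sub>+\<^sub>1\<close> times the matrix of the new crossing, and is absorbed by the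
  new value of the chain map.\<close>

lemma equivalent_readings_advance:
  assumes eq: "equivalent_readings s s'" and R: "reading s" "reading s'"
    and adm: "admissible e s" "admissible e s'"
  shows "equivalent_readings (advance e s) (advance e s')"
proof -
  obtain ev I where e: "e = (ev, I)" by (cases e)
  define n where "n = ngen s"
  have n': "ngen s' = n" using eq by (simp add: equivalent_readings_def n_def)
  obtain F Y where F: "unitriangular n F" "intertwines n (lin s) (lin s') F"
    and Y: "\<And>r. strict_upper (Y r)" "\<And>r. n \<le> r \<Longrightarrow> Y r = 0"
    and h: "homotopic s s' F Y \<or> late s \<and> late s' \<and> superdiagonal_homotopic s s' F Y"
    using eq unfolding equivalent_readings_def n_def by blast
  have late: "late s' = late s" using h by (auto simp: homotopic_def)
  have hom: "homotopic s s' F Y" if "\<not> late s" using h that by blast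
  have superdiag: "(\<Sum>q<n. F q r * entry (paths s q) k (Suc k)) =
        entry (paths s' r) k (Suc k) + (\<Sum>q<n. lin s' q r * entry (Y q) k (Suc k))"
    if "odd k \<or> \<not> late s" for r k
  proof (cases "homotopic s s' F Y")
    case True
    show ?thesis using homotopic_superdiagonal[OF True R(1) Y(1)] by (simp add: n_def)
  next
    case False
    then show ?thesis using h that by (simp add: superdiagonal_homotopic_def n_def)
  qed
  have Z: "paths s r = 0" "paths s' r = 0" if "n \<le> r" for r
    using readingD(2)[OF R(1)] readingD(2)[OF R(2)] that n' by (simp_all add: n_def)
  have lin0: "lin s q r = 0" "lin s' q r = 0" if "q < n" "q \<le> r" for q r
    using readingD(3)[OF R(1)] readingD(3)[OF R(2)] that n' by (simp_all add: n_def)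
  have F0: "F q n = 0" if "q < n" for q using F(1) that by (simp add: unitriangular_def)
  show ?thesis
  proof (cases ev)
    case (Slide k l)
    then have kl: "k < l" "k \<noteq> l" using adm(1) e by auto
    define Y' where "Y' = (\<lambda>r. slide k l (Y r))"
    have "homotopic (advance e s) (advance e s') F Y'" if "homotopic s s' F Y"
      unfolding homotopic_def
    proof (intro conjI allI)
      fix r
      have "slide k l (\<Sum>q<ngen s. bscale (F q r) (paths s q)) =
        slide k l (paths s' r + comm (diff s) (Y r) + (\<Sum>q<ngen s. bscale (lin s' q r) (Y q)))"
        using that by (simp only: homotopic_def)
      then show "(\<Sum>q<ngen (advance e s). bscale (F q r) (paths (advance e s) q)) =
          paths (advance e s') r + comm (diff (advance e s)) (Y' r) +
          (\<Sum>q<ngen (advance e s). bscale (lin (advance e s') q r) (Y' q))"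
        using kl by (simp add: e Slide Y'_def slide_comm slide_add slide_sum slide_bscale)
    qed (use that in \<open>simp_all add: homotopic_def e Slide\<close>)
    moreover have "superdiagonal_homotopic (advance e s) (advance e s') F Y'"
      if "superdiagonal_homotopic s s' F Y"
      using that kl unfolding superdiagonal_homotopic_def
      by (simp add: e Slide Y'_def slide_superdiagonal Y(1) readingD(1)[OF R(1)] readingD(1)[OF R(2)])
    ultimately show ?thesis
      unfolding equivalent_readings_def using F Y h n' kl
      by (intro conjI exI[of _ F] exI[of _ Y'])
        (auto simp: e Slide n_def Y'_def intro: strict_upper_slide)
  next
    case (Crossing k)
    then have early: "\<not> late s" using adm(1) e by simp
    note hom = hom[OF early]
    have D: "diff s' = diff s" using hom by (simp add: homotopic_def)
    define D1 where "D1 = conj_perm k (diff s)"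
    define M where "M = comm D1 (unit (Suc k) k)"
    define F' where "F' = F(n := (\<lambda>r. (if r = n then 1 else 0) + entry (Y r) k (Suc k)))"
    define Y' where "Y' = (\<lambda>r. cross k (Y r))"
    have DSU: "strict_upper (diff s)" using readingD(4)[OF R(1) early] .
    have zs: "entry (paths s n) k (Suc k) = 0" "\<And>r. n \<le> r \<Longrightarrow> entry (Y r) k (Suc k) = 0"
      by (simp_all add: Z Y(2))
    have eqs: "(\<Sum>q<n. F q r * entry (paths s q) k (Suc k)) =
        entry (paths s' r) k (Suc k) + (\<Sum>q<n. lin s' q r * entry (Y q) k (Suc k))" for r
      by (rule superdiag) (simp add: early)
    note row = intertwines_new_row[where \<phi> = "\<lambda>r. entry (paths s r) k (Suc k)" and
        y = "\<lambda>r. entry (Y r) k (Suc k)", OF F lin0(1) zs eqs, folded F'_def]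
    have "(\<Sum>q<Suc n. bscale (F' q r) (if q = n then M else cross k (paths s q))) =
        (if r = n then M else cross k (paths s' r)) + comm D1 (Y' r) +
        (\<Sum>q<Suc n. bscale (((lin s')(n := (\<lambda>r. entry (paths s' r) k (Suc k)))) q r) (Y' q))" for r
    proof (cases "r = n")
      case True
      then show ?thesis by (simp add: F'_def F0 Y'_def Y(2) lin0)
    next
      case False
      have "(\<Sum>q<n. bscale (F q r) (cross k (paths s q))) =
          cross k (\<Sum>q<n. bscale (F q r) (paths s q))"
        by (simp add: cross_sum cross_bscale)
      also have "\<dots> = cross k (paths s' r + comm (diff s) (Y r) + (\<Sum>q<n. bscale (lin s' q r) (Y q)))"
        using hom by (simp add: homotopic_def n_def)
      also have "\<dots> = cross k (paths s' r) + cross k (comm (diff s) (Y r)) +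
          (\<Sum>q<n. bscale (lin s' q r) (cross k (Y q)))"
        by (simp add: cross_sum cross_bscale cross_add)
      also have "cross k (comm (diff s) (Y r)) = comm D1 (Y' r) + bscale (entry (Y r) k (Suc k)) M"
        using comm_cross[OF DSU Y(1)[of r], of k] by (simp add: D1_def M_def Y'_def add.assoc)
      finally show ?thesis
        using False by (simp add: F'_def Y'_def Y(2) add_ac)
    qed
    then have "homotopic (advance e s) (advance e s') F' Y'"
      unfolding homotopic_def using early late
      by (simp add: e Crossing D D1_def M_def n_def[symmetric] n' cong: if_cong del: sum.lessThan_Suc)
    then show ?thesis
      unfolding equivalent_readings_def using row Y
      by (intro conjI exI[of _ F'] exI[of _ Y'])
        (auto simp: e Crossing n_def[symmetric] n' Y'_def intro: strict_upper_cross)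
  next
    case (LeftCusp k)
    then have early: "\<not> late s" and n0: "n = 0" using adm(1) e by (auto simp: n_def)
    have D: "diff s' = diff s" using hom[OF early] by (simp add: homotopic_def)
    have "homotopic (advance e s) (advance e s') F (\<lambda>r. 0)"
      unfolding homotopic_def using early late n0 n'
      by (simp add: e LeftCusp D n_def)
    then show ?thesis
      unfolding equivalent_readings_def using n0 n'
      by (intro conjI exI[of _ F] exI[of _ "\<lambda>r. 0"])
        (auto simp: e LeftCusp n_def unitriangular_def intertwines_def)
  next
    case (RightCusp k)
    then have k: "odd k" using adm(1) e by simp
    define F' where "F' = F(n := (\<lambda>r. (if r = n then 1 else 0) + entry (Y r) k (Suc k)))"
    define Y' where "Y' = (\<lambda>r. restrict k (Y r))"
    have zs: "entry (paths s n) k (Suc k) = 0" "\<And>r. n \<le> r \<Longrightarrow> entry (Y r) k (Suc k) = 0"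
      by (simp_all add: Z Y(2))
    have eqs: "(\<Sum>q<n. F q r * entry (paths s q) k (Suc k)) =
        entry (paths s' r) k (Suc k) + (\<Sum>q<n. lin s' q r * entry (Y q) k (Suc k))" for r
      by (rule superdiag) (simp add: k)
    note row = intertwines_new_row[where \<phi> = "\<lambda>r. entry (paths s r) k (Suc k)" and
        y = "\<lambda>r. entry (Y r) k (Suc k)", OF F lin0(1) zs eqs, folded F'_def]
    have "superdiagonal_homotopic (advance e s) (advance e s') F' Y'"
      unfolding superdiagonal_homotopic_def
    proof (intro allI impI)
      fix r j :: nat assume j: "odd j"
      then have sk: "skip_cusp k (Suc j) = Suc (skip_cusp k j)" "odd (skip_cusp k j)"
        using k by (auto simp: skip_cusp_def elim: oddE) presburger
      show "(\<Sum>q<ngen (advance e s). F' q r * entry (paths (advance e s) q) j (Suc j)) =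
          entry (paths (advance e s') r) j (Suc j) +
          (\<Sum>q<ngen (advance e s). lin (advance e s') q r * entry (Y' q) j (Suc j))"
        using superdiag[of "skip_cusp k j" r] sk
        by (simp add: e RightCusp n_def[symmetric] n' Y'_def F'_def Z Y(2))
    qed
    then show ?thesis
      unfolding equivalent_readings_def using row Y
      by (intro conjI exI[of _ F'] exI[of _ Y'])
        (auto simp: e RightCusp n_def[symmetric] n' Y'_def intro!: bmat_eqI strict_upper_restrict)
  qed
qed

lemma equivalent_readings_run:
  assumes "equivalent_readings s s'" "reading s" "reading s'" "good W s" "good W s'"
  shows "equivalent_readings (run W s) (run W s')"
  using assms
  by (induction W arbitrary: s s') (auto intro: equivalent_readings_advance reading_advance)

text \<open>Equivalent readings with the identity as chain map.  In contrast to
  \<^const>\<open>equivalent_readings\<close> this is visibly symmetric, so each move also gives an equivalence in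
  the other direction.\<close>

definition close :: "cstate \<Rightarrow> cstate \<Rightarrow> bool" where
  "close s s' \<longleftrightarrow>
     ngen s = ngen s' \<and> lin s = lin s' \<and> late s = late s' \<and>
     (if late s then \<forall>r k. odd k \<longrightarrow> entry (paths s r) k (Suc k) = entry (paths s' r) k (Suc k)
      else diff s = diff s' \<and>
        (\<exists>Y. (\<forall>r. strict_upper (Y r)) \<and> (\<forall>r \<ge> ngen s. Y r = 0) \<and>
          (\<forall>r. paths s r =
             paths s' r + comm (diff s) (Y r) + (\<Sum>q<ngen s. bscale (lin s q r) (Y q)))))"

lemma closeI:
  assumes "ngen s = ngen s'" "lin s = lin s'" "\<not> late s" "\<not> late s'" "diff s = diff s'"
    "\<And>r. strict_upper (Y r)" "\<And>r. ngen s \<le> r \<Longrightarrow> Y r = 0"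
    "\<And>r. paths s r = paths s' r + comm (diff s) (Y r) + (\<Sum>q<ngen s. bscale (lin s q r) (Y q))"
  shows "close s s'"
  using assms unfolding close_def by auto

lemma close_sym: "close s s' \<Longrightarrow> close s' s"
proof (cases "late s")
  case False
  assume cl: "close s s'"
  then obtain Y where Y: "\<forall>r. strict_upper (Y r)" "\<forall>r \<ge> ngen s. Y r = 0"
    "\<And>r. paths s r = paths s' r + comm (diff s) (Y r) + (\<Sum>q<ngen s. bscale (lin s q r) (Y q))"
    using False by (auto simp: close_def)
  have "paths s' r = paths s r + comm (diff s) (Y r) + (\<Sum>q<ngen s. bscale (lin s q r) (Y q))" for r
    unfolding Y(3)[of r] by (simp add: add_ac)
  moreover have "ngen s' = ngen s" "lin s' = lin s" "\<not> late s'" "diff s' = diff s"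
    using cl False by (auto simp: close_def)
  ultimately show ?thesis using Y(1,2) False unfolding close_def by auto
qed (simp add: close_def)

lemma close_refl: "close s s"
  unfolding close_def by (auto intro!: exI[of _ "\<lambda>r. 0"])

lemma close_equivalent:
  assumes "close s s'" "reading s"
  shows "equivalent_readings s s'"
proof -
  let ?F = "\<lambda>q r. if q = r then 1 else (0::bit)"
  have uni: "unitriangular (ngen s) ?F" by (simp add: unitriangular_def)
  have sum_F: "(\<Sum>q<ngen s. ?F q r * f q) = (if r < ngen s then f r else 0)" for r f
  proof -
    have "(\<Sum>q<ngen s. ?F q r * f q) = (\<Sum>q<ngen s. if q = r then f q else 0)"
      by (intro sum.cong) auto
    then show ?thesis by (simp add: sum.delta)
  qed
  have inter: "intertwines (ngen s) (lin s) (lin s') ?F"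
    unfolding intertwines_def
  proof (intro allI impI)
    fix q r assume q: "q < ngen s"
    have "(\<Sum>t<ngen s. lin s q t * ?F t r) = (if r < ngen s then lin s q r else 0)"
      using sum_F[of r "lin s q"] by (simp add: mult.commute)
    also have "\<dots> = lin s q r" using readingD(3)[OF assms(2) q, of r] q by auto
    also have "\<dots> = (\<Sum>t<ngen s. ?F t q * lin s' t r)"
      using sum_F[of q "\<lambda>t. lin s' t r"] q assms(1) by (simp add: close_def)
    also have "\<dots> = (\<Sum>t<ngen s. ?F q t * lin s' t r)" by (intro sum.cong) auto
    finally show "(\<Sum>t<ngen s. lin s q t * ?F t r) = (\<Sum>t<ngen s. ?F q t * lin s' t r)" .
  qed
  show ?thesis
  proof (cases "late s")
    case True
    have "superdiagonal_homotopic s s' ?F (\<lambda>r. 0)"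
      unfolding superdiagonal_homotopic_def
    proof (intro allI impI)
      fix r k :: nat assume "odd k"
      then have "entry (paths s' r) k (Suc k) = entry (paths s r) k (Suc k)"
        using assms(1) True by (simp add: close_def)
      moreover have "(\<Sum>q<ngen s. ?F q r * entry (paths s q) k (Suc k)) = entry (paths s r) k (Suc k)"
        unfolding sum_F[of r "\<lambda>q. entry (paths s q) k (Suc k)"]
        using readingD(2)[OF assms(2), of r] by simp
      ultimately show "(\<Sum>q<ngen s. ?F q r * entry (paths s q) k (Suc k)) =
        entry (paths s' r) k (Suc k) + (\<Sum>q<ngen s. lin s' q r * entry 0 k (Suc k))"
        by simp
    qed
    then show ?thesis
      using True assms(1) uni inter unfolding equivalent_readings_def
      by (intro conjI exI[of _ ?F] exI[of _ "\<lambda>r. 0"]) (auto simp: close_def)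
  next
    case False
    then obtain Y where Y: "\<forall>r. strict_upper (Y r)" "\<forall>r \<ge> ngen s. Y r = 0"
      "\<And>r. paths s r = paths s' r + comm (diff s) (Y r) + (\<Sum>q<ngen s. bscale (lin s q r) (Y q))"
      using assms(1) by (auto simp: close_def)
    have "(\<Sum>q<ngen s. bscale (?F q r) (paths s q)) = paths s r" for r
    proof -
      have "(\<Sum>q<ngen s. bscale (?F q r) (paths s q)) = (\<Sum>q<ngen s. if q = r then paths s q else 0)"
        by (intro sum.cong) auto
      then show ?thesis using readingD(2)[OF assms(2), of r] by (simp add: sum.delta)
    qed
    then have "homotopic s s' ?F Y"
      using assms(1) False Y(3) by (simp add: homotopic_def close_def)
    then show ?thesis
      using False assms(1) uni inter Y(1,2) unfolding equivalent_readings_def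
      by (intro conjI exI[of _ ?F] exI[of _ Y]) (auto simp: close_def)
  qed
qed

section \<open>The moves\<close>

lemma implicit_at_iff: "(a, b) \<in> implicit_at c k \<longleftrightarrow>
    b = k \<and> a < k \<and> c a (Suc k) = 1 \<or> a = Suc k \<and> Suc k < b \<and> c k b = 1"
  by (auto simp: implicit_at_def)

lemma toggle_iff: "x \<in> toggle p I \<longleftrightarrow> (if x = p then p \<notin> I else x \<in> I)"
  by (auto simp: toggle_def)

lemma bit_plus_eq_one_iff: "x + y = (1 :: bit) \<longleftrightarrow> (x = 1) \<noteq> (y = 1)"
  by (cases x; cases y) auto

lemma left_cusp_rel_slide:
  assumes "left_cusp_rel k I D D'" "i < j"
    "reduce k (slide i j D') = E" "entry D' k (Suc k) = 1 \<Longrightarrow> implicit_at (entry (slide i j D')) k = J"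
  shows "left_cusp_rel k J E (slide i j D')"
  using assms unfolding left_cusp_rel_def
  by (simp add: strict_upper_slide slide_mult slide_superdiagonal)

text \<open>A mark ending on a cusp strand, next to the cusp, adds the entry 1 at \<open>(k, k + 1)\<close> to
  one of the entries recorded by the implicit marks, and the two changes that it makes in
  the reduced differential cancel.\<close>

lemma left_cusp_rel_absorb:
  assumes rel: "left_cusp_rel k I D D'" and ij: "i < k \<and> j = k \<or> i = Suc k \<and> Suc k < j"
  shows "left_cusp_rel k (toggle (i, j) I) D (slide i j D')"
proof (rule left_cusp_rel_slide[OF rel])
  have SU: "strict_upper D'" and one: "entry D' k (Suc k) = 1" and D: "D = reduce k D'"
    and I: "I = implicit_at (entry D') k"
    using rel by (auto simp: left_cusp_rel_def)
  show lt: "i < j" using ij by auto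
  show "reduce k (slide i j D') = D"
    unfolding D
  proof (rule bmat_eqI)
    fix a b
    show "entry (reduce k (slide i j D')) a b = entry (reduce k D') a b"
      using ij one unfolding entry_reduce entry_slide[OF SU lt]
      by (elim disjE) (auto simp: distrib_right distrib_left)
  qed
  show "implicit_at (entry (slide i j D')) k = toggle (i, j) I"
  proof (rule set_eqI)
    fix x :: "nat \<times> nat"
    obtain a b where x: "x = (a, b)" by (cases x)
    show "x \<in> implicit_at (entry (slide i j D')) k \<longleftrightarrow> x \<in> toggle (i, j) I"
      using ij one strict_upperD[OF SU, of k k] strict_upperD[OF SU, of "Suc k" "Suc k"]
      unfolding x toggle_iff I implicit_at_iff entry_slide[OF SU lt]
      by (elim disjE) auto
  qed
qed

text \<open>A mark away from the cusp strands acts on the reduced differential as the mark to the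
  left of the cusp, and on the entries between the cusp strands and its own ends by the rule in
  \<^const>\<open>pass_cusp\<close>.\<close>

lemma left_cusp_rel_pass:
  assumes rel: "left_cusp_rel k I D D'" and ij: "i < j"
  shows "left_cusp_rel k (pass_cusp k (skip_cusp k i) (skip_cusp k j) I) (slide i j D)
     (slide (skip_cusp k i) (skip_cusp k j) D')"
proof (rule left_cusp_rel_slide[OF rel])
  let ?i = "skip_cusp k i" and ?j = "skip_cusp k j"
  have SU: "strict_upper D'" and one: "entry D' k (Suc k) = 1" and D: "D = reduce k D'"
    and I: "I = implicit_at (entry D') k"
    using rel by (auto simp: left_cusp_rel_def)
  show lt: "?i < ?j" using ij by simp
  have DSU: "strict_upper D"
    unfolding strict_upper_def
  proof (intro allI impI)
    fix a b assume "entry D a b \<noteq> 0"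
    then have nz: "entry D' (skip_cusp k a) (skip_cusp k b) +
        entry D' (skip_cusp k a) (Suc k) * entry D' k (skip_cusp k b) \<noteq> 0" by (simp add: D)
    show "a < b"
    proof (rule ccontr)
      assume "\<not> a < b"
      then have le: "skip_cusp k b \<le> skip_cusp k a" by (simp add: not_less flip: not_less)
      then have "entry D' (skip_cusp k a) (Suc k) = 0 \<or> entry D' k (skip_cusp k b) = 0"
        using strict_upperD[OF SU, of "Suc k" "skip_cusp k a"] strict_upperD[OF SU, of "skip_cusp k b" k]
        by (cases "Suc k \<le> skip_cusp k a") auto
      then show False using nz strict_upperD[OF SU le] by auto
    qed
  qed
  \<comment> \<open>The strand \<open>?j\<close> then lies above the cusp, and so does \<open>?i\<close>.\<close>
  have cross0: "entry D' k ?i = 0" if "entry D' ?j (Suc k) = 1"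
  proof (rule strict_upperD[OF SU])
    have "?j < Suc k" using that strict_upperD[OF SU, of "Suc k" ?j] by (metis not_less zero_neq_one)
    then show "?i \<le> k" using lt by (meson less_Suc_eq_le less_trans)
  qed
  show "reduce k (slide ?i ?j D') = slide i j D"
  proof (rule bmat_eqI)
    fix a b
    show "entry (reduce k (slide ?i ?j D')) a b = entry (slide i j D) a b"
      unfolding entry_reduce entry_slide[OF SU lt] entry_slide[OF DSU ij]
      unfolding D entry_reduce using cross0 by (auto simp: algebra_simps)
  qed
  show "implicit_at (entry (slide ?i ?j D')) k = pass_cusp k ?i ?j I"
  proof (rule set_eqI)
    fix x :: "nat \<times> nat"
    obtain a b where x: "x = (a, b)" by (cases x)
    have c1: "?i < k" if "?j < k" using lt that by (rule less_trans)
    have c2: "Suc k < ?j" if "Suc k < ?i" using that lt by (rule less_trans)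
    have z1: "entry D' ?j (Suc k) = 0" if "\<not> ?j < k"
      by (rule strict_upperD[OF SU]) (use that in \<open>auto simp: skip_cusp_def\<close>)
    have z2: "entry D' k ?i = 0" if "\<not> Suc k < ?i"
      by (rule strict_upperD[OF SU]) (use that in \<open>auto simp: skip_cusp_def split: if_splits\<close>)
    show "x \<in> implicit_at (entry (slide ?i ?j D')) k \<longleftrightarrow> x \<in> pass_cusp k ?i ?j I"
    proof (cases "?j < k")
      case True
      then show ?thesis
        using c1[OF True] z2 ij unfolding x pass_cusp_def I
        by (auto simp: toggle_iff implicit_at_iff entry_slide[OF SU lt] bit_plus_eq_one_iff)
    next
      case False
      then show ?thesis
        using c2 z1[OF False] z2 ij unfolding x pass_cusp_def I
        by (auto simp: toggle_iff implicit_at_iff entry_slide[OF SU lt] bit_plus_eq_one_iff)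
    qed
  qed
qed

lemma slide_twice: "k \<noteq> l \<Longrightarrow> slide k l (slide k l X) = X"
  unfolding slide_def by (simp add: mult.assoc del: distrib_left distrib_right)

lemma slide_commute:
  assumes "l \<noteq> k'" "k \<noteq> l'"
  shows "slide k l (slide k' l' X) = slide k' l' (slide k l X)"
proof -
  have *: "(1 + unit k l) * (1 + unit k' l') = (1 + unit k' l') * (1 + unit k l)"
    using assms by (simp add: algebra_simps unit_times_unit)
  have "slide k l (slide k' l' X) =
      ((1 + unit k l) * (1 + unit k' l')) * X * ((1 + unit k' l') * (1 + unit k l))"
    by (simp only: slide_def mult.assoc)
  also have "\<dots> = ((1 + unit k' l') * (1 + unit k l)) * X * ((1 + unit k l) * (1 + unit k' l'))"
    by (simp only: *)
  also have "\<dots> = slide k' l' (slide k l X)"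
    by (simp only: slide_def mult.assoc)
  finally show ?thesis .
qed

text \<open>The commutator relation between elementary matrices.\<close>

lemma slide_braid:
  assumes "k < l" "l < m"
  shows "slide l m (slide k l X) = slide k l (slide k m (slide l m X))"
    and "slide k l (slide l m X) = slide l m (slide k m (slide k l X))"
proof -
  let ?a = "1 + unit k l" and ?b = "1 + unit l m" and ?c = "1 + unit k m"
  have 1: "?b * ?a = ?a * ?c * ?b" and 2: "?a * ?b = ?b * ?c * ?a"
    using assms by (simp_all add: algebra_simps unit_times_unit)
  have "slide l m (slide k l X) = (?b * ?a) * X * (?a * ?b)"
    by (simp only: slide_def mult.assoc)
  also have "\<dots> = slide k l (slide k m (slide l m X))"
    unfolding 1 2 by (simp only: slide_def mult.assoc)
  finally show "slide l m (slide k l X) = slide k l (slide k m (slide l m X))" .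
  have "slide k l (slide l m X) = (?a * ?b) * X * (?b * ?a)"
    by (simp only: slide_def mult.assoc)
  also have "\<dots> = slide l m (slide k m (slide k l X))"
    unfolding 1 2 by (simp only: slide_def mult.assoc)
  finally show "slide k l (slide l m X) = slide l m (slide k m (slide k l X))" .
qed

text \<open>A mark ending on a crossing strand does not slide freely through the crossing.  Conjugation
  by the mark \<open>(i', j')\<close> behind the crossing also moves \<open>unit (k + 1) k\<close>, from which the matrix of
  the crossing is built and to which the removed entries are attached; the homotopy is the
  change of this matrix unit, placed on the new crossing.\<close>

lemma close_slide_crossing:
  assumes R: "reading s" and ij: "i < j" "(i, j) \<noteq> (k, Suc k)"
    and late: "\<not> late s" and D0: "entry (diff s) k (Suc k) = 0"
  defines "i' \<equiv> swap k i" and "j' \<equiv> swap k j"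
  shows "close (run [mark i j, (Crossing k, {})] s) (run [(Crossing k, {}), mark i' j'] s)"
proof -
  have ij': "i' < j'" unfolding i'_def j'_def by (rule transpose_Suc_less[OF ij])
  define n where "n = ngen s"
  define U where "U = unit (Suc k) k"
  define D1 where "D1 = conj_perm k (diff s)"
  define H where "H = 1 + unit i' j'"
  note SU = readingD(1)[OF R]
  have conj: "conj_perm k (slide i j X) = slide i' j' (conj_perm k X)" for X
  proof -
    have H: "H = perm k * (1 + unit i j) * perm k"
      by (simp add: H_def i'_def j'_def algebra_simps perm_unit_perm[unfolded mult.assoc])
    show ?thesis
      unfolding slide_def conj_perm_def H_def[symmetric]
      unfolding H by (simp add: mult.assoc del: distrib_left distrib_right)
  qed
  define Y where "Y = (\<lambda>r. if r = n then U + slide i' j' U else 0)"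
  have slideU: "slide i' j' U = U + (if j' = Suc k then unit i' k else 0) + (if i' = k then unit (Suc k) j' else 0)"
    using ij' ij by (auto simp: U_def slide_def algebra_simps unit_times_unit i'_def j'_def
        Transposition.transpose_def split: if_splits)
  have YSU: "strict_upper (Y r)" for r
    unfolding Y_def slideU using ij' ij
    by (auto simp: strict_upper_unit i'_def j'_def Transposition.transpose_def intro!: strict_upper_plus
        simp flip: add.assoc split: if_splits)
  have lin0: "lin s q n = 0" if "q < n" for q using readingD(3)[OF R] that by (simp add: n_def)
  let ?s = "run [mark i j, (Crossing k, {})] s" and ?s' = "run [(Crossing k, {}), mark i' j'] s"
  have paths: "paths ?s r = (if r = n then comm (slide i' j' D1) U else cross k (slide i j (paths s r)))"
    "paths ?s' r = slide i' j' (if r = n then comm D1 U else cross k (paths s r))" for r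
    by (simp_all add: n_def D1_def U_def conj)
  have lin: "lin ?s = (lin s)(n := (\<lambda>r. entry (paths s r) k (Suc k)))"
    "lin ?s' = (lin s)(n := (\<lambda>r. entry (paths s r) k (Suc k)))"
    by (simp_all add: n_def slide_superdiagonal[OF SU ij(1)])
  have homotopy: "paths ?s r = paths ?s' r + comm (slide i' j' D1) (Y r) + (\<Sum>q<Suc n. bscale (lin ?s q r) (Y q))" for r
  proof (cases "r = n")
    case True
    have "(\<Sum>q<n. bscale (lin s q n) (Y q)) = 0" by (simp add: lin0)
    moreover have "paths s n = 0" using readingD(2)[OF R] by (simp add: n_def)
    ultimately show ?thesis
      using ij' unfolding paths lin True
      by (simp add: Y_def comm_add slide_comm)
  next
    case False
    have "(\<Sum>q<n. bscale (lin s q r) (Y q)) = 0" by (intro sum.neutral) (simp add: Y_def)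
    then have "(\<Sum>q<Suc n. bscale (lin ?s q r) (Y q)) =
        bscale (entry (paths s r) k (Suc k)) (U + slide i' j' U)"
      unfolding lin by (simp add: Y_def)
    moreover have "cross k (slide i j (paths s r)) =
        slide i' j' (conj_perm k (paths s r)) + bscale (entry (paths s r) k (Suc k)) U"
      by (simp add: cross_def conj slide_superdiagonal[OF SU ij(1)] U_def)
    moreover have "slide i' j' (cross k (paths s r)) =
        slide i' j' (conj_perm k (paths s r)) + bscale (entry (paths s r) k (Suc k)) (slide i' j' U)"
      by (simp add: cross_def slide_add slide_bscale U_def)
    ultimately show ?thesis
      using False unfolding paths by (simp add: Y_def bscale_plus add_ac)
  qed
  have ns: "ngen ?s = Suc n" "ngen ?s' = Suc n" "diff ?s = slide i' j' D1" "diff ?s' = slide i' j' D1"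
    "late ?s = late s" "late ?s' = late s"
    by (simp_all add: n_def D1_def conj)
  show ?thesis
  proof (rule closeI[where Y = Y])
    show "Y r = 0" if "ngen ?s \<le> r" for r using that unfolding ns by (simp add: Y_def)
    show "paths ?s r = paths ?s' r + comm (diff ?s) (Y r) + (\<Sum>q<ngen ?s. bscale (lin ?s q r) (Y q))" for r
      unfolding ns by (rule homotopy)
  qed (simp_all only: ns lin late YSU not_False_eq_True)
qed

lemma cstate_eqI:
  assumes "diff s = diff s'" "ngen s = ngen s'" "paths s = paths s'" "lin s = lin s'"
    "late s = late s'"
  shows "s = (s' :: cstate)"
  using assms by (cases s; cases s') simp

lemma odd_skip_cusp: "odd k \<Longrightarrow> odd j \<Longrightarrow> skip_cusp k (Suc j) = Suc (skip_cusp k j) \<and> odd (skip_cusp k j)"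
  by (auto simp: skip_cusp_def elim: oddE) presburger

text \<open>Up to the leftmost right cusp the readings after a move even agree, except for marks pushed
  through a crossing.  At right cusps the mark only affects entries that are irrelevant later on,
  by \<open>slide_superdiagonal\<close>.\<close>

lemma close_local_move:
  assumes move: "local_move U U'" and R: "reading s" and good: "good U s" "good U' s"
  shows "close (run U s) (run U' s)"
  using move
proof cases
  case (move1 k l)
  then have "run U' s = run U s"
    by (intro cstate_eqI) (auto simp: slide_twice)
  then show ?thesis by (simp add: close_refl)
next
  case (move2_5 k l k' l')
  then have "run U' s = run U s"
    by (intro cstate_eqI) (auto simp: slide_commute[of l k' k l'])
  then show ?thesis by (simp add: close_refl)
next
  case (move6 k l m)
  then have "run U' s = run U s"
    by (intro cstate_eqI) (auto simp: slide_braid(1)[of k l m])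
  then show ?thesis by (simp add: close_refl)
next
  case (move6_reflected k l m)
  then have "run U' s = run U s"
    by (intro cstate_eqI) (auto simp: slide_braid(2)[of k l m])
  then show ?thesis by (simp add: close_refl)
next
  case (move7_8_10 i j k)
  then have "\<not> late s" "entry (diff s) k (Suc k) = 0" using good(2) by auto
  then show ?thesis
    unfolding move7_8_10(1,2) by (intro close_slide_crossing[OF R move7_8_10(3,4)])
next
  case (pass_left_cusp i j k I)
  then obtain D' where D': "left_cusp_rel k I (diff s) D'" using good(1) by auto
  note D'' = left_cusp_rel_pass[OF D' \<open>i < j\<close>]
  have "run U' s = run U s"
    unfolding pass_left_cusp(1,2)
    by (intro cstate_eqI) (simp_all add: the_left_cusp_rel[OF D'] the_left_cusp_rel[OF D''])
  then show ?thesis by (simp add: close_refl)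
next
  case (absorb_left_cusp i k j I)
  then obtain D' where D': "left_cusp_rel k I (diff s) D'" using good(1) by auto
  note D'' = left_cusp_rel_absorb[OF D' absorb_left_cusp(3)]
  have "run U' s = run U s"
    unfolding absorb_left_cusp(1,2)
    by (intro cstate_eqI) (simp_all add: the_left_cusp_rel[OF D'] the_left_cusp_rel[OF D''])
  then show ?thesis by (simp add: close_refl)
next
  case (pass_right_cusp i j k I)
  then have k: "odd k" using good(2) by simp
  have lt: "skip_cusp k i < skip_cusp k j" using pass_right_cusp(3) by simp
  note SU = readingD(1)[OF R]
  have "late (run U s)" "late (run U' s)" "ngen (run U s) = ngen (run U' s)"
    by (simp_all add: pass_right_cusp(1,2))
  moreover have "lin (run U s) = lin (run U' s)"
    by (simp add: pass_right_cusp(1,2) slide_superdiagonal[OF SU lt])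
  moreover have "entry (paths (run U s) r) q (Suc q) = entry (paths (run U' s) r) q (Suc q)"
    if "odd q" for r q
    using odd_skip_cusp[OF k that]
    by (simp add: pass_right_cusp(1,2) slide_superdiagonal[OF SU lt]
        slide_superdiagonal[OF strict_upper_restrict[OF SU] pass_right_cusp(3)])
  ultimately show ?thesis by (simp add: close_def)
next
  case (absorb_right_cusp i k j I)
  then have k: "odd k" using good(2) by simp
  have lt: "i < j" using absorb_right_cusp(3) by auto
  note SU = readingD(1)[OF R]
  have "late (run U s)" "late (run U' s)" "ngen (run U s) = ngen (run U' s)"
    by (simp_all add: absorb_right_cusp(1,2))
  moreover have "lin (run U s) = lin (run U' s)"
    by (simp add: absorb_right_cusp(1,2) slide_superdiagonal[OF SU lt])
  moreover have "entry (paths (run U s) r) q (Suc q) = entry (paths (run U' s) r) q (Suc q)"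
    if "odd q" for r q
    using odd_skip_cusp[OF k that]
    by (simp add: absorb_right_cusp(1,2) slide_superdiagonal[OF SU lt])
  ultimately show ?thesis by (simp add: close_def)
qed

definition marks :: "(nat \<times> nat) list \<Rightarrow> marked_front" where
  "marks ms = map (\<lambda>(a, b). mark a b) ms"

text \<open>If no mark ends on the strand on which another one starts, the product of the handleslide
  matrices has no mixed terms.\<close>

lemma run_marks:
  assumes "\<And>a b c d. (a, b) \<in> set ms \<Longrightarrow> (c, d) \<in> set ms \<Longrightarrow> b \<noteq> c"
  defines "G \<equiv> 1 + (\<Sum>(a, b)\<leftarrow>ms. unit a b)"
  shows "run (marks ms) s = s\<lparr>diff := G * diff s * G, paths := (\<lambda>r. G * paths s r * G)\<rparr>"
  using assms(1) unfolding G_def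
proof (induction ms arbitrary: s)
  case Nil
  show ?case by (simp add: marks_def)
next
  case (Cons m ms)
  obtain a b where m: "m = (a, b)" by (cases m)
  let ?N = "\<Sum>(a, b)\<leftarrow>ms. unit a b"
  have IH: "run (marks ms) s =
      s\<lparr>diff := (1 + ?N) * diff s * (1 + ?N), paths := (\<lambda>r. (1 + ?N) * paths s r * (1 + ?N))\<rparr>" for s
    by (rule Cons.IH) (use Cons.prems in auto)
  have "unit a b * (\<Sum>(a, b)\<leftarrow>ns. unit a b) = 0 \<and> (\<Sum>(a, b)\<leftarrow>ns. unit a b) * unit a b = 0"
    if "set ns \<subseteq> set ms" for ns
    using that
  proof (induction ns)
    case (Cons p ns)
    obtain c d where p: "p = (c, d)" by (cases p)
    have "(c, d) \<in> set ms" using Cons.prems p by simp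
    then have "b \<noteq> c" "d \<noteq> a" using \<open>\<And>a' b' c' d'. (a', b') \<in> set (m # ms) \<Longrightarrow> (c', d') \<in> set (m # ms) \<Longrightarrow> b' \<noteq> c'\<close> m
      by fastforce+
    then show ?case using Cons by (simp add: p unit_times_unit distrib_left distrib_right)
  qed simp
  then have "unit a b * ?N = 0" "?N * unit a b = 0" by blast+
  then have *: "(1 + ?N) * (1 + unit a b) = 1 + (unit a b + ?N)"
    "(1 + unit a b) * (1 + ?N) = 1 + (unit a b + ?N)"
    by (simp_all add: algebra_simps)
  have **: "(1 + ?N) * slide a b X * (1 + ?N) = (1 + (unit a b + ?N)) * X * (1 + (unit a b + ?N))" for X
  proof -
    have "(1 + ?N) * slide a b X * (1 + ?N) =
        ((1 + ?N) * (1 + unit a b)) * X * ((1 + unit a b) * (1 + ?N))"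
      by (simp only: slide_def mult.assoc)
    then show ?thesis by (simp only: *)
  qed
  have "run (marks (m # ms)) s = run (marks ms) (advance (mark a b) s)"
    by (simp add: marks_def m)
  also have "\<dots> = s\<lparr>diff := (1 + (unit a b + ?N)) * diff s * (1 + (unit a b + ?N)),
      paths := (\<lambda>r. (1 + (unit a b + ?N)) * paths s r * (1 + (unit a b + ?N)))\<rparr>"
    unfolding IH by (simp add: **)
  finally show ?case by (simp add: m)
qed

lemma close_late_marks:
  assumes "reading s" "late s" "\<And>a b. (a, b) \<in> set ms \<Longrightarrow> a < b"
  shows "close s (run (marks ms) s)"
  using assms
proof (induction ms arbitrary: s)
  case Nil
  show ?case by (simp add: marks_def close_refl)
next
  case (Cons m ms)
  obtain a b where m: "m = (a, b)" by (cases m)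
  have ab: "a < b" using Cons.prems(3) m by simp
  let ?s = "advance (mark a b) s"
  have "reading ?s" by (rule reading_advance[OF Cons.prems(1)]) (simp add: ab)
  then have "close ?s (run (marks ms) ?s)"
    by (rule Cons.IH) (use Cons.prems in auto)
  then have "close s (run (marks ms) ?s)"
    using Cons.prems(2) by (simp add: close_def slide_superdiagonal[OF readingD(1)[OF Cons.prems(1)] ab])
  then show ?case by (simp add: marks_def m)
qed

text \<open>The marks of \<^const>\<open>move15\<close> conjugate by \<open>G = 1 + [D, K]\<close> with the matrix unit \<open>K = unit i j\<close>; the
  marks ending on the strand \<open>j\<close> come from \<open>D * K\<close> and those starting on \<open>i\<close> from \<open>K * D\<close>.
  Since \<open>G\<close> commutes with \<open>D\<close>, the differential does not change.  For the paths, \<open>[[D, K], \<Phi>]\<close> is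
  \<open>[D, [K, \<Phi>]] + [K, [D, \<Phi>]]\<close> by the Jacobi identity, and \<open>[D, \<Phi>] = d\<^sub>1 \<Phi>\<close>
  turns the second summand into \<open>d\<^sub>1 [K, \<Phi>]\<close>.\<close>

lemma close_homotopy_marks:
  assumes R: "reading s" and ij: "i < j"
    and us: "distinct us" "set us = {u. entry (diff s) u i = 1}"
    and vs: "distinct vs" "set vs = {v. entry (diff s) j v = 1}"
    and ms: "ms = map (\<lambda>u. (u, j)) us @ map (\<lambda>v. (i, v)) vs \<or> ms = map (\<lambda>v. (i, v)) vs @ map (\<lambda>u. (u, j)) us"
    and lt: "\<And>a b. (a, b) \<in> set ms \<Longrightarrow> a < b"
  shows "close s (run (marks ms) s)"
proof (cases "late s")
  case True
  then show ?thesis by (intro close_late_marks R lt)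
next
  case False
  define D where "D = diff s"
  define K where "K = unit i j"
  define N where "N = comm D K"
  define G where "G = 1 + N"
  have SU: "strict_upper D" and sq: "D * D = 0"
    using readingD(4,5)[OF R False] by (simp_all add: D_def)
  have mem_us: "u \<in> set us \<longleftrightarrow> entry D u i = 1" for u unfolding us(2) D_def by simp
  have mem_vs: "v \<in> set vs \<longleftrightarrow> entry D j v = 1" for v unfolding vs(2) D_def by simp
  have usi: "u < i" if "u \<in> set us" for u
  proof -
    have "entry D u i = 1" using that mem_us by blast
    then show ?thesis using SU unfolding strict_upper_def by simp
  qed
  have vsj: "j < v" if "v \<in> set vs" for v
  proof -
    have "entry D j v = 1" using that mem_vs by blast
    then show ?thesis using SU unfolding strict_upper_def by simp
  qed
  have ends: "a \<in> set us \<and> b = j \<or> a = i \<and> b \<in> set vs" if "(a, b) \<in> set ms" for a b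
    using ms that by (elim disjE) auto
  have sep: "b \<noteq> c" if "(a, b) \<in> set ms" "(c, d) \<in> set ms" for a b c d
  proof -
    have "j \<le> b" using ends[OF that(1)] vsj by (auto intro: less_imp_le)
    moreover have "c \<le> i" using ends[OF that(2)] usi by (auto intro: less_imp_le)
    ultimately show ?thesis using ij by simp
  qed
  have DK: "D * K = (\<Sum>u\<leftarrow>us. unit u j)"
  proof (rule bmat_eqI)
    fix a b
    have "entry (\<Sum>u\<leftarrow>us. unit u j) a b = (\<Sum>u\<in>set us. if u = a then (if b = j then 1 else 0) else 0)"
      unfolding sum_list_distinct_conv_sum_set[OF us(1)] entry_sum by (intro sum.cong) (auto simp: entry_unit)
    also have "\<dots> = (if b = j then entry D a i else 0)"
      using mem_us[of a] by (cases "entry D a i") (auto simp: sum.delta)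
    finally show "entry (D * K) a b = entry (\<Sum>u\<leftarrow>us. unit u j) a b" by (simp add: K_def)
  qed
  have KD: "K * D = (\<Sum>v\<leftarrow>vs. unit i v)"
  proof (rule bmat_eqI)
    fix a b
    have "entry (\<Sum>v\<leftarrow>vs. unit i v) a b = (\<Sum>v\<in>set vs. if v = b then (if a = i then 1 else 0) else 0)"
      unfolding sum_list_distinct_conv_sum_set[OF vs(1)] entry_sum by (intro sum.cong) (auto simp: entry_unit)
    also have "\<dots> = (if a = i then entry D j b else 0)"
      using mem_vs[of b] by (cases "entry D j b") (auto simp: sum.delta)
    finally show "entry (K * D) a b = entry (\<Sum>v\<leftarrow>vs. unit i v) a b" by (simp add: K_def)
  qed
  have "(\<Sum>(a, b)\<leftarrow>ms. unit a b) = N"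
    using ms by (auto simp: N_def comm_def DK KD comp_def add.commute)
  then have run: "run (marks ms) s = s\<lparr>diff := G * D * G, paths := (\<lambda>r. G * paths s r * G)\<rparr>"
    using run_marks[OF sep] by (simp add: G_def D_def)
  have KDK: "K * (D * K) = 0" and KK: "K * K = 0"
    using ij by (auto simp: K_def unit_times_unit strict_upperD[OF SU] intro!: bmat_eqI)
  have KSU: "strict_upper K" using ij by (simp add: K_def strict_upper_unit)
  have DDX: "D * (D * X) = 0" and KKX: "K * (K * X) = 0" and KDKX: "K * (D * (K * X)) = 0" for X
  proof -
    show "D * (D * X) = 0" using sq by (simp flip: mult.assoc)
    show "K * (K * X) = 0" using KK by (simp flip: mult.assoc)
    have "K * (D * (K * X)) = K * (D * K) * X" by (simp only: mult.assoc)
    then show "K * (D * (K * X)) = 0" by (simp add: KDK)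
  qed
  have GG: "G * G = 1"
    by (simp add: G_def N_def comm_def algebra_simps KDKX KDK DDX KKX sq KK)
  then have GGX: "G * (G * X) = X" for X by (simp flip: mult.assoc)
  have DG: "D * G = G * D"
    by (simp add: G_def N_def comm_def algebra_simps DDX sq)
  then have DGX: "D * (G * X) = G * (D * X)" for X by (simp only: flip: mult.assoc)
  define Y where "Y = (\<lambda>r. comm K (paths s r) * G)"
  have "close s (run (marks ms) s)"
    unfolding run
  proof (rule closeI[where Y = Y])
    show "strict_upper (Y r)" for r
    proof -
      have "strict_upper (comm K (paths s r))"
        by (intro strict_upper_comm KSU readingD(1)[OF R])
      moreover have "strict_upper N" unfolding N_def by (intro strict_upper_comm KSU SU)
      ultimately show ?thesis by (auto simp: Y_def G_def distrib_left)
    qed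
    show "Y r = 0" if "ngen s \<le> r" for r using readingD(2)[OF R that] by (simp add: Y_def)
    show "diff s = diff (s\<lparr>diff := G * D * G, paths := \<lambda>r. G * paths s r * G\<rparr>)"
      by (simp add: D_def[symmetric] DGX DG[symmetric] mult.assoc GG)
    fix r
    let ?X = "paths s r"
    have "(\<Sum>q<ngen s. bscale (lin s q r) (Y q)) = comm K (\<Sum>q<ngen s. bscale (lin s q r) (paths s q)) * G"
      by (simp add: Y_def comm_sum comm_bscale bscale_mult_right sum_distrib_right)
    also have "\<dots> = comm K (comm D ?X) * G"
      by (simp only: readingD(6)[OF R False] D_def)
    finally have sum: "(\<Sum>q<ngen s. bscale (lin s q r) (Y q)) = comm K (comm D ?X) * G" .
    have "comm D (Y r) = comm D (comm K ?X) * G"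
      by (simp add: Y_def comm_def distrib_right mult.assoc DG)
    then have "comm D (Y r) + (\<Sum>q<ngen s. bscale (lin s q r) (Y q)) =
        (comm D (comm K ?X) + comm K (comm D ?X)) * G"
      by (simp add: sum distrib_right)
    also have "comm D (comm K ?X) + comm K (comm D ?X) = comm N ?X"
      by (simp add: N_def comm_def algebra_simps)
    also have "comm N ?X = comm G ?X"
      by (simp add: G_def comm_def algebra_simps)
    also have "comm G ?X * G = G * ?X * G + ?X"
      by (simp add: comm_def distrib_right mult.assoc GG)
    finally show "paths s r = paths (s\<lparr>diff := G * D * G, paths := \<lambda>r. G * paths s r * G\<rparr>) r +
        comm (diff s) (Y r) + (\<Sum>q<ngen s. bscale (lin s q r) (Y q))"
      by (simp add: D_def add.assoc)
  qed (use False in simp_all)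
  then show ?thesis .
qed

lemma equivalent_readings_replace:
  assumes "good (A @ U @ B) start" "good (A @ U' @ B) start"
    and "close (run U (run A start)) (run U' (run A start))"
  shows "equivalent_readings (run (A @ U @ B) start) (run (A @ U' @ B) start)"
proof -
  have R: "reading (run A start)"
    using reading_run[OF reading_start] assms(1) by (simp add: good_append)
  then have RU: "reading (run U (run A start))" "reading (run U' (run A start))"
    using assms(1,2) by (auto simp: good_append intro: reading_run)
  have "equivalent_readings (run U (run A start)) (run U' (run A start))"
    by (rule close_equivalent[OF assms(3) RU(1)])
  then have "equivalent_readings (run B (run U (run A start))) (run B (run U' (run A start)))"
    by (rule equivalent_readings_run[OF _ RU]) (use assms(1,2) in \<open>auto simp: good_append\<close>)
  then show ?thesis by simp
qed

section \<open>Consecutive complexes\<close>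

text \<open>The isomorphisms between consecutive complexes are turned into equations between
  coefficients.  They also relate the numbers of strands and the Maslov potentials on the two
  sides, so these can be followed along the front without looking at the curve again.\<close>

definition stranded :: "nat \<Rightarrow> (nat \<Rightarrow> int) \<Rightarrow> (nat \<Rightarrow> nat \<Rightarrow> bit) \<Rightarrow> nat based_complex" where
  "stranded N g c = \<lparr>basis = {1..N}, degr = g, bd = linear_ext {1..N} c\<rparr>"

lemma stranded_simps [simp]:
  "basis (stranded N g c) = {1..N}" "degr (stranded N g c) = g"
  "bd (stranded N g c) = linear_ext {1..N} c"
  by (simp_all add: stranded_def)

definition supported :: "nat \<Rightarrow> (nat \<Rightarrow> nat \<Rightarrow> bit) \<Rightarrow> bool" where
  "supported N c \<longleftrightarrow> (\<forall>i j. c i j \<noteq> 0 \<longrightarrow> 1 \<le> i \<and> i < j \<and> j \<le> N)"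

lemma supportedD: "supported N c \<Longrightarrow> c i j = 1 \<Longrightarrow> 1 \<le> i \<and> i < j \<and> j \<le> N"
  unfolding supported_def by auto

lemma supported_zero: "supported N c \<Longrightarrow> \<not> (1 \<le> i \<and> i < j \<and> j \<le> N) \<Longrightarrow> c i j = 0"
  unfolding supported_def by blast

lemma sum_bit_nonzeroE:
  assumes "(\<Sum>a\<in>B. f a) = (1 :: bit)"
  obtains a where "a \<in> B" "f a = 1"
proof -
  have "\<exists>a\<in>B. f a \<noteq> 0" using assms by (metis sum.neutral zero_neq_one)
  then show ?thesis using that by auto
qed

lemma linear_ext_gen: "finite B \<Longrightarrow> i \<in> B \<Longrightarrow> linear_ext B f (gen i) = f i"
  unfolding linear_ext_def gen_def
proof (rule ext)
  fix b assume "finite B" "i \<in> B"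
  have "(\<Sum>a\<in>B. (if a = i then 1 else 0) * f a b) = (\<Sum>a\<in>B. if a = i then f a b else 0)"
    by (intro sum.cong) auto
  then show "(\<Sum>a\<in>B. (if a = i then 1 else 0) * f a b) = f i b"
    using \<open>finite B\<close> \<open>i \<in> B\<close> by (simp add: sum.delta)
qed

lemma linear_ext_index:
  assumes "finite B" "inj f"
  shows "linear_ext B (\<lambda>i. gen (f i)) v (f j) = (if j \<in> B then v j else 0)"
proof -
  have "linear_ext B (\<lambda>i. gen (f i)) v (f j) = (\<Sum>a\<in>B. if a = j then v a else 0)"
    unfolding linear_ext_def gen_def using inj_eq[OF assms(2)] by (intro sum.cong) auto
  then show ?thesis using assms(1) by (simp add: sum.delta)
qed

lemma linear_ext_index_other:
  "b \<notin> f ` B \<Longrightarrow> linear_ext B (\<lambda>i. gen (f i)) v b = 0"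
  unfolding linear_ext_def gen_def by (intro sum.neutral) auto

lemma gen_in_chains [simp]: "gen i \<in> chains K \<longleftrightarrow> i \<in> basis K"
  by (auto simp: chains_def gen_def)

lemma homogeneous_gen: "i \<in> basis K \<Longrightarrow> homogeneous K (degr K i) (gen i)"
  unfolding homogeneous_def by (simp add: gen_def[of i, THEN fun_cong])

lemma homogeneousD: "homogeneous K d v \<Longrightarrow> v a = 1 \<Longrightarrow> a \<in> basis K \<and> degr K a = d"
  by (auto simp: homogeneous_def chains_def)

lemma chain_complex_stranded:
  assumes "chain_complex (stranded N g c)" "supported N c"
  shows "c i j = 1 \<Longrightarrow> g j = g i - 1"
    and "(\<Sum>l\<in>{1..N}. c i l * c l j) = 0"
proof -
  show "g j = g i - 1" if "c i j = 1"
  proof -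
    have i: "i \<in> {1..N}" using supportedD[OF assms(2) that] by auto
    have "homogeneous (stranded N g c) (g i - 1) (bd (stranded N g c) (gen i))"
      using assms(1) homogeneous_gen[of i "stranded N g c"] i unfolding chain_complex_def by simp
    then show ?thesis using homogeneousD that i by (fastforce simp: linear_ext_gen)
  qed
  show "(\<Sum>l\<in>{1..N}. c i l * c l j) = 0"
  proof (cases "i \<in> {1..N}")
    case True
    then have "bd (stranded N g c) (bd (stranded N g c) (gen i)) = (\<lambda>a. 0)"
      using assms(1) unfolding chain_complex_def by simp
    then have "linear_ext {1..N} c (c i) j = 0"
      using True by (simp add: linear_ext_gen)
    then show ?thesis by (simp add: linear_ext_def)
  next
    case False
    then have "c i l = 0" for l by (intro supported_zero[OF assms(2)]) auto
    then show ?thesis by simp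
  qed
qed

lemma crossing_iso:
  assumes iso: "complex_iso (stranded N g c) (stranded N' g' c')
      (index_map (stranded N g c) (swap k))"
    and sup: "supported N c" "supported N' c'"
  defines "\<sigma> \<equiv> swap k"
  shows "\<sigma> i \<in> {1..N'} \<longleftrightarrow> i \<in> {1..N}"
    and "i \<in> {1..N} \<Longrightarrow> g' (\<sigma> i) = g i"
    and "c' (\<sigma> i) (\<sigma> j) = c i j"
proof -
  let ?K = "stranded N g c" and ?K' = "stranded N' g' c'"
  define f where "f = linear_ext {1..N} (\<lambda>i. gen (\<sigma> i))"
  have f: "index_map ?K (swap k) = f"
    by (simp add: index_map_def f_def \<sigma>_def)
  have inj: "inj \<sigma>" by (simp add: \<sigma>_def)
  have inv: "\<sigma> (\<sigma> a) = a" for a by (simp add: \<sigma>_def)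
  note I = iso[unfolded complex_iso_def f]
  have f_gen: "f (gen a) = gen (\<sigma> a)" if "a \<in> {1..N}" for a
    using that by (simp add: f_def linear_ext_gen)
  have hom: "homogeneous ?K' (g a) (gen (\<sigma> a))" if "a \<in> {1..N}" for a
    using I homogeneous_gen[of a ?K] f_gen[OF that] that by fastforce
  have forward: "\<sigma> a \<in> {1..N'} \<and> g' (\<sigma> a) = g a" if "a \<in> {1..N}" for a
    using homogeneousD[OF hom[OF that], of "\<sigma> a"] by (simp add: gen_def)
  have backward: "a \<in> {1..N}" if a: "\<sigma> a \<in> {1..N'}" for a
  proof -
    have "gen (\<sigma> a) \<in> chains ?K'" using a by simp
    then obtain v where "gen (\<sigma> a) = f v"
      using I unfolding bij_betw_def by (metis (no_types, lifting) image_iff)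
    then have "f v (\<sigma> a) = 1" by (metis gen_def)
    then show ?thesis unfolding f_def linear_ext_index[OF finite_atLeastAtMost inj]
      by (metis zero_neq_one)
  qed
  show "\<sigma> i \<in> {1..N'} \<longleftrightarrow> i \<in> {1..N}" using forward backward by blast
  show "i \<in> {1..N} \<Longrightarrow> g' (\<sigma> i) = g i" using forward by blast
  show "c' (\<sigma> i) (\<sigma> j) = c i j"
  proof (cases "i \<in> {1..N}")
    case True
    have "f (bd ?K (gen i)) = bd ?K' (f (gen i))"
      using I True by simp
    then have "f (c i) = c' (\<sigma> i)"
      using True forward[OF True] by (simp add: linear_ext_gen f_gen)
    then have "f (c i) (\<sigma> j) = c' (\<sigma> i) (\<sigma> j)" by simp
    then show ?thesis
      unfolding f_def linear_ext_index[OF finite_atLeastAtMost inj]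
      using supported_zero[OF sup(1), of i j] by (auto split: if_splits)
  next
    case False
    then have "\<sigma> i \<notin> {1..N'}" using backward by blast
    then have "c' (\<sigma> i) (\<sigma> j) = 0" by (intro supported_zero[OF sup(2)]) auto
    moreover have "c i j = 0" using False by (intro supported_zero[OF sup(1)]) auto
    ultimately show ?thesis by simp
  qed
qed

lemma handleslide_iso:
  assumes iso: "complex_iso (stranded N g c) (stranded N' g' c') (handleslide_map (stranded N g c) k l)"
    and sup: "supported N c" "supported N' c'" and kl: "1 \<le> k" "k < l"
  shows "N' = N"
    and "i \<in> {1..N} \<Longrightarrow> g' i = g i"
    and "k \<in> {1..N} \<Longrightarrow> l \<in> {1..N} \<and> g l = g k"
    and "c' i j = c i j + (if i = k then c l j else 0) + (if j = l then c i k else 0)"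
proof -
  let ?K = "stranded N g c" and ?K' = "stranded N' g' c'"
  define h where "h = (\<lambda>i. if i = k then (\<lambda>b. gen k b + gen l b) else gen i)"
  define f where "f = linear_ext {1..N} h"
  have f: "handleslide_map ?K k l = f"
    by (simp add: handleslide_map_def f_def h_def)
  note I = iso[unfolded complex_iso_def f]
  have f_gen: "f (gen a) = h a" if "a \<in> {1..N}" for a
    using that by (simp add: f_def linear_ext_gen)
  have hom: "homogeneous ?K' (g a) (h a)" if "a \<in> {1..N}" for a
    using I homogeneous_gen[of a ?K] f_gen[OF that] that by fastforce
  have h1: "h a a = 1" "h k l = 1" for a using kl by (auto simp: h_def gen_def)
  have f_entry: "f v b = (if b \<in> {1..N} then v b else 0) + (if b = l \<and> k \<in> {1..N} then v k else 0)" for v b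
  proof -
    have "f v b = (\<Sum>a\<in>{1..N}. (if a = b then v a else 0) + (if a = k then (if b = l then v a else 0) else 0))"
      unfolding f_def linear_ext_def h_def gen_def by (intro sum.cong) auto
    also have "\<dots> = (\<Sum>a\<in>{1..N}. if a = b then v a else 0) +
        (\<Sum>a\<in>{1..N}. if a = k then (if b = l then v a else 0) else 0)"
      by (rule sum.distrib)
    finally show ?thesis by (simp add: sum.delta)
  qed
  have up: "a \<in> {1..N'} \<and> g' a = g a" if "a \<in> {1..N}" for a
    using homogeneousD[OF hom[OF that] h1(1)] by simp
  have l: "l \<in> {1..N'} \<and> g' l = g k" if "k \<in> {1..N}"
    using homogeneousD[OF hom[OF that] h1(2)] by simp
  have down: "b \<in> {1..N}" if b: "b \<in> {1..N'}" for b
  proof (rule ccontr)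
    assume nb: "b \<notin> {1..N}"
    have "gen b \<in> chains ?K'" using b by simp
    then obtain v where v: "gen b = f v"
      using I unfolding bij_betw_def by (metis (no_types, lifting) image_iff)
    have "f v b = 1" unfolding v[symmetric] by (simp add: gen_def)
    then have "b = l" "k \<in> {1..N}" "v k = 1"
      using nb by (auto simp: f_entry split: if_splits)
    then have "f v k = 1" using kl by (simp add: f_entry)
    then have "k = b" unfolding v[symmetric] by (simp add: gen_def split: if_splits)
    then show False using \<open>b = l\<close> kl by simp
  qed
  have eq: "{1..N'} = {1..N}" using up down by blast
  then show N: "N' = N" by (metis card_atLeastAtMost diff_Suc_1)
  show g: "i \<in> {1..N} \<Longrightarrow> g' i = g i" for i using up by blast
  show "k \<in> {1..N} \<Longrightarrow> l \<in> {1..N} \<and> g l = g k" using l g N by metis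
  have comm: "f (c i) b = linear_ext {1..N'} c' (h i) b" if "i \<in> {1..N}" for i b
  proof -
    have "f (bd ?K (gen i)) = bd ?K' (f (gen i))" using I that by simp
    then show ?thesis using that by (simp add: linear_ext_gen f_gen)
  qed
  have fc: "f (c i) b = c i b + (if b = l then c i k else 0)" for i b
  proof -
    have "c i b = 0" if "b \<notin> {1..N}" using that by (intro supported_zero[OF sup(1)]) auto
    moreover have "c i k = 0" if "k \<notin> {1..N}" using that by (intro supported_zero[OF sup(1)]) auto
    ultimately show ?thesis by (auto simp: f_entry)
  qed
  have row: "c' i b = c i b + (if b = l then c i k else 0)" if i: "i \<in> {1..N}" "i \<noteq> k" for i b
    using comm[OF i(1), of b] i N unfolding fc h_def by (simp add: linear_ext_gen)
  have rowk: "c' k b + c' l b = c k b + (if b = l then c k k else 0)" if k: "k \<in> {1..N}" for b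
  proof -
    have l: "l \<in> {1..N}" using l[OF k] N by simp
    have "linear_ext {1..N'} c' (h k) b =
        linear_ext {1..N'} c' (gen k) b + linear_ext {1..N'} c' (gen l) b"
      by (simp add: linear_ext_def h_def distrib_right sum.distrib)
    then show ?thesis using comm[OF k, of b] k l N unfolding fc by (simp add: linear_ext_gen)
  qed
  have out: "c i b = 0" "c' i b = 0" if "i \<notin> {1..N}" for i b
    using that N by (auto intro!: supported_zero[OF sup(1)] supported_zero[OF sup(2)])
  show "c' i j = c i j + (if i = k then c l j else 0) + (if j = l then c i k else 0)"
  proof (cases "i = k")
    case False
    then show ?thesis using row[of i j] out[of i] by (cases "i \<in> {1..N}") auto
  next
    case True
    show ?thesis
    proof (cases "k \<in> {1..N}")
      case k: True
      have lN: "l \<in> {1..N}" using l[OF k] N by simp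
      have "c l k = 0" using kl by (intro supported_zero[OF sup(1)]) auto
      then have "c' l j = c l j" using row[OF lN] kl by simp
      then have "c' k j = c k j + c l j + (if j = l then c k k else 0)"
        using rowk[OF k, of j] by (metis add.commute add.left_commute bit_sum_zero_iff add_0)
      then show ?thesis using True by simp
    next
      case False
      then have "l \<notin> {1..N}" using kl by auto
      then show ?thesis using True False out by simp
    qed
  qed
qed

text \<open>In the quotient by the span of \<open>e\<^sub>k\<close> and \<open>\<delta> e\<^sub>k\<close> the generator \<open>e\<^sub>k\<close> vanishes and
  \<open>e\<^sub>k\<^sub>+\<^sub>1\<close> becomes the rest of \<open>\<delta> e\<^sub>k\<close>.  In the proof the coefficient of \<open>e\<^sub>k\<^sub>+\<^sub>1\<close>
  tells the multiple of \<open>\<delta> e\<^sub>k\<close> in an element of the span.\<close>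

lemma cusp_quotient_iso:
  assumes iso: "quotient_iso (stranded N g c) (stranded N' g' c')
      (gen_bd_span (stranded N' g' c') k) (index_map (stranded N g c) (skip_cusp k))"
    and sup: "supported N c" "supported N' c'" and one: "c' k (Suc k) = 1"
  defines "\<tau> \<equiv> skip_cusp k"
  shows "\<tau> i \<in> {1..N'} \<longleftrightarrow> i \<in> {1..N}"
    and "i \<in> {1..N} \<Longrightarrow> g' (\<tau> i) = g i"
    and "c i j = c' (\<tau> i) (\<tau> j) + c' (\<tau> i) (Suc k) * c' k (\<tau> j)"
proof -
  let ?K = "stranded N g c" and ?K' = "stranded N' g' c'"
  let ?S = "gen_bd_span ?K' k"
  define f where "f = linear_ext {1..N} (\<lambda>i. gen (\<tau> i))"
  have f: "index_map ?K (skip_cusp k) = f"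
    by (simp add: index_map_def f_def \<tau>_def)
  have inj: "inj \<tau>" by (simp add: \<tau>_def inj_def)
  note I = iso[unfolded quotient_iso_def f]
  have k: "1 \<le> k" "k \<in> {1..N'}" using supportedD[OF sup(2) one] by auto
  have f_gen: "f (gen a) = gen (\<tau> a)" if "a \<in> {1..N}" for a
    using that by (simp add: f_def linear_ext_gen)
  have f_entry: "f v (\<tau> a) = (if a \<in> {1..N} then v a else 0)" for v a
    unfolding f_def by (rule linear_ext_index[OF finite_atLeastAtMost inj])
  have f_cusp: "f v (Suc k) = 0" for v
    unfolding f_def by (rule linear_ext_index_other) (auto simp: \<tau>_def)
  have S: "\<exists>s t. v = (\<lambda>b. s * gen k b + t * c' k b)" if "v \<in> ?S" for v
    using that k by (auto simp: gen_bd_span_def linear_ext_gen)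
  have S0: "(\<lambda>b. 0) \<in> ?S"
    unfolding gen_bd_span_def by (rule CollectI, rule exI[of _ 0], rule exI[of _ 0]) simp
  have coset: "\<exists>s t. \<forall>b. w b = v b + (s * gen k b + t * c' k b)"
    if "coset ?S v = coset ?S w" for v w
  proof -
    have "w \<in> coset ?S w"
      unfolding coset_def using S0 by (intro CollectI exI[of _ "\<lambda>b. 0"]) simp
    then have "w \<in> coset ?S v" by (simp only: that)
    then obtain u where u: "u \<in> ?S" "w = (\<lambda>a. v a + u a)" by (auto simp: coset_def)
    then show ?thesis using S[OF u(1)] by auto
  qed
  have hom: "homogeneous ?K' (g a) (gen (\<tau> a))" if "a \<in> {1..N}" for a
    using I homogeneous_gen[of a ?K] f_gen[OF that] that by fastforce
  have forward: "\<tau> a \<in> {1..N'} \<and> g' (\<tau> a) = g a" if "a \<in> {1..N}" for a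
    using homogeneousD[OF hom[OF that], of "\<tau> a"] by (simp add: gen_def)
  have backward: "a \<in> {1..N}" if a: "\<tau> a \<in> {1..N'}" for a
  proof -
    have "gen (\<tau> a) \<in> chains ?K'" using a by simp
    then have "coset ?S (gen (\<tau> a)) \<in> coset ?S ` chains ?K'" by (rule imageI)
    also have "\<dots> = (\<lambda>v. coset ?S (f v)) ` chains ?K"
      using I by (simp add: bij_betw_def)
    finally obtain v where v: "coset ?S (gen (\<tau> a)) = coset ?S (f v)" by (rule imageE)
    obtain s t where st: "\<forall>b. f v b = gen (\<tau> a) b + (s * gen k b + t * c' k b)"
      using coset[OF v] by blast
    have "t = 0" using st[rule_format, of "Suc k"] one by (simp add: f_cusp gen_def \<tau>_def)
    then have "f v (\<tau> a) = 1" using st[rule_format, of "\<tau> a"] by (simp add: gen_def \<tau>_def)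
    then show ?thesis by (metis f_entry zero_neq_one)
  qed
  show "\<tau> i \<in> {1..N'} \<longleftrightarrow> i \<in> {1..N}" using forward backward by blast
  show "i \<in> {1..N} \<Longrightarrow> g' (\<tau> i) = g i" using forward by blast
  show "c i j = c' (\<tau> i) (\<tau> j) + c' (\<tau> i) (Suc k) * c' k (\<tau> j)"
  proof (cases "i \<in> {1..N}")
    case True
    have "coset ?S (f (bd ?K (gen i))) = coset ?S (bd ?K' (f (gen i)))"
      using I True by simp
    then have "coset ?S (f (c i)) = coset ?S (c' (\<tau> i))"
      using True forward[OF True] by (simp add: linear_ext_gen f_gen)
    then obtain s t where st: "\<And>b. c' (\<tau> i) b = f (c i) b + (s * gen k b + t * c' k b)"
      using coset by blast
    have t: "c' (\<tau> i) (Suc k) = t" using st[of "Suc k"] one by (simp add: f_cusp gen_def)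
    have "f (c i) (\<tau> j) = c i j"
      using supported_zero[OF sup(1), of i j] by (auto simp: f_entry)
    then have "c' (\<tau> i) (\<tau> j) = c i j + t * c' k (\<tau> j)"
      using st[of "\<tau> j"] by (simp add: gen_def \<tau>_def)
    then show ?thesis unfolding t by (simp add: add.assoc)
  next
    case False
    then have "\<tau> i \<notin> {1..N'}" using backward by blast
    then have "c' (\<tau> i) b = 0" for b by (intro supported_zero[OF sup(2)]) auto
    moreover have "c i j = 0" using False by (intro supported_zero[OF sup(1)]) auto
    ultimately show ?thesis by simp
  qed
qed

section \<open>Fronts of Legendrian knots\<close>

locale plat_knot =
  fixes \<gamma> :: space_curve
  assumes knot: "legendrian_knot \<gamma>" and plat: "nearly_plat \<gamma>"
begin

abbreviation x where "x \<equiv> cx \<gamma>"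
abbreviation y where "y \<equiv> cy \<gamma>"
abbreviation z where "z \<equiv> cz \<gamma>"
abbreviation dx where "dx \<equiv> deriv (cx \<gamma>)"

lemma front_proj_gamma: "front_proj (\<gamma> t) = (x t, z t)"
  by (simp add: front_proj_def cx_def cz_def)

lemma mem_front: "(a, c) \<in> front \<gamma> \<longleftrightarrow> (\<exists>t. x t = a \<and> z t = c)"
  by (auto simp: front_def image_iff front_proj_gamma)

lemma smooth: "smooth_fun x" "smooth_fun y" "smooth_fun z"
  using knot by (simp_all add: legendrian_knot_def)

lemma smooth_DERIV: "smooth_fun f \<Longrightarrow> ((deriv ^^ k) f has_real_derivative (deriv ^^ Suc k) f t) (at t)"
  unfolding smooth_fun_def differentiable_on_def
  by (simp add: DERIV_deriv_iff_real_differentiable)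

lemma DERIV_x: "(x has_real_derivative dx t) (at t)"
  and DERIV_y: "(y has_real_derivative deriv y t) (at t)"
  and DERIV_z: "(z has_real_derivative y t * dx t) (at t)"
  and DERIV_dx: "(dx has_real_derivative (deriv ^^ 2) x t) (at t)"
proof -
  have dz: "deriv z t = y t * dx t" using knot by (simp add: legendrian_knot_def)
  show "(x has_real_derivative dx t) (at t)" "(y has_real_derivative deriv y t) (at t)"
    using smooth_DERIV[OF smooth(1), of 0 t] smooth_DERIV[OF smooth(2), of 0 t] by simp_all
  show "(z has_real_derivative y t * dx t) (at t)"
    using smooth_DERIV[OF smooth(3), of 0 t] by (simp add: dz)
  show "(dx has_real_derivative (deriv ^^ 2) x t) (at t)"
    using smooth_DERIV[OF smooth(1), of 1 t] by (simp add: numeral_2_eq_2)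
qed

lemma isCont_coordinates: "isCont x t" "isCont y t" "isCont z t"
  using DERIV_x DERIV_y DERIV_z DERIV_isCont by blast+

lemma continuous_coordinates: "continuous_on A x" "continuous_on A y" "continuous_on A z"
  using isCont_coordinates by (auto intro: continuous_at_imp_continuous_on)

lemma periodic_int: "\<gamma> (t + of_int k) = \<gamma> t"
proof -
  have one: "\<gamma> (s + 1) = \<gamma> s" for s using knot by (simp add: legendrian_knot_def)
  have nat: "\<gamma> (s + of_nat m) = \<gamma> s" for s m
  proof (induction m)
    case (Suc m)
    then show ?case using one[of "s + of_nat m"] by (simp add: add_ac)
  qed simp
  show ?thesis
  proof (cases "0 \<le> k")
    case True
    then show ?thesis using nat[of t "nat k"] by simp
  next
    case False
    then show ?thesis using nat[of "t + of_int k" "nat (- k)"] by simp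
  qed
qed

lemma same_point: "s - t \<in> \<int> \<Longrightarrow> \<gamma> s = \<gamma> t"
  using periodic_int[of t] by (metis Ints_cases add.commute diff_add_cancel)

lemma same_coordinates: "s - t \<in> \<int> \<Longrightarrow> x s = x t \<and> y s = y t \<and> z s = z t"
  using same_point by (simp add: cx_def cy_def cz_def)

text \<open>Differentiating \<open>z' = y x'\<close> gives \<open>z'' = y x''\<close> at a critical point of \<open>x\<close>; if also \<open>x'' = 0\<close>,
  the second derivatives would vanish, which a semicubical cusp excludes.\<close>

lemma critical_cusp:
  assumes "dx t = 0"
  shows "cusp_param \<gamma> t" and "(deriv ^^ 2) x t \<noteq> 0"
proof -
  have dz: "deriv z = (\<lambda>t. y t * dx t)" using knot by (auto simp: legendrian_knot_def)
  show cusp: "cusp_param \<gamma> t" using assms dz by (simp add: cusp_param_def)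
  have "(deriv z has_real_derivative deriv y t * dx t + (deriv ^^ 2) x t * y t) (at t)"
    unfolding dz by (rule DERIV_mult[OF DERIV_y DERIV_dx])
  then have "(deriv ^^ 2) z t = (deriv ^^ 2) x t * y t"
    using assms by (simp add: numeral_2_eq_2 DERIV_imp_deriv)
  moreover have "(deriv ^^ 2) x t * (deriv ^^ 3) z t \<noteq> (deriv ^^ 3) x t * (deriv ^^ 2) z t"
    using plat cusp by (simp add: nearly_plat_def generic_front_def)
  ultimately show "(deriv ^^ 2) x t \<noteq> 0" by auto
qed

lemma critical_point: "dx t = 0 \<Longrightarrow> (x t, z t) \<in> left_cusps \<gamma> \<union> right_cusps \<gamma>"
proof -
  assume "dx t = 0"
  note c = critical_cusp[OF this]
  consider "(deriv ^^ 2) x t > 0" | "(deriv ^^ 2) x t < 0" using c(2) by linarith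
  then show ?thesis
  proof cases
    case 1
    then have "front_proj (\<gamma> t) \<in> left_cusps \<gamma>" using c(1) unfolding left_cusps_def by blast
    then show ?thesis by (simp add: front_proj_gamma)
  next
    case 2
    then have "front_proj (\<gamma> t) \<in> right_cusps \<gamma>" using c(1) unfolding right_cusps_def by blast
    then show ?thesis by (simp add: front_proj_gamma)
  qed
qed

lemma double_point:
  assumes "x s = x t" "z s = z t" "s - t \<notin> \<int>" shows "(x t, z t) \<in> crossings \<gamma>"
proof -
  have "front_proj (\<gamma> s) = front_proj (\<gamma> t)" using assms by (simp add: front_proj_gamma)
  then have "front_proj (\<gamma> t) \<in> crossings \<gamma>" using assms(3) unfolding crossings_def by blast
  then show ?thesis by (simp add: front_proj_gamma)
qed

lemma singular_eqI:
  "p \<in> left_cusps \<gamma> \<union> crossings \<gamma> \<union> right_cusps \<gamma> \<Longrightarrow> q \<in> left_cusps \<gamma> \<union> crossings \<gamma> \<union> right_cusps \<gamma> \<Longrightarrow>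
   fst p = fst q \<Longrightarrow> p = q"
  using plat unfolding nearly_plat_def by (meson inj_onD)

text \<open>The tangent directions at a double point are given by \<open>y\<close>, since \<open>z' = y x'\<close>.\<close>

lemma transverse: "s - t \<notin> \<int> \<Longrightarrow> x s = x t \<Longrightarrow> z s = z t \<Longrightarrow> dx s \<noteq> 0 \<and> dx t \<noteq> 0 \<and> y s \<noteq> y t"
proof -
  assume st: "s - t \<notin> \<int>" "x s = x t" "z s = z t"
  have dz: "deriv z t = y t * dx t" for t using knot by (simp add: legendrian_knot_def)
  have g: "generic_front \<gamma>" using plat by (simp add: nearly_plat_def)
  have tr: "dx s * (y t * dx t) \<noteq> dx t * (y s * dx s)"
    using g[unfolded generic_front_def, THEN conjunct2, THEN conjunct1, rule_format, of s t] st
    by (simp add: front_proj_gamma dz)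
  then show ?thesis by (auto simp: algebra_simps)
qed

lemma no_triple: "x r = x s \<Longrightarrow> z r = z s \<Longrightarrow> x s = x t \<Longrightarrow> z s = z t \<Longrightarrow>
    r - s \<in> \<int> \<or> s - t \<in> \<int> \<or> r - t \<in> \<int>"
proof -
  assume e: "x r = x s" "z r = z s" "x s = x t" "z s = z t"
  have g: "generic_front \<gamma>" using plat by (simp add: nearly_plat_def)
  show ?thesis
    using g[unfolded generic_front_def, THEN conjunct2, THEN conjunct2, rule_format, of r s t] e
    by (simp add: front_proj_gamma)
qed

lemma extremum:
  "\<exists>t. \<forall>s. x t \<le> x s" "\<exists>t. \<forall>s. x s \<le> x t"
proof -
  have frac: "x s = x (frac s)" for s
  proof -
    have "s - frac s \<in> \<int>" by (simp add: frac_def)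
    then show ?thesis using same_coordinates by blast
  qed
  have mem: "frac s \<in> {0..1::real}" for s
    using frac_ge_0[of s] frac_lt_1[of s] by auto
  have comp: "compact {0..1::real}" "{0..1::real} \<noteq> {}" by auto
  obtain t where "\<forall>s\<in>{0..1}. x t \<le> x s"
    using continuous_attains_inf[OF comp continuous_coordinates(1)] by blast
  then have "x t \<le> x s" for s using frac[of s] mem[of s] by auto
  then show "\<exists>t. \<forall>s. x t \<le> x s" by blast
  obtain t where "\<forall>s\<in>{0..1}. x s \<le> x t"
    using continuous_attains_sup[OF comp continuous_coordinates(1)] by blast
  then have "x s \<le> x t" for s using frac[of s] mem[of s] by auto
  then show "\<exists>t. \<forall>s. x s \<le> x t" by blast
qed

lemma minimum_left_cusp:
  assumes "\<And>s. x t \<le> x s" shows "(x t, z t) \<in> left_cusps \<gamma>"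
proof -
  have crit: "dx t = 0" by (rule DERIV_local_min[OF DERIV_x, of 1]) (use assms in auto)
  have "(deriv ^^ 2) x t > 0"
  proof (rule ccontr)
    assume "\<not> (deriv ^^ 2) x t > 0"
    then have "(deriv ^^ 2) x t < 0" using critical_cusp(2)[OF crit] by linarith
    from DERIV_neg_dec_right[OF DERIV_dx this]
    obtain d where d: "d > 0" "\<And>h. 0 < h \<Longrightarrow> h < d \<Longrightarrow> dx (t + h) < dx t" by blast
    obtain c where c: "c > t" "c < t + d / 2" "x (t + d / 2) - x t = (t + d / 2 - t) * dx c"
      using MVT2[of t "t + d / 2" x dx] DERIV_x d(1) by auto
    have "dx c < 0" using d(2)[of "c - t"] c crit by auto
    then have "x (t + d / 2) - x t < 0" using c(3) d(1) mult_pos_neg[of "d / 2" "dx c"] by simp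
    then show False using assms[of "t + d / 2"] by simp
  qed
  then have "front_proj (\<gamma> t) \<in> left_cusps \<gamma>"
    using critical_cusp(1)[OF crit] unfolding left_cusps_def by blast
  then show ?thesis by (simp add: front_proj_gamma)
qed

lemma maximum_right_cusp:
  assumes "\<And>s. x s \<le> x t" shows "(x t, z t) \<in> right_cusps \<gamma>"
proof -
  have crit: "dx t = 0" by (rule DERIV_local_max[OF DERIV_x, of 1]) (use assms in auto)
  have "(deriv ^^ 2) x t < 0"
  proof (rule ccontr)
    assume "\<not> (deriv ^^ 2) x t < 0"
    then have "(deriv ^^ 2) x t > 0" using critical_cusp(2)[OF crit] by linarith
    from DERIV_pos_inc_right[OF DERIV_dx this]
    obtain d where d: "d > 0" "\<And>h. 0 < h \<Longrightarrow> h < d \<Longrightarrow> dx t < dx (t + h)" by blast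
    obtain c where c: "c > t" "c < t + d / 2" "x (t + d / 2) - x t = (t + d / 2 - t) * dx c"
      using MVT2[of t "t + d / 2" x dx] DERIV_x d(1) by auto
    have "dx c > 0" using d(2)[of "c - t"] c crit by auto
    then have "d / 2 * dx c > 0" using d(1) by simp
    then have "x (t + d / 2) - x t > 0" using c(3) by simp
    then show False using assms[of "t + d / 2"] by simp
  qed
  then have "front_proj (\<gamma> t) \<in> right_cusps \<gamma>"
    using critical_cusp(1)[OF crit] unfolding right_cusps_def by blast
  then show ?thesis by (simp add: front_proj_gamma)
qed

lemma interior_minimum:
  assumes "a < e" "e < b" "\<And>s. a \<le> s \<Longrightarrow> s \<le> b \<Longrightarrow> x e \<le> x s"
  shows "dx e = 0"
  by (rule DERIV_local_min[OF DERIV_x, of "min (e - a) (b - e)"]) (use assms in \<open>auto simp: abs_less_iff\<close>)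

lemma interior_maximum:
  assumes "a < e" "e < b" "\<And>s. a \<le> s \<Longrightarrow> s \<le> b \<Longrightarrow> x s \<le> x e"
  shows "dx e = 0"
  by (rule DERIV_local_max[OF DERIV_x, of "min (e - a) (b - e)"]) (use assms in \<open>auto simp: abs_less_iff\<close>)

text \<open>Over one period starting at the leftmost point, \<open>x\<close> can return to a value \<open>\<le> x1\<close> only
  through a further critical point, so it takes the value \<open>x1\<close> exactly twice.\<close>

lemma two_strands:
  assumes t0: "\<And>s. x t0 \<le> x s" and x1: "x t0 < x1" "x1 = x t1"
    and sing: "\<And>p. p \<in> left_cusps \<gamma> \<union> crossings \<gamma> \<union> right_cusps \<gamma> \<Longrightarrow> fst p \<le> x1 \<Longrightarrow> fst p = x t0 \<and> p \<notin> crossings \<gamma>"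
  shows "strands \<gamma> x1 = 2"
proof -
  have min_eq: "s - t0 \<in> \<int>" if "x s = x t0" for s
  proof (rule ccontr)
    assume n: "s - t0 \<notin> \<int>"
    have "(x s, z s) \<in> left_cusps \<gamma>" by (rule minimum_left_cusp) (use t0 that in simp)
    moreover have "(x t0, z t0) \<in> left_cusps \<gamma>" by (rule minimum_left_cusp[OF t0])
    ultimately have "(x s, z s) = (x t0, z t0)" using that by (intro singular_eqI) auto
    then have "(x t0, z t0) \<in> crossings \<gamma>" using double_point[OF that _ n] by simp
    then show False using sing[of "(x t0, z t0)"] x1 by simp
  qed
  have int01: "r \<notin> \<int>" if "0 < r" "r < 1" for r :: real
    using that by (metis Ints_cases of_int_0_less_iff of_int_less_1_iff zless_imp_add1_zle add_0 not_less)
  have crit: "x1 < x s" if "dx s = 0" "t0 < s" "s < t0 + 1" for s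
  proof (rule ccontr)
    assume "\<not> x1 < x s"
    then have "x s = x t0" using sing[of "(x s, z s)"] critical_point[OF that(1)] by auto
    then show False using min_eq int01[of "s - t0"] that by auto
  qed
  have per: "x (t0 + 1) = x t0" using same_coordinates[of "t0 + 1" t0] by simp
  define L where "L = {t \<in> {t0..t0 + 1}. x t = x1}"
  have L_eq: "L = {t0..t0 + 1} \<inter> x -` {x1}" by (auto simp: L_def)
  have comp: "compact L"
    unfolding L_eq by (intro compact_Int_closed compact_Icc closed_vimage closed_singleton continuous_coordinates)
  define t1' where "t1' = t0 + frac (t1 - t0)"
  have "t1 - t1' \<in> \<int>" by (simp add: t1'_def frac_def)
  then have "x t1' = x1" using same_coordinates x1(2) by metis
  moreover have "t1' \<in> {t0..t0 + 1}"
    using frac_ge_0[of "t1 - t0"] frac_lt_1[of "t1 - t0"] by (simp add: t1'_def)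
  ultimately have ne: "L \<noteq> {}" by (auto simp: L_def)
  obtain s1 where s1: "s1 \<in> L" "\<And>t. t \<in> L \<Longrightarrow> s1 \<le> t" using compact_attains_inf[OF comp ne] by blast
  obtain s2 where s2: "s2 \<in> L" "\<And>t. t \<in> L \<Longrightarrow> t \<le> s2" using compact_attains_sup[OF comp ne] by blast
  have inside: "t0 < s" "s < t0 + 1" if "s \<in> L" for s
  proof -
    have "s \<noteq> t0" "s \<noteq> t0 + 1" using that x1(1) per by (auto simp: L_def)
    then show "t0 < s" "s < t0 + 1" using that by (auto simp: L_def)
  qed
  have above: "x1 < x s" if s: "s1 < s" "s < s2" for s
  proof (rule ccontr)
    assume le: "\<not> x1 < x s"
    have "\<exists>c\<in>{s1..s2}. \<forall>t\<in>{s1..s2}. x c \<le> x t"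
      by (rule continuous_attains_inf[OF compact_Icc _ continuous_coordinates(1)]) (use s in auto)
    then obtain c where c: "c \<in> {s1..s2}" "\<And>t. t \<in> {s1..s2} \<Longrightarrow> x c \<le> x t" by blast
    \<comment> \<open>If the minimum is attained at an end of the interval, it is also attained at \<open>s\<close>.\<close>
    have "\<exists>e. s1 < e \<and> e < s2 \<and> (\<forall>t\<in>{s1..s2}. x e \<le> x t)"
    proof (cases "c = s1 \<or> c = s2")
      case True
      then have "x c = x1" using s1(1) s2(1) by (auto simp: L_def)
      then have "x s \<le> x t" if "t \<in> {s1..s2}" for t using c(2)[OF that] le by simp
      then show ?thesis using s by blast
    next
      case False
      then show ?thesis using c by (intro exI[of _ c]) auto
    qed
    then obtain e where e: "s1 < e" "e < s2" "\<And>t. t \<in> {s1..s2} \<Longrightarrow> x e \<le> x t" by blast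
    have "dx e = 0" by (rule interior_minimum[OF e(1,2)]) (use e(3) in auto)
    then have "x1 < x e" using crit e inside[OF s1(1)] inside[OF s2(1)] by auto
    then show False using e(3)[of s1] e(1,2) s1(1) by (auto simp: L_def)
  qed
  have "s1 \<noteq> s2"
  proof
    assume eq: "s1 = s2"
    have only: "t = s1" if "t \<in> L" for t using s1(2)[OF that] s2(2)[OF that] eq by simp
    have below: "x t \<le> x s1" if t: "t0 \<le> t" "t \<le> t0 + 1" for t
    proof (rule ccontr)
      assume "\<not> x t \<le> x s1"
      then have gt: "x1 < x t" using s1(1) by (simp add: L_def)
      have "\<exists>r\<ge>t0. r \<le> t \<and> x r = x1"
        by (rule IVT') (use gt x1(1) t continuous_coordinates in auto)
      moreover have "\<exists>r\<ge>t. r \<le> t0 + 1 \<and> x r = x1"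
        by (rule IVT2') (use gt x1(1) t per continuous_coordinates in auto)
      ultimately obtain r r' where r: "t0 \<le> r" "r \<le> t" "x r = x1" "t \<le> r'" "r' \<le> t0 + 1" "x r' = x1" by blast
      then have "r = s1" "r' = s1" using only t by (auto simp: L_def)
      then have "t = s1" using r by simp
      then show False using gt s1(1) by (simp add: L_def)
    qed
    have "dx s1 = 0"
      by (rule interior_maximum[OF inside[OF s1(1)]]) (use below in auto)
    then show False using crit inside[OF s1(1)] s1(1) by (fastforce simp: L_def)
  qed
  then have lt: "s1 < s2" using s1(2)[OF s2(1)] by simp
  have L: "t = s1 \<or> t = s2" if "t \<in> L" for t
    using s1(2)[OF that] s2(2)[OF that] above[of t] that by (fastforce simp: L_def)
  have zne: "z s1 \<noteq> z s2"
  proof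
    assume e: "z s1 = z s2"
    have "s2 - s1 \<notin> \<int>" using lt inside[OF s1(1)] inside[OF s2(1)] by (intro int01) auto
    moreover have "x s2 = x s1" using s1(1) s2(1) by (simp add: L_def)
    ultimately have "(x s1, z s1) \<in> crossings \<gamma>" using e by (intro double_point) auto
    then show False using sing[of "(x s1, z s1)"] s1(1) by (simp add: L_def)
  qed
  have "{c. (x1, c) \<in> front \<gamma>} = {z s1, z s2}"
  proof (intro equalityI subsetI)
    fix c assume "c \<in> {c. (x1, c) \<in> front \<gamma>}"
    then obtain t where t: "x t = x1" "z t = c" by (auto simp: mem_front)
    define t' where "t' = t0 + frac (t - t0)"
    have "t - t' \<in> \<int>" by (simp add: t'_def frac_def)
    then have "x t' = x1" "z t' = c" using same_coordinates[of t t'] t by auto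
    moreover have "t' \<in> {t0..t0 + 1}"
      using frac_ge_0[of "t - t0"] frac_lt_1[of "t - t0"] by (simp add: t'_def)
    ultimately show "c \<in> {z s1, z s2}" using L[of t'] by (auto simp: L_def)
  next
    fix c assume "c \<in> {z s1, z s2}"
    then show "c \<in> {c. (x1, c) \<in> front \<gamma>}" using s1(1) s2(1) by (auto simp: mem_front L_def)
  qed
  then show ?thesis using zne by (simp add: strands_def)
qed

end

lemma right_cusp_exists:
  assumes "legendrian_knot \<gamma>" "nearly_plat \<gamma>"
  shows "\<exists>r. r \<in> right_cusps \<gamma>"
proof -
  interpret plat_knot \<gamma> by (rule plat_knot.intro[OF assms])
  show ?thesis using extremum(2) maximum_right_cusp by blast
qed

lemma first_strip:
  assumes "legendrian_knot \<gamma>" "nearly_plat \<gamma>" "is_mcs \<gamma> \<mu> C"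
  shows "strip_event \<gamma> C 0 = LeftCusp 1" "strands \<gamma> (line C 1) = 2"
proof -
  interpret plat_knot \<gamma> by (rule plat_knot.intro[OF assms(1,2)])
  have lines: "mcs_lines \<gamma> C" using assms(3) by (simp add: is_mcs_def)
  have one: "1 \<in> {1..nlines C}" using lines by (simp add: mcs_lines_def)
  obtain w where w: "(line C 1, w) \<in> front \<gamma>" and off: "line C 1 \<notin> fst ` events \<gamma> C"
    using lines one unfolding mcs_lines_def by blast
  have uniq: "\<exists>!e. e \<in> events \<gamma> C \<and> fst e \<in> strip C 0"
    using lines unfolding mcs_lines_def by blast
  obtain t0 where t0: "\<And>s. x t0 \<le> x s" using extremum(1) by blast
  define p where "p = (x t0, z t0)"
  have p: "p \<in> left_cusps \<gamma>" unfolding p_def by (rule minimum_left_cusp[OF t0])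
  have ev: "(fst p, LeftCusp (position \<gamma> p)) \<in> events \<gamma> C" using p unfolding events_def by blast
  obtain t1 where t1: "x t1 = line C 1" using w by (auto simp: mem_front)
  have lt: "x t0 < line C 1"
  proof -
    have "x t0 \<noteq> line C 1" using off ev by (force simp: p_def)
    then show ?thesis using t0[of t1] t1 by simp
  qed
  then have strip: "fst p \<in> strip C 0" by (simp add: strip_def p_def)
  have only: "e = (fst p, LeftCusp (position \<gamma> p))" if "e \<in> events \<gamma> C" "fst e \<in> strip C 0" for e
    using uniq that ev strip by (metis fst_conv)
  have "{c. (fst p, c) \<in> front \<gamma> \<and> c > snd p} = {}"
  proof (rule equals0I)
    fix c assume c: "c \<in> {c. (fst p, c) \<in> front \<gamma> \<and> c > snd p}"
    then obtain t where t: "x t = x t0" "z t = c" by (auto simp: mem_front p_def)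
    have "(x t, z t) \<in> left_cusps \<gamma>" by (rule minimum_left_cusp) (use t0 t in simp)
    then have "(x t, z t) = p" using p t by (intro singular_eqI) (auto simp: p_def)
    then show False using c t by auto
  qed
  then have "position \<gamma> p = 1" unfolding position_def by (simp only: card.empty One_nat_def)
  moreover have "strip_event \<gamma> C 0 = LeftCusp (position \<gamma> p)"
    unfolding strip_event_def
    using the1_equality[OF uniq, of "(fst p, LeftCusp (position \<gamma> p))"] ev strip by simp
  ultimately show "strip_event \<gamma> C 0 = LeftCusp 1" by simp
  show "strands \<gamma> (line C 1) = 2"
  proof (rule two_strands[OF t0 lt t1[symmetric]])
    fix q assume q: "q \<in> left_cusps \<gamma> \<union> crossings \<gamma> \<union> right_cusps \<gamma>" "fst q \<le> line C 1"
    have evs: "q \<in> left_cusps \<gamma> \<Longrightarrow> (fst q, LeftCusp (position \<gamma> q)) \<in> events \<gamma> C"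
      "q \<in> right_cusps \<gamma> \<Longrightarrow> (fst q, RightCusp (position \<gamma> q)) \<in> events \<gamma> C"
      "q \<in> crossings \<gamma> \<Longrightarrow> (fst q, Crossing (position \<gamma> q)) \<in> events \<gamma> C"
      unfolding events_def by blast+
    obtain e where e: "(fst q, e) \<in> events \<gamma> C" using q(1) evs by blast
    then have "fst q \<noteq> line C 1" using off by force
    then have qs: "fst q \<in> strip C 0" using q(2) by (simp add: strip_def)
    show "fst q = x t0 \<and> q \<notin> crossings \<gamma>"
      using only[OF e] only[OF evs(3)] qs by (auto simp: p_def)
  qed
qed

section \<open>The degree of a crossing\<close>

context plat_knot
begin

definition branch :: "real \<Rightarrow> real \<Rightarrow> (real \<Rightarrow> real) \<Rightarrow> bool" where
  "branch u v \<phi> \<longleftrightarrow> continuous_on {u..v} \<phi> \<and> (\<forall>a\<in>{u..v}. x (\<phi> a) = a)"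

text \<open>By the mean value theorem.  This gives both the existence of branches and their uniqueness.\<close>

lemma inj_on_regular:
  assumes reg: "\<And>t. x t \<in> {u..v} \<Longrightarrow> dx t \<noteq> 0"
    and S: "connected S" "\<And>t. t \<in> S \<Longrightarrow> x t \<in> {u..v}"
  shows "inj_on x S"
proof -
  have "x a \<noteq> x b" if ab: "a \<in> S" "b \<in> S" "a < b" for a b
  proof
    assume eq: "x a = x b"
    obtain c where c: "a < c" "c < b" "x b - x a = (b - a) * dx c"
      using MVT2[OF ab(3), of x dx] DERIV_x by auto
    have "c \<in> S" using connectedD_interval[OF S(1) ab(1,2)] c by auto
    then have "dx c \<noteq> 0" using reg S(2) by blast
    then show False using c eq by simp
  qed
  then show ?thesis by (metis inj_onI linorder_neqE_linordered_idom)
qed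

text \<open>Applied where \<open>x\<close> is extremal on a component of the parameters over an interval: if the
  extremal value lay inside the interval, the component could be enlarged.\<close>

lemma move_up:
  fixes f :: "real \<Rightarrow> real"
  assumes d: "(f has_real_derivative l) (at s)" "l \<noteq> 0" and cont: "\<And>t. isCont f t" and v: "f s < v"
  shows "\<exists>s'. f s < f s' \<and> (\<forall>r\<in>closed_segment s s'. f s \<le> f r \<and> f r < v)"
proof -
  obtain e where e: "e > 0" "\<And>r. dist r s < e \<Longrightarrow> dist (f r) (f s) < v - f s"
    using cont[of s] v unfolding continuous_at_eps_delta by (metis diff_gt_0_iff_gt)
  show ?thesis
  proof (cases "l > 0")
    case True
    obtain d' where d': "d' > 0" "\<And>h. 0 < h \<Longrightarrow> h < d' \<Longrightarrow> f s < f (s + h)"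
      using DERIV_pos_inc_right[OF d(1) True] by blast
    define h where "h = min e d' / 2"
    have h: "0 < h" "h < e" "h < d'" using e(1) d'(1) by (auto simp: h_def)
    have "f s \<le> f r \<and> f r < v" if "r \<in> closed_segment s (s + h)" for r
    proof -
      have r: "s \<le> r" "r \<le> s + h" using that h(1) by (auto simp: closed_segment_eq_real_ivl)
      have "f s \<le> f r" using d'(2)[of "r - s"] r h by (cases "r = s") auto
      moreover have "f r < v" using e(2)[of r] r h by (auto simp: dist_real_def abs_less_iff)
      ultimately show ?thesis by simp
    qed
    then show ?thesis using d'(2)[OF h(1,3)] by (intro exI[of _ "s + h"]) auto
  next
    case False
    then have neg: "l < 0" using d(2) by simp
    obtain d' where d': "d' > 0" "\<And>h. 0 < h \<Longrightarrow> h < d' \<Longrightarrow> f s < f (s - h)"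
      using DERIV_neg_dec_left[OF d(1) neg] by blast
    define h where "h = min e d' / 2"
    have h: "0 < h" "h < e" "h < d'" using e(1) d'(1) by (auto simp: h_def)
    have "f s \<le> f r \<and> f r < v" if "r \<in> closed_segment s (s - h)" for r
    proof -
      have r: "s - h \<le> r" "r \<le> s" using that h(1) by (auto simp: closed_segment_eq_real_ivl split: if_splits)
      have "f s \<le> f r" using d'(2)[of "s - r"] r h by (cases "r = s") auto
      moreover have "f r < v" using e(2)[of r] r h by (auto simp: dist_real_def abs_less_iff)
      ultimately show ?thesis by simp
    qed
    then show ?thesis using d'(2)[OF h(1,3)] by (intro exI[of _ "s - h"]) auto
  qed
qed

text \<open>Over an interval without critical values every point of the knot lies on a branch: the
  connected component of the parameters over the interval is mapped homeomorphically onto it.\<close>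

lemma branch_exists:
  assumes uv: "u < v" and reg: "\<And>t. x t \<in> {u..v} \<Longrightarrow> dx t \<noteq> 0" and t0: "x t0 \<in> {u..v}"
  shows "\<exists>\<phi>. branch u v \<phi> \<and> \<phi> (x t0) = t0"
proof -
  let ?P = "{s. x s \<in> {u..v}}"
  define S where "S = connected_component_set ?P t0"
  have P_eq: "?P = x -` {u..v}" by auto
  have "closed ?P"
    unfolding P_eq by (intro closed_vimage closed_atLeastAtMost continuous_coordinates)
  then have clS: "closed S" unfolding S_def by (rule closed_connected_component)
  have conS: "connected S" by (simp add: S_def)
  have SP: "x s \<in> {u..v}" if "s \<in> S" for s
    using that connected_component_subset[of ?P t0] by (auto simp: S_def)
  have t0S: "t0 \<in> S" using t0 by (simp add: S_def connected_component_refl_eq)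
  have inj: "inj_on x S" by (rule inj_on_regular[OF reg conS SP])
  have maximal: "s' \<in> S" if "s \<in> S" "\<And>r. r \<in> closed_segment s s' \<Longrightarrow> x r \<in> {u..v}" for s s'
  proof -
    have "connected (S \<union> closed_segment s s')"
      by (rule connected_Un[OF conS connected_segment]) (use that(1) in auto)
    moreover have "t0 \<in> S \<union> closed_segment s s'" using t0S by simp
    moreover have "S \<union> closed_segment s s' \<subseteq> ?P" using SP that(2) by blast
    ultimately have "S \<union> closed_segment s s' \<subseteq> connected_component_set ?P t0"
      by (intro connected_component_maximal)
    then show ?thesis unfolding S_def[symmetric] using ends_in_segment(2)[of s' s] by blast
  qed
  have bounded: "s \<in> {t0 - 1..t0 + 1}" if s: "s \<in> S" for s
  proof (rule ccontr)
    assume n: "s \<notin> {t0 - 1..t0 + 1}"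
    have "t0 + 1 \<in> S \<or> t0 - 1 \<in> S"
    proof (cases "t0 + 1 < s")
      case True
      then show ?thesis using connectedD_interval[OF conS t0S s, of "t0 + 1"] by simp
    next
      case False
      then show ?thesis using n connectedD_interval[OF conS s t0S, of "t0 - 1"] by simp
    qed
    moreover have "x (t0 + 1) = x t0" "x (t0 - 1) = x t0"
      using same_coordinates[of "t0 + 1" t0] same_coordinates[of "t0 - 1" t0] by auto
    ultimately show False using inj t0S by (auto dest: inj_onD)
  qed
  have compS: "compact S"
    using clS bounded bounded_closed_interval[of "t0 - 1" "t0 + 1"]
    by (meson bounded_subset compact_eq_bounded_closed subsetI)
  have top: "x s = v" if s: "s \<in> S" "\<And>r. r \<in> S \<Longrightarrow> x r \<le> x s" for s
  proof (rule ccontr)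
    assume "x s \<noteq> v"
    then have lt: "x s < v" using SP[OF s(1)] by simp
    obtain s' where s': "x s < x s'" "\<And>r. r \<in> closed_segment s s' \<Longrightarrow> x s \<le> x r \<and> x r < v"
      using move_up[OF DERIV_x reg[OF SP[OF s(1)]] isCont_coordinates(1) lt] by blast
    have "s' \<in> S" by (rule maximal[OF s(1)]) (use s'(2) SP[OF s(1)] in fastforce)
    then show False using s(2) s'(1) by fastforce
  qed
  have bottom: "x s = u" if s: "s \<in> S" "\<And>r. r \<in> S \<Longrightarrow> x s \<le> x r" for s
  proof (rule ccontr)
    assume "x s \<noteq> u"
    then have lt: "- x s < - u" using SP[OF s(1)] by simp
    have d: "((\<lambda>t. - x t) has_real_derivative - dx s) (at s)" by (rule DERIV_minus[OF DERIV_x])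
    have nz: "- dx s \<noteq> 0" using reg[OF SP[OF s(1)]] by simp
    have cont: "isCont (\<lambda>t. - x t) t" for t using isCont_coordinates(1) by (rule continuous_minus)
    obtain s' where s': "- x s < - x s'" "\<And>r. r \<in> closed_segment s s' \<Longrightarrow> - x s \<le> - x r \<and> - x r < - u"
      using move_up[OF d nz cont lt] by blast
    have "s' \<in> S" by (rule maximal[OF s(1)]) (use s'(2) SP[OF s(1)] in fastforce)
    then show False using s(2) s'(1) by fastforce
  qed
  have ne: "S \<noteq> {}" using t0S by auto
  obtain s1 where s1: "s1 \<in> S" "\<And>r. r \<in> S \<Longrightarrow> x r \<le> x s1"
    using continuous_attains_sup[OF compS ne continuous_coordinates(1)] by blast
  obtain s2 where s2: "s2 \<in> S" "\<And>r. r \<in> S \<Longrightarrow> x s2 \<le> x r"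
    using continuous_attains_inf[OF compS ne continuous_coordinates(1)] by blast
  have "connected (x ` S)" by (rule connected_continuous_image[OF continuous_coordinates(1) conS])
  moreover have "v \<in> x ` S" "u \<in> x ` S" using top[OF s1] bottom[OF s2] s1(1) s2(1) by auto
  ultimately have "{u..v} \<subseteq> x ` S" by (meson atLeastAtMost_iff connectedD_interval subsetI)
  then have img: "x ` S = {u..v}" using SP by auto
  have "branch u v (the_inv_into S x)"
    unfolding branch_def
  proof (intro conjI ballI)
    show "continuous_on {u..v} (the_inv_into S x)"
      using continuous_on_inv_into[OF continuous_coordinates(1) compS inj] by (simp add: img)
    show "x (the_inv_into S x a) = a" if "a \<in> {u..v}" for a
      using f_the_inv_into_f[OF inj, of a] that img by simp
  qed
  moreover have "the_inv_into S x (x t0) = t0" by (rule the_inv_into_f_f[OF inj t0S])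
  ultimately show ?thesis by blast
qed

text \<open>Two branches which agree at one point, up to a period, have a connected union.\<close>

lemma branch_same:
  assumes reg: "\<And>t. x t \<in> {u..v} \<Longrightarrow> dx t \<noteq> 0"
    and b: "branch u v \<phi>" "branch u v \<psi>" and a0: "a0 \<in> {u..v}" "\<phi> a0 - \<psi> a0 \<in> \<int>" and a: "a \<in> {u..v}"
  shows "z (\<phi> a) = z (\<psi> a)" "\<phi> a - \<psi> a \<in> \<int>"
proof -
  define k where "k = \<phi> a0 - \<psi> a0"
  define \<psi>' where "\<psi>' = (\<lambda>a. \<psi> a + k)"
  have per: "x (\<psi> a + k) = x (\<psi> a)" for a
    using same_coordinates[of "\<psi> a + k" "\<psi> a"] a0(2) by (simp add: k_def)
  have \<psi>': "branch u v \<psi>'" using b(2) per by (auto simp: branch_def \<psi>'_def intro!: continuous_intros)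
  let ?S = "\<phi> ` {u..v} \<union> \<psi>' ` {u..v}"
  have "\<phi> a0 = \<psi>' a0" by (simp add: \<psi>'_def k_def)
  then have conn: "connected ?S"
    using b(1) \<psi>' imageI[OF a0(1), of \<phi>] imageI[OF a0(1), of \<psi>'] unfolding branch_def
    by (intro connected_Un connected_continuous_image connected_Icc) auto
  have "inj_on x ?S"
    by (rule inj_on_regular[OF reg conn]) (use b(1) \<psi>' in \<open>auto simp: branch_def\<close>)
  then have "\<phi> a = \<psi>' a"
    by (rule inj_onD) (use b(1) \<psi>' a in \<open>auto simp: branch_def\<close>)
  then show "\<phi> a - \<psi> a \<in> \<int>" using a0(2) by (simp add: \<psi>'_def k_def)
  then show "z (\<phi> a) = z (\<psi> a)" using same_coordinates by blast
qed

lemma branch_continuous: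
  "branch u v \<phi> \<Longrightarrow> continuous_on {u..v} (\<lambda>a. z (\<phi> a))"
  "branch u v \<phi> \<Longrightarrow> continuous_on {u..v} (\<lambda>a. y (\<phi> a))"
  by (rule continuous_on_compose2[OF continuous_coordinates(3)[of UNIV]], simp add: branch_def, simp)
    (rule continuous_on_compose2[OF continuous_coordinates(2)[of UNIV]], simp add: branch_def, simp)

text \<open>Branches only meet in crossings, so their vertical order persists as long as no
  crossing is reached.\<close>

lemma branch_order:
  assumes reg: "\<And>t. x t \<in> {u..v} \<Longrightarrow> dx t \<noteq> 0"
    and nocross: "\<And>c. c \<in> crossings \<gamma> \<Longrightarrow> fst c \<notin> {u..<v}"
    and b: "branch u v \<phi>" "branch u v \<psi>" and less: "z (\<phi> u) < z (\<psi> u)" and a: "u \<le> a" "a < v"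
  shows "z (\<phi> a) < z (\<psi> a)"
proof (rule ccontr)
  assume n: "\<not> z (\<phi> a) < z (\<psi> a)"
  let ?h = "\<lambda>a. z (\<psi> a) - z (\<phi> a)"
  have "continuous_on {u..a} ?h"
    using a by (intro continuous_on_diff continuous_on_subset[OF branch_continuous(1)[OF b(1)]]
        continuous_on_subset[OF branch_continuous(1)[OF b(2)]]) auto
  then obtain c where c: "u \<le> c" "c \<le> a" "?h c = 0"
    using IVT2'[of ?h a 0 u] n less a by auto
  have cuv: "c \<in> {u..v}" "u \<in> {u..v}" using c a by auto
  have "\<phi> c - \<psi> c \<in> \<int>"
  proof (rule ccontr)
    assume "\<phi> c - \<psi> c \<notin> \<int>"
    then have "(x (\<psi> c), z (\<psi> c)) \<in> crossings \<gamma>"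
      using b c(3) cuv by (intro double_point) (auto simp: branch_def)
    then show False using nocross[of "(x (\<psi> c), z (\<psi> c))"] b(2) cuv(1) c a by (auto simp: branch_def)
  qed
  then show False using branch_same(1)[OF reg b cuv(1) _ cuv(2)] less by simp
qed

text \<open>Cauchy's mean value theorem for \<open>z\<close> and \<open>x\<close> along the knot, with \<open>z' = y x'\<close>.\<close>

lemma branch_mean_value:
  assumes reg: "\<And>t. x t \<in> {u..v} \<Longrightarrow> dx t \<noteq> 0"
    and b: "branch u v \<phi>" and a: "u \<le> a" "a < v"
  shows "\<exists>c\<in>{a..v}. z (\<phi> v) - z (\<phi> a) = y (\<phi> c) * (v - a)"
proof -
  have xa: "x (\<phi> a) = a" "x (\<phi> v) = v" using b a by (auto simp: branch_def)
  then have ne: "\<phi> a \<noteq> \<phi> v" using a by auto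
  have cont: "continuous_on {a..v} \<phi>"
    using b a unfolding branch_def by (auto intro: continuous_on_subset)
  have conn: "connected (\<phi> ` {a..v})" by (rule connected_continuous_image[OF cont connected_Icc])
  have ends: "\<phi> a \<in> \<phi> ` {a..v}" "\<phi> v \<in> \<phi> ` {a..v}" using a by auto
  have mvt: "\<exists>c. p < c \<and> c < q \<and> (z q - z p) * dx c = (x q - x p) * (y c * dx c)" if "p < q" for p q
    by (rule GMVT'[OF that]) (use isCont_coordinates DERIV_x DERIV_z in auto)
  have "\<exists>c. c \<in> \<phi> ` {a..v} \<and> (z (\<phi> v) - z (\<phi> a)) * dx c = (v - a) * (y c * dx c)"
  proof (cases "\<phi> a < \<phi> v")
    case True
    then obtain c where c: "\<phi> a < c" "c < \<phi> v" "(z (\<phi> v) - z (\<phi> a)) * dx c = (v - a) * (y c * dx c)"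
      using mvt[OF True] xa by auto
    have "c \<in> \<phi> ` {a..v}" using connectedD_interval[OF conn ends] c by auto
    then show ?thesis using c(3) by blast
  next
    case False
    then have lt: "\<phi> v < \<phi> a" using ne by simp
    then obtain c where c: "\<phi> v < c" "c < \<phi> a" "(z (\<phi> a) - z (\<phi> v)) * dx c = (a - v) * (y c * dx c)"
      using mvt[OF lt] xa by auto
    have "c \<in> \<phi> ` {a..v}" using connectedD_interval[OF conn ends(2,1)] c by auto
    moreover have "(z (\<phi> v) - z (\<phi> a)) * dx c = (v - a) * (y c * dx c)"
      using c(3) by (simp add: algebra_simps)
    ultimately show ?thesis by blast
  qed
  then obtain e where e: "e \<in> {a..v}" "(z (\<phi> v) - z (\<phi> a)) * dx (\<phi> e) = (v - a) * (y (\<phi> e) * dx (\<phi> e))" by auto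
  have "x (\<phi> e) \<in> {u..v}" using b e(1) a by (auto simp: branch_def)
  then have "dx (\<phi> e) \<noteq> 0" by (rule reg)
  then show ?thesis using e by (intro bexI[of _ e]) (auto simp: mult_ac)
qed

text \<open>Parameters at which \<open>x\<close> is regular are isolated in their level set.\<close>

lemma fibre_finite:
  assumes reg: "\<And>t. x t = a \<Longrightarrow> dx t \<noteq> 0"
  shows "finite {c. (a, c) \<in> front \<gamma>}"
proof -
  let ?T = "{t \<in> {0..1}. x t = a}"
  have "finite ({0..1} \<inter> ?T)"
  proof (rule finite_not_islimpt_in_compact[OF compact_Icc])
    fix t :: real assume t: "t \<in> {0..1}"
    show "\<not> t islimpt ?T"
    proof
      assume lim: "t islimpt ?T"
      have "closed ?T"
      proof -
        have "?T = {0..1} \<inter> x -` {a}" by auto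
        then show ?thesis
          by (simp only:) (intro closed_Int closed_atLeastAtMost closed_vimage closed_singleton continuous_coordinates)
      qed
      then have "x t = a" using lim closed_limpt by blast
      then have nz: "dx t \<noteq> 0" by (rule reg)
      have "eventually (\<lambda>s. (x s - x t) / (s - t) \<noteq> 0) (at t)"
        using DERIV_x[of t, unfolded has_field_derivative_iff] nz by (rule tendsto_imp_eventually_ne)
      then have "eventually (\<lambda>s. s \<notin> ?T) (at t)"
        by (rule eventually_mono) (use \<open>x t = a\<close> in auto)
      then show False using lim by (simp add: islimpt_iff_eventually)
    qed
  qed
  then have "finite ?T" by (rule finite_subset[rotated]) auto
  moreover have "{c. (a, c) \<in> front \<gamma>} \<subseteq> z ` ?T"
  proof
    fix c assume "c \<in> {c. (a, c) \<in> front \<gamma>}"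
    then obtain t where t: "x t = a" "z t = c" by (auto simp: mem_front)
    have "t - frac t \<in> \<int>" by (simp add: frac_def)
    then have "x (frac t) = a" "z (frac t) = c" using same_coordinates t by metis+
    moreover have "frac t \<in> {0..1}" using frac_ge_0[of t] frac_lt_1[of t] by auto
    ultimately show "c \<in> z ` ?T" by blast
  qed
  ultimately show ?thesis using finite_surj by blast
qed

lemma position_eq: "position \<gamma> (a, c) = Suc (card {d. (a, d) \<in> front \<gamma> \<and> d > c})"
  by (simp add: position_def)

lemma position_less:
  assumes "finite {d. (a, d) \<in> front \<gamma>}" "(a, c') \<in> front \<gamma>" "c < c'"
  shows "position \<gamma> (a, c') < position \<gamma> (a, c)"
proof -
  have "{d. (a, d) \<in> front \<gamma> \<and> d > c'} \<subset> {d. (a, d) \<in> front \<gamma> \<and> d > c}"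
    using assms(2,3) by auto
  moreover have "finite {d. (a, d) \<in> front \<gamma> \<and> d > c}"
    by (rule finite_subset[OF _ assms(1)]) auto
  ultimately show ?thesis unfolding position_eq using psubset_card_mono by simp
qed

lemma strand_point_eq:
  assumes fin: "finite {d. (x t, d) \<in> front \<gamma>}" and nocross: "\<And>c. c \<in> crossings \<gamma> \<Longrightarrow> fst c \<noteq> x t"
  shows "strand_point \<gamma> (x t) (position \<gamma> (x t, z t)) = \<gamma> t"
  unfolding strand_point_def
proof (rule the_equality)
  show "\<gamma> t \<in> range \<gamma> \<and> fst (\<gamma> t) = x t \<and> position \<gamma> (front_proj (\<gamma> t)) = position \<gamma> (x t, z t)"
    by (simp add: front_proj_gamma cx_def)
  fix p assume p: "p \<in> range \<gamma> \<and> fst p = x t \<and> position \<gamma> (front_proj p) = position \<gamma> (x t, z t)"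
  then obtain s where s: "p = \<gamma> s" by blast
  have xs: "x s = x t" using p s by (simp add: cx_def)
  have mem: "(x t, z t) \<in> front \<gamma>" "(x t, z s) \<in> front \<gamma>" using xs mem_front by blast+
  have "z s = z t"
    using p position_less[OF fin mem(1), of "z s"] position_less[OF fin mem(2), of "z t"]
    by (cases "z s" "z t" rule: linorder_cases) (auto simp: s front_proj_gamma xs)
  then have "s - t \<in> \<int>" using double_point[OF xs] nocross[of "(x t, z t)"] by fastforce
  then show "p = \<gamma> t" unfolding s by (rule same_point)
qed

lemma maslov_branch:
  assumes reg: "\<And>t. x t \<in> {u..v} \<Longrightarrow> dx t \<noteq> 0" and maslov: "maslov_potential \<gamma> \<mu>"
    and b: "branch u v \<phi>" and uv: "u \<le> v"
  shows "\<mu> (\<gamma> (\<phi> u)) = \<mu> (\<gamma> (\<phi> v))"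
proof (rule connected_local_const[where f = "\<lambda>a. \<mu> (\<gamma> (\<phi> a))" and A = "{u..v}"])
  show "\<forall>a\<in>{u..v}. \<forall>\<^sub>F c in at a within {u..v}. \<mu> (\<gamma> (\<phi> a)) = \<mu> (\<gamma> (\<phi> c))"
  proof
    fix a assume a: "a \<in> {u..v}"
    have "dx (\<phi> a) \<noteq> 0" using b a by (intro reg) (auto simp: branch_def)
    then have "\<not> cusp_param \<gamma> (\<phi> a)" by (simp add: cusp_param_def)
    then have "\<exists>e>0. \<forall>s. \<bar>s - \<phi> a\<bar> < e \<longrightarrow> \<mu> (\<gamma> s) = \<mu> (\<gamma> (\<phi> a))"
      using maslov[unfolded maslov_potential_def, THEN conjunct1, THEN spec[of _ "\<phi> a"]] by (rule mp[rotated])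
    then obtain e where e: "e > 0 \<and> (\<forall>s. \<bar>s - \<phi> a\<bar> < e \<longrightarrow> \<mu> (\<gamma> s) = \<mu> (\<gamma> (\<phi> a)))"
      by (rule exE)
    note e = conjunct1[OF e] conjunct2[OF e, THEN spec, THEN mp]
    have "(\<phi> \<longlongrightarrow> \<phi> a) (at a within {u..v})"
      using b a by (simp add: branch_def continuous_on_def)
    then have "\<forall>\<^sub>F c in at a within {u..v}. dist (\<phi> c) (\<phi> a) < e" using e(1) by (rule tendstoD)
    then show "\<forall>\<^sub>F c in at a within {u..v}. \<mu> (\<gamma> (\<phi> a)) = \<mu> (\<gamma> (\<phi> c))"
    proof (rule eventually_mono)
      fix c assume "dist (\<phi> c) (\<phi> a) < e"
      then have "\<bar>\<phi> c - \<phi> a\<bar> < e" by (simp only: dist_real_def)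
      then show "\<mu> (\<gamma> (\<phi> a)) = \<mu> (\<gamma> (\<phi> c))" by (rule e(2)[symmetric])
    qed
  qed
qed (use uv in auto)

text \<open>Near the crossing the slopes along the branches are close to those at the crossing, so the
  mean value theorem gives the order there; it persists back to \<open>u\<close>.\<close>

lemma smaller_slope_above:
  assumes uv: "u < v" and reg: "\<And>t. x t \<in> {u..v} \<Longrightarrow> dx t \<noteq> 0"
    and nocross: "\<And>c. c \<in> crossings \<gamma> \<Longrightarrow> fst c \<notin> {u..<v}"
    and b: "branch u v \<phi>" "branch u v \<psi>"
    and meet: "z (\<phi> v) = z (\<psi> v)" and slope: "y (\<phi> v) < y (\<psi> v)"
  shows "z (\<psi> u) < z (\<phi> u)"
proof -
  define m where "m = (y (\<phi> v) + y (\<psi> v)) / 2"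
  have m: "y (\<phi> v) < m" "m < y (\<psi> v)" using slope by (auto simp: m_def field_simps)
  have lim: "((\<lambda>a. y (\<phi> a)) \<longlongrightarrow> y (\<phi> v)) (at v within {u..v})"
    "((\<lambda>a. y (\<psi> a)) \<longlongrightarrow> y (\<psi> v)) (at v within {u..v})"
    using branch_continuous(2)[OF b(1)] branch_continuous(2)[OF b(2)] uv by (auto simp: continuous_on_def)
  have "\<forall>\<^sub>F a in at v within {u..v}. y (\<phi> a) < m \<and> m < y (\<psi> a)"
    by (intro eventually_conj order_tendstoD(2)[OF lim(1) m(1)] order_tendstoD(1)[OF lim(2) m(2)])
  then obtain e where e: "e > 0"
    "\<And>a. a \<in> {u..v} \<Longrightarrow> a \<noteq> v \<Longrightarrow> dist a v < e \<Longrightarrow> y (\<phi> a) < m \<and> m < y (\<psi> a)"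
    unfolding eventually_at by blast
  define a where "a = max u (v - e / 2)"
  have a: "u \<le> a" "a < v" "v - a < e" using uv e(1) by (auto simp: a_def)
  have near: "y (\<phi> c) < m \<and> m < y (\<psi> c)" if "c \<in> {a..v}" for c
    using e(2)[of c] that a m by (cases "c = v") (auto simp: dist_real_def)
  obtain c where c: "c \<in> {a..v}" "z (\<phi> v) - z (\<phi> a) = y (\<phi> c) * (v - a)"
    using branch_mean_value[OF reg b(1) a(1,2)] by blast
  obtain d where d: "d \<in> {a..v}" "z (\<psi> v) - z (\<psi> a) = y (\<psi> d) * (v - a)"
    using branch_mean_value[OF reg b(2) a(1,2)] by blast
  have "y (\<phi> c) * (v - a) < y (\<psi> d) * (v - a)"
    using near[OF c(1)] near[OF d(1)] a(2) by (intro mult_strict_right_mono) auto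
  then have gt: "z (\<psi> a) < z (\<phi> a)" using c(2) d(2) meet by linarith
  show ?thesis
  proof (rule ccontr)
    assume "\<not> z (\<psi> u) < z (\<phi> u)"
    then consider "z (\<phi> u) < z (\<psi> u)" | "z (\<phi> u) = z (\<psi> u)" by linarith
    then show False
    proof cases
      case 1
      then show ?thesis using branch_order[OF reg nocross b 1 a(1,2)] gt by simp
    next
      case 2
      have u: "u \<in> {u..v}" "v \<in> {u..v}" "a \<in> {u..v}" using uv a by auto
      have "\<phi> u - \<psi> u \<in> \<int>"
      proof (rule ccontr)
        assume "\<phi> u - \<psi> u \<notin> \<int>"
        then have "(x (\<psi> u), z (\<psi> u)) \<in> crossings \<gamma>"
          using b 2 u by (intro double_point) (auto simp: branch_def)
        then show False using nocross[of "(x (\<psi> u), z (\<psi> u))"] b(2) u uv by (auto simp: branch_def)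
      qed
      then show ?thesis using branch_same(1)[OF reg b u(1) _ u(3)] gt by simp
    qed
  qed
qed

end

text \<open>Over the interval from \<open>u\<close> to the crossing the front consists of branches that meet only at
  the crossing.  The branches passing above the crossing are therefore exactly those above both
  crossing branches over \<open>u\<close>, and no branch lies between these two.  So the crossing
  branches are the strands \<open>k\<close> and \<open>k + 1\<close> over \<open>u\<close>, the one with the smaller slope at the
  crossing being the upper one, and the Maslov potential is constant along them.\<close>

lemma crossing_degree:
  assumes "legendrian_knot \<gamma>" "nearly_plat \<gamma>" "maslov_potential \<gamma> \<mu>" "b \<in> crossings \<gamma>"
    "u < fst b" "\<And>c. c \<in> left_cusps \<gamma> \<union> crossings \<gamma> \<union> right_cusps \<gamma> \<Longrightarrow> fst c \<notin> {u..<fst b}"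
  shows "Q_degree \<gamma> \<mu> b = potential \<gamma> \<mu> u (position \<gamma> b) - potential \<gamma> \<mu> u (Suc (position \<gamma> b))"
    and "Suc (position \<gamma> b) \<le> strands \<gamma> u"
proof -
  interpret plat_knot \<gamma> by (rule plat_knot.intro[OF assms(1,2)])
  define v where "v = fst b"
  have uv: "u < v" using assms(5) by (simp add: v_def)
  have nocross: "fst c \<notin> {u..<v}" if "c \<in> crossings \<gamma>" for c using assms(6)[of c] that by (simp add: v_def)
  obtain s0 t0 where st0: "s0 - t0 \<notin> \<int>" "front_proj (\<gamma> s0) = front_proj (\<gamma> t0)" "b = front_proj (\<gamma> t0)"
    using assms(4) unfolding crossings_def by blast
  have xz0: "x s0 = x t0" "z s0 = z t0" using st0(2) by (auto simp: front_proj_gamma)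
  have "\<exists>sT sB. sT - sB \<notin> \<int> \<and> y sT < y sB \<and> (x sT, z sT) = b \<and> (x sB, z sB) = b"
  proof (cases "y s0 < y t0")
    case True
    then show ?thesis using st0 xz0 by (intro exI[of _ s0] exI[of _ t0]) (simp add: front_proj_gamma)
  next
    case False
    have "t0 - s0 \<notin> \<int>" using st0(1) Ints_minus[of "t0 - s0"] by auto
    moreover have "y t0 < y s0" using False transverse[OF st0(1) xz0] by auto
    ultimately show ?thesis using st0 xz0 by (intro exI[of _ t0] exI[of _ s0]) (simp add: front_proj_gamma)
  qed
  then obtain sT sB where TB: "sT - sB \<notin> \<int>" "y sT < y sB" "(x sT, z sT) = b" "(x sB, z sB) = b" by blast
  have xT: "x sT = v" "x sB = v" and zT: "z sT = snd b" "z sB = snd b"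
    using TB(3,4) by (auto simp: v_def)
  have at_b: "s - sT \<in> \<int> \<or> s - sB \<in> \<int>" if "x s = v" "z s = snd b" for s
    using no_triple[of s sT sB] that TB(1) xT zT by auto
  have not_both: "\<not> (t - sT \<in> \<int> \<and> t - sB \<in> \<int>)" for t
  proof
    assume both: "t - sT \<in> \<int> \<and> t - sB \<in> \<int>"
    have "(t - sB) - (t - sT) \<in> \<int>"
      by (rule Ints_diff[OF conjunct2[OF both] conjunct1[OF both]])
    moreover have "(t - sB) - (t - sT) = sT - sB" by simp
    ultimately show False using TB(1) by (simp only:)
  qed
  have reg: "dx t \<noteq> 0" if "x t \<in> {u..v}" for t
  proof
    assume crit: "dx t = 0"
    note sing = critical_point[OF crit]
    then have "x t = v" using assms(6)[of "(x t, z t)"] that by (auto simp: v_def)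
    then have "(x t, z t) = b" using sing assms(4) by (intro singular_eqI) (auto simp: v_def)
    then have "t - sT \<in> \<int> \<or> t - sB \<in> \<int>" using at_b[of t] \<open>x t = v\<close> by auto
    then have "t - sB \<notin> \<int> \<or> t - sT \<notin> \<int>" using not_both by blast
    then show False
      using transverse[of t sB] transverse[of t sT] crit \<open>(x t, z t) = b\<close> TB(3,4) by auto
  qed
  have uv_mem: "u \<in> {u..v}" "v \<in> {u..v}" using uv by auto
  obtain \<phi> where \<phi>: "branch u v \<phi>" "\<phi> v = sT"
    using branch_exists[OF uv reg, of sT] xT uv_mem by auto
  obtain \<psi> where \<psi>: "branch u v \<psi>" "\<psi> v = sB"
    using branch_exists[OF uv reg, of sB] xT uv_mem by auto
  have above: "z (\<psi> u) < z (\<phi> u)"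
    by (rule smaller_slope_above[OF uv reg nocross \<phi>(1) \<psi>(1)]) (use TB(2) zT \<phi>(2) \<psi>(2) in auto)
  have xu: "x (\<theta> u) = u" "x (\<theta> v) = v" if "branch u v \<theta>" for \<theta>
    using that uv_mem by (auto simp: branch_def)
  \<comment> \<open>There is no crossing over \<open>u\<close>.\<close>
  have same_u: "\<theta> u - \<theta>' u \<in> \<int>" if "branch u v \<theta>" "branch u v \<theta>'" "z (\<theta> u) = z (\<theta>' u)" for \<theta> \<theta>'
  proof (rule ccontr)
    assume "\<theta> u - \<theta>' u \<notin> \<int>"
    then have "(x (\<theta>' u), z (\<theta>' u)) \<in> crossings \<gamma>" using that xu by (intro double_point) auto
    then show False using nocross[of "(x (\<theta>' u), z (\<theta>' u))"] xu(1)[OF that(2)] uv by auto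
  qed
  have weak_order: "z (\<theta> v) \<le> z (\<theta>' v)" if br: "branch u v \<theta>" "branch u v \<theta>'" and less: "z (\<theta> u) < z (\<theta>' u)" for \<theta> \<theta>'
  proof (rule ccontr)
    assume n: "\<not> z (\<theta> v) \<le> z (\<theta>' v)"
    let ?h = "\<lambda>a. z (\<theta>' a) - z (\<theta> a)"
    have "continuous_on {u..v} ?h"
      by (intro continuous_on_diff branch_continuous(1) br)
    then obtain c where c: "u \<le> c" "c \<le> v" "?h c = 0"
      using IVT2'[of ?h v 0 u] n less uv by auto
    then show False using branch_order[OF reg nocross br less c(1)] n by (cases "c = v") auto
  qed
  have through_b: "z (\<theta> u) = z (\<phi> u) \<or> z (\<theta> u) = z (\<psi> u)"
    if br: "branch u v \<theta>" and zb: "z (\<theta> v) = snd b" for \<theta>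
    using at_b[OF xu(2)[OF br] zb] branch_same(1)[OF reg br \<phi>(1) uv_mem(2) _ uv_mem(1)]
      branch_same(1)[OF reg br \<psi>(1) uv_mem(2) _ uv_mem(1)] \<phi>(2) \<psi>(2) by auto
  have branch_at: "\<exists>\<theta>. branch u v \<theta> \<and> \<theta> a = t" if "x t = a" "a \<in> {u..v}" for t a
    using branch_exists[OF uv reg, of t] that by auto
  have fin: "finite {c. (a, c) \<in> front \<gamma>}" if "a \<in> {u..v}" for a
    by (rule fibre_finite) (use reg that in auto)
  define A where "A = {c. (u, c) \<in> front \<gamma> \<and> c > z (\<phi> u)}"
  define B where "B = {c. (v, c) \<in> front \<gamma> \<and> c > snd b}"
  define \<theta> where "\<theta> = (\<lambda>c. SOME \<theta>. branch u v \<theta> \<and> z (\<theta> u) = c)"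
  have \<theta>: "branch u v (\<theta> c)" "z (\<theta> c u) = c" if "c \<in> A" for c
  proof -
    obtain t where t: "x t = u" "z t = c" using \<open>c \<in> A\<close> by (auto simp: A_def mem_front)
    obtain \<theta>' where "branch u v \<theta>'" "\<theta>' u = t" using branch_at[OF t(1) uv_mem(1)] by blast
    then have "\<exists>\<theta>. branch u v \<theta> \<and> z (\<theta> u) = c" using t by blast
    then have "branch u v (\<theta> c) \<and> z (\<theta> c u) = c" unfolding \<theta>_def by (rule someI_ex)
    then show "branch u v (\<theta> c)" "z (\<theta> c u) = c" by auto
  qed
  \<comment> \<open>Following branches matches the points over \<open>u\<close> above \<open>\<phi>\<close> with those over \<open>v\<close> above the crossing.\<close>
  have "bij_betw (\<lambda>c. z (\<theta> c v)) A B"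
    unfolding bij_betw_def
  proof (intro conjI inj_onI equalityI subsetI)
    have into: "z (\<theta> c v) > snd b" if c: "c \<in> A" for c
    proof -
      have gt: "z (\<phi> u) < z (\<theta> c u)" using \<theta>(2)[OF c] c by (simp add: A_def)
      have "z (\<phi> v) \<le> z (\<theta> c v)" by (rule weak_order[OF \<phi>(1) \<theta>(1)[OF c] gt])
      moreover have "z (\<theta> c v) \<noteq> snd b" using through_b[OF \<theta>(1)[OF c]] gt above by auto
      ultimately show ?thesis using \<phi>(2) zT(1) by auto
    qed
    show "w \<in> B" if "w \<in> (\<lambda>c. z (\<theta> c v)) ` A" for w
    proof -
      obtain c where c: "c \<in> A" "w = z (\<theta> c v)" using \<open>w \<in> (\<lambda>c. z (\<theta> c v)) ` A\<close> by blast
      have "(v, w) \<in> front \<gamma>" unfolding mem_front using xu(2)[OF \<theta>(1)[OF c(1)]] c(2) by blast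
      then show ?thesis using into[OF c(1)] c(2) by (simp add: B_def)
    qed
    show "c = c'" if c: "c \<in> A" "c' \<in> A" "z (\<theta> c v) = z (\<theta> c' v)" for c c'
    proof -
      have "\<theta> c v - \<theta> c' v \<in> \<int>"
      proof (rule ccontr)
        assume "\<theta> c v - \<theta> c' v \<notin> \<int>"
        then have "(x (\<theta> c' v), z (\<theta> c' v)) \<in> crossings \<gamma>"
          using c xu(2) \<theta>(1) by (intro double_point) auto
        then have "(x (\<theta> c' v), z (\<theta> c' v)) = b"
          using assms(4) xu(2)[OF \<theta>(1)[OF c(2)]] by (intro singular_eqI) (auto simp: v_def)
        then show False using into[OF c(2)] by auto
      qed
      then show ?thesis
        using branch_same(1)[OF reg \<theta>(1)[OF c(1)] \<theta>(1)[OF c(2)] uv_mem(2) _ uv_mem(1)] \<theta>(2) c by simp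
    qed
    show "w \<in> (\<lambda>c. z (\<theta> c v)) ` A" if w: "w \<in> B" for w
    proof -
      obtain t where t: "x t = v" "z t = w" using w by (auto simp: B_def mem_front)
      obtain \<theta>' where \<theta>': "branch u v \<theta>'" "\<theta>' v = t" using branch_at[OF t(1) uv_mem(2)] by blast
      have "z (\<phi> u) < z (\<theta>' u)"
      proof (rule ccontr)
        assume "\<not> z (\<phi> u) < z (\<theta>' u)"
        then consider "z (\<theta>' u) < z (\<phi> u)" | "z (\<theta>' u) = z (\<phi> u)" by linarith
        then have "z (\<theta>' v) \<le> z (\<phi> v)"
        proof cases
          case 1
          then show ?thesis by (rule weak_order[OF \<theta>'(1) \<phi>(1)])
        next
          case 2
          show ?thesis
            using branch_same(1)[OF reg \<theta>'(1) \<phi>(1) uv_mem(1) same_u[OF \<theta>'(1) \<phi>(1) 2] uv_mem(2)] by simp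
        qed
        then show False using w t(2) \<theta>'(2) \<phi>(2) zT(1) by (simp add: B_def)
      qed
      moreover have "(u, z (\<theta>' u)) \<in> front \<gamma>" unfolding mem_front using xu(1)[OF \<theta>'(1)] by blast
      ultimately have c: "z (\<theta>' u) \<in> A" by (simp add: A_def)
      have "z (\<theta> (z (\<theta>' u)) v) = z (\<theta>' v)"
        by (rule branch_same(1)[OF reg \<theta>(1)[OF c] \<theta>'(1) uv_mem(1) same_u[OF \<theta>(1)[OF c] \<theta>'(1) \<theta>(2)[OF c]] uv_mem(2)])
      then show ?thesis using c \<theta>'(2) t(2) by (intro image_eqI[of _ _ "z (\<theta>' u)"]) auto
    qed
  qed
  then have card: "card A = card B" by (rule bij_betw_same_card)
  have finA: "finite A" by (rule finite_subset[OF _ fin[OF uv_mem(1)]]) (auto simp: A_def)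
  have pos_b: "position \<gamma> b = Suc (card B)" by (simp add: position_def B_def v_def)
  have pos_T: "position \<gamma> (u, z (\<phi> u)) = position \<gamma> b"
    unfolding pos_b position_eq A_def[symmetric] card by simp
  have below: "{c. (u, c) \<in> front \<gamma> \<and> c > z (\<psi> u)} = insert (z (\<phi> u)) A"
  proof (intro equalityI subsetI)
    fix c assume "c \<in> insert (z (\<phi> u)) A"
    moreover have "(u, z (\<phi> u)) \<in> front \<gamma>" unfolding mem_front using xu(1)[OF \<phi>(1)] by blast
    ultimately show "c \<in> {c. (u, c) \<in> front \<gamma> \<and> c > z (\<psi> u)}" using above by (auto simp: A_def)
  next
    fix c assume c: "c \<in> {c. (u, c) \<in> front \<gamma> \<and> c > z (\<psi> u)}"
    show "c \<in> insert (z (\<phi> u)) A"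
    proof (rule ccontr)
      assume "c \<notin> insert (z (\<phi> u)) A"
      then have lt: "z (\<psi> u) < c" "c < z (\<phi> u)" using c by (auto simp: A_def)
      obtain t where t: "x t = u" "z t = c" using c by (auto simp: mem_front)
      obtain \<theta>' where \<theta>': "branch u v \<theta>'" "\<theta>' u = t" using branch_at[OF t(1) uv_mem(1)] by blast
      have "z (\<psi> v) \<le> z (\<theta>' v)" "z (\<theta>' v) \<le> z (\<phi> v)"
        using lt t(2) \<theta>'(2) by (auto intro: weak_order \<theta>'(1) \<phi>(1) \<psi>(1))
      then have "z (\<theta>' v) = snd b" using \<phi>(2) \<psi>(2) zT by simp
      then show False using through_b[OF \<theta>'(1)] lt t(2) \<theta>'(2) by auto
    qed
  qed
  have zA: "z (\<phi> u) \<notin> A" "z (\<psi> u) \<notin> insert (z (\<phi> u)) A" using above by (auto simp: A_def)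
  then have pos_B: "position \<gamma> (u, z (\<psi> u)) = Suc (position \<gamma> b)"
    unfolding position_eq[of u "z (\<psi> u)"] below pos_b using finA card by simp
  have "(u, z (\<psi> u)) \<in> front \<gamma>" unfolding mem_front using xu(1)[OF \<psi>(1)] by blast
  then have "insert (z (\<psi> u)) {c. (u, c) \<in> front \<gamma> \<and> c > z (\<psi> u)} \<subseteq> {c. (u, c) \<in> front \<gamma>}" by auto
  then have "card (insert (z (\<psi> u)) {c. (u, c) \<in> front \<gamma> \<and> c > z (\<psi> u)}) \<le> strands \<gamma> u"
    unfolding strands_def by (intro card_mono fin[OF uv_mem(1)])
  then show "Suc (position \<gamma> b) \<le> strands \<gamma> u"
    using finA zA unfolding below pos_b by (simp add: card)
  have nc: "fst c \<noteq> u" if "c \<in> crossings \<gamma>" for c using nocross[OF that] uv by auto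
  have pots: "potential \<gamma> \<mu> u (position \<gamma> b) = \<mu> (\<gamma> sT)" "potential \<gamma> \<mu> u (Suc (position \<gamma> b)) = \<mu> (\<gamma> sB)"
  proof -
    have "strand_point \<gamma> u (position \<gamma> b) = \<gamma> (\<phi> u)"
      using strand_point_eq[of "\<phi> u"] fin[OF uv_mem(1)] nc xu(1)[OF \<phi>(1)] pos_T by simp
    then show "potential \<gamma> \<mu> u (position \<gamma> b) = \<mu> (\<gamma> sT)"
      using maslov_branch[OF reg assms(3) \<phi>(1)] uv \<phi>(2) by (simp add: potential_def)
    have "strand_point \<gamma> u (Suc (position \<gamma> b)) = \<gamma> (\<psi> u)"
      using strand_point_eq[of "\<psi> u"] fin[OF uv_mem(1)] nc xu(1)[OF \<psi>(1)] pos_B by simp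
    then show "potential \<gamma> \<mu> u (Suc (position \<gamma> b)) = \<mu> (\<gamma> sB)"
      using maslov_branch[OF reg assms(3) \<psi>(1)] uv \<psi>(2) by (simp add: potential_def)
  qed
  have "b \<notin> right_cusps \<gamma>"
  proof
    assume "b \<in> right_cusps \<gamma>"
    then have "fst b < fst b" using assms(2,4) unfolding nearly_plat_def by blast
    then show False by simp
  qed
  moreover have "(THE d. \<exists>T \<in> range \<gamma>. \<exists>B \<in> range \<gamma>. front_proj T = b \<and> front_proj B = b \<and>
              fst (snd T) < fst (snd B) \<and> d = \<mu> T - \<mu> B) = \<mu> (\<gamma> sT) - \<mu> (\<gamma> sB)"
  proof (rule the_equality)
    show "\<exists>T \<in> range \<gamma>. \<exists>B \<in> range \<gamma>. front_proj T = b \<and> front_proj B = b \<and>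
              fst (snd T) < fst (snd B) \<and> \<mu> (\<gamma> sT) - \<mu> (\<gamma> sB) = \<mu> T - \<mu> B"
      using TB(2-4) by (intro bexI[of _ "\<gamma> sT"] bexI[of _ "\<gamma> sB"]) (auto simp: front_proj_gamma cy_def)
    fix d assume "\<exists>T \<in> range \<gamma>. \<exists>B \<in> range \<gamma>. front_proj T = b \<and> front_proj B = b \<and>
              fst (snd T) < fst (snd B) \<and> d = \<mu> T - \<mu> B"
    then obtain p q where pq: "front_proj (\<gamma> p) = b" "front_proj (\<gamma> q) = b" "y p < y q" "d = \<mu> (\<gamma> p) - \<mu> (\<gamma> q)"
      by (auto simp: cy_def)
    have "p - sT \<in> \<int> \<or> p - sB \<in> \<int>" "q - sT \<in> \<int> \<or> q - sB \<in> \<int>"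
      using at_b[of p] at_b[of q] pq(1,2) by (auto simp: front_proj_gamma v_def)
    then have "\<gamma> p = \<gamma> sT \<or> \<gamma> p = \<gamma> sB" "\<gamma> q = \<gamma> sT \<or> \<gamma> q = \<gamma> sB" using same_point by blast+
    then have "\<gamma> p = \<gamma> sT \<and> \<gamma> q = \<gamma> sB" using pq(3) TB(2) by (auto simp: cy_def)
    then show "d = \<mu> (\<gamma> sT) - \<mu> (\<gamma> sB)" using pq(4) by simp
  qed
  ultimately show "Q_degree \<gamma> \<mu> b = potential \<gamma> \<mu> u (position \<gamma> b) - potential \<gamma> \<mu> u (Suc (position \<gamma> b))"
    unfolding Q_degree_def pots by simp
qed

section \<open>Strips, generators and lines of a Morse complex sequence\<close>

text \<open>The number of a generator in the order from left to right.  It depends on the front only,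
  so that the matrices read off two MCSs can be compared.\<close>

definition gen_index :: "space_curve \<Rightarrow> real \<times> real \<Rightarrow> nat" where
  "gen_index \<gamma> a = card {c \<in> QL \<gamma>. fst c < fst a}"

locale mcs_front =
  fixes \<gamma> :: space_curve and \<mu> :: "real \<times> real \<times> real \<Rightarrow> int" and C :: mcs
  assumes knot: "legendrian_knot \<gamma>" and plat: "nearly_plat \<gamma>"
    and maslov: "maslov_potential \<gamma> \<mu>" and mcs: "is_mcs \<gamma> \<mu> C"
begin

abbreviation n :: nat where "n \<equiv> nlines C"
abbreviation N :: "nat \<Rightarrow> nat" where "N m \<equiv> strands \<gamma> (line C m)"
abbreviation pot :: "nat \<Rightarrow> nat \<Rightarrow> int" where "pot m \<equiv> potential \<gamma> \<mu> (line C m)"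
abbreviation ev :: "nat \<Rightarrow> event" where "ev \<equiv> strip_event \<gamma> C"
abbreviation implicit :: "nat \<Rightarrow> (nat \<times> nat) set" where "implicit \<equiv> implicit_marks \<gamma> C"
abbreviation cplx :: "nat \<Rightarrow> nat based_complex" where "cplx m \<equiv> stranded (N m) (pot m) (dcoef C m)"

lemma lines: "mcs_lines \<gamma> C"
  using mcs by (simp add: is_mcs_def)

lemma n_pos: "1 \<le> n"
  using lines by (simp add: mcs_lines_def)

lemma line_less: "1 \<le> m \<Longrightarrow> m < m' \<Longrightarrow> m' \<le> n \<Longrightarrow> line C m < line C m'"
  using lines unfolding mcs_lines_def strict_mono_on_def by auto

lemma line_le: "1 \<le> m \<Longrightarrow> m \<le> m' \<Longrightarrow> m' \<le> n \<Longrightarrow> line C m \<le> line C m'"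
  using line_less[of m m'] by (cases "m = m'") auto

lemma strip_upper: "m < n \<Longrightarrow> x \<in> strip C m \<Longrightarrow> x < line C (Suc m)"
  by (auto simp: strip_def split: if_splits)

lemma strip_lower: "1 \<le> m \<Longrightarrow> x \<in> strip C m \<Longrightarrow> line C m < x"
  by (auto simp: strip_def split: if_splits)

lemma strip_less:
  assumes "m < m'" "m' \<le> n" "x \<in> strip C m" "y \<in> strip C m'"
  shows "x < y"
proof -
  have "x < line C (Suc m)" using strip_upper assms by simp
  also have "\<dots> \<le> line C m'" using line_le[of "Suc m" m'] assms by simp
  also have "\<dots> < y" using strip_lower assms by simp
  finally show ?thesis .
qed

lemma strip_unique: "m \<le> n \<Longrightarrow> m' \<le> n \<Longrightarrow> x \<in> strip C m \<Longrightarrow> x \<in> strip C m' \<Longrightarrow> m = m'"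
  using strip_less[of m m' x x] strip_less[of m' m x x] by (cases m m' rule: linorder_cases) auto

lemma in_some_strip:
  assumes "x \<notin> line C ` {1..n}"
  shows "\<exists>m\<le>n. x \<in> strip C m"
proof (cases "x < line C 1")
  case True
  then show ?thesis by (intro exI[of _ 0]) (simp add: strip_def)
next
  case False
  define A where "A = {k \<in> {1..n}. line C k < x}"
  have "line C 1 \<noteq> x" using assms n_pos by auto
  then have ne: "A \<noteq> {}" "finite A" using False n_pos by (auto simp: A_def)
  define m where "m = Max A"
  have m: "m \<in> A" "\<And>k. k \<in> A \<Longrightarrow> k \<le> m" using ne by (auto simp: m_def)
  show ?thesis
  proof (cases "m < n")
    case True
    then have "Suc m \<notin> A" using m(2)[of "Suc m"] by auto
    then have "\<not> line C (Suc m) < x" using True by (auto simp: A_def)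
    moreover have "line C (Suc m) \<noteq> x" using assms True by auto
    ultimately show ?thesis using m(1) True by (intro exI[of _ m]) (auto simp: strip_def A_def)
  next
    case False
    then show ?thesis using m(1) by (intro exI[of _ m]) (auto simp: strip_def A_def)
  qed
qed

lemma ex1_event: "m \<le> n \<Longrightarrow> \<exists>!e. e \<in> events \<gamma> C \<and> fst e \<in> strip C m"
  using lines by (simp add: mcs_lines_def)

lemma strip_event_eq:
  assumes "(x, e) \<in> events \<gamma> C" "x \<in> strip C m" "m \<le> n"
  shows "ev m = e"
  unfolding strip_event_def using the1_equality[OF ex1_event[OF assms(3)], of "(x, e)"] assms by simp

lemma strip_eventE:
  assumes "m \<le> n"
  obtains x where "x \<in> strip C m" "(x, ev m) \<in> events \<gamma> C"
proof -
  let ?e = "THE e. e \<in> events \<gamma> C \<and> fst e \<in> strip C m"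
  have "?e \<in> events \<gamma> C \<and> fst ?e \<in> strip C m" by (rule theI'[OF ex1_event[OF assms]])
  then show ?thesis using that[of "fst ?e"] by (simp add: strip_event_def)
qed

lemma same_strip_event:
  assumes "(x, e) \<in> events \<gamma> C" "(y, e') \<in> events \<gamma> C" "x \<in> strip C m" "y \<in> strip C m" "m \<le> n"
  shows "x = y \<and> e = e'"
  using ex1_event[OF assms(5)] assms by (metis fst_conv prod.inject)

lemma event_intros:
  "p \<in> left_cusps \<gamma> \<Longrightarrow> (fst p, LeftCusp (position \<gamma> p)) \<in> events \<gamma> C"
  "p \<in> right_cusps \<gamma> \<Longrightarrow> (fst p, RightCusp (position \<gamma> p)) \<in> events \<gamma> C"
  "p \<in> crossings \<gamma> \<Longrightarrow> (fst p, Crossing (position \<gamma> p)) \<in> events \<gamma> C"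
  unfolding events_def by blast+

lemma event_elims:
  "(x, LeftCusp k) \<in> events \<gamma> C \<Longrightarrow> \<exists>p\<in>left_cusps \<gamma>. x = fst p \<and> k = position \<gamma> p"
  "(x, RightCusp k) \<in> events \<gamma> C \<Longrightarrow> \<exists>p\<in>right_cusps \<gamma>. x = fst p \<and> k = position \<gamma> p"
  "(x, Crossing k) \<in> events \<gamma> C \<Longrightarrow> \<exists>p\<in>crossings \<gamma>. x = fst p \<and> k = position \<gamma> p"
  "(x, Slide k l) \<in> events \<gamma> C \<Longrightarrow> (x, k, l) \<in> slides C"
  unfolding events_def by auto

lemma event_strip:
  assumes "(x, e) \<in> events \<gamma> C"
  obtains m where "m \<le> n" "x \<in> strip C m" "ev m = e"
proof -
  have "x \<notin> line C ` {1..n}" using lines assms unfolding mcs_lines_def by (force simp: image_iff)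
  then obtain m where "m \<le> n" "x \<in> strip C m" using in_some_strip by blast
  then show ?thesis using that strip_event_eq[OF assms] by blast
qed

lemma plat_order:
  "l \<in> left_cusps \<gamma> \<Longrightarrow> c \<in> crossings \<gamma> \<Longrightarrow> fst l < fst c"
  "c \<in> crossings \<gamma> \<Longrightarrow> r \<in> right_cusps \<gamma> \<Longrightarrow> fst c < fst r"
  "l \<in> left_cusps \<gamma> \<Longrightarrow> r \<in> right_cusps \<gamma> \<Longrightarrow> fst l < fst r"
  "r \<in> right_cusps \<gamma> \<Longrightarrow> odd (position \<gamma> r)"
  using plat by (auto simp: nearly_plat_def)

lemma QL_eqI: "a \<in> QL \<gamma> \<Longrightarrow> b \<in> QL \<gamma> \<Longrightarrow> fst a = fst b \<Longrightarrow> a = b"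
  using plat unfolding nearly_plat_def QL_def inj_on_def by blast

lemma event_order:
  assumes "m \<le> n" "m' \<le> n"
  shows "ev m = LeftCusp k \<Longrightarrow> ev m' = Crossing l \<Longrightarrow> m < m'"
    and "ev m = LeftCusp k \<Longrightarrow> ev m' = RightCusp l \<Longrightarrow> m < m'"
    and "ev m = Crossing k \<Longrightarrow> ev m' = RightCusp l \<Longrightarrow> m < m'"
proof -
  obtain x where x: "x \<in> strip C m" "(x, ev m) \<in> events \<gamma> C" using strip_eventE assms by blast
  obtain y where y: "y \<in> strip C m'" "(y, ev m') \<in> events \<gamma> C" using strip_eventE assms by blast
  have less: "m < m'" if "x < y"
  proof (rule ccontr)
    assume "\<not> m < m'"
    then consider "m' < m" | "m' = m" by linarith
    then show False
    proof cases
      case 1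
      then show ?thesis using strip_less[OF 1 assms(1) y(1) x(1)] that by simp
    next
      case 2
      then show ?thesis using same_strip_event[OF x(2) y(2) x(1)] y(1) assms that by simp
    qed
  qed
  show "ev m = LeftCusp k \<Longrightarrow> ev m' = Crossing l \<Longrightarrow> m < m'"
    using x(2) y(2) event_elims(1)[of x k] event_elims(3)[of y l] plat_order(1) less by auto
  show "ev m = LeftCusp k \<Longrightarrow> ev m' = RightCusp l \<Longrightarrow> m < m'"
    using x(2) y(2) event_elims(1)[of x k] event_elims(2)[of y l] plat_order(3) less by auto
  show "ev m = Crossing k \<Longrightarrow> ev m' = RightCusp l \<Longrightarrow> m < m'"
    using x(2) y(2) event_elims(3)[of x k] event_elims(2)[of y l] plat_order(2) less by auto
qed

lemma first_event: "ev 0 = LeftCusp 1" and N_1: "N 1 = 2"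
  using first_strip[OF knot plat mcs] by auto

text \<open>The knot has a right cusp, and this lies behind all crossings and left cusps.\<close>

lemma last_event: "(\<exists>k. ev n = RightCusp k) \<or> (\<exists>k l. ev n = Slide k l)"
proof -
  obtain r where r: "r \<in> right_cusps \<gamma>" using right_cusp_exists[OF knot plat] by blast
  obtain m where m: "m \<le> n" "ev m = RightCusp (position \<gamma> r)"
    using event_strip[OF event_intros(2)[OF r]] by metis
  show ?thesis
    using event_order(2)[OF le_refl m(1) _ m(2)] event_order(3)[OF le_refl m(1) _ m(2)] m(1)
    by (cases "ev n") (auto dest: leD)
qed

lemma QL_strip:
  assumes "a \<in> QL \<gamma>"
  obtains m where "1 \<le> m" "m \<le> n" "fst a \<in> strip C m"
    "a \<in> crossings \<gamma> \<and> ev m = Crossing (position \<gamma> a) \<or>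
     a \<in> right_cusps \<gamma> \<and> ev m = RightCusp (position \<gamma> a)"
proof -
  consider "a \<in> crossings \<gamma>" | "a \<in> right_cusps \<gamma>" using assms by (auto simp: QL_def)
  then obtain m where m: "m \<le> n" "fst a \<in> strip C m"
    "a \<in> crossings \<gamma> \<and> ev m = Crossing (position \<gamma> a) \<or>
     a \<in> right_cusps \<gamma> \<and> ev m = RightCusp (position \<gamma> a)"
  proof cases
    case 1
    then show ?thesis using event_strip[OF event_intros(3)[OF 1]] that by metis
  next
    case 2
    then show ?thesis using event_strip[OF event_intros(2)[OF 2]] that by metis
  qed
  moreover have "m \<noteq> 0"
  proof
    assume "m = 0"
    then show False using m(3) first_event by auto
  qed
  ultimately show ?thesis using that[of m] by simp
qed

lemma strip_QL:
  assumes "m \<le> n"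
  shows "ev m = Crossing k \<Longrightarrow> \<exists>a\<in>crossings \<gamma>. fst a \<in> strip C m \<and> position \<gamma> a = k"
    and "ev m = RightCusp k \<Longrightarrow> \<exists>a\<in>right_cusps \<gamma>. fst a \<in> strip C m \<and> position \<gamma> a = k"
proof -
  obtain x where x: "x \<in> strip C m" "(x, ev m) \<in> events \<gamma> C" using strip_eventE assms by blast
  show "ev m = Crossing k \<Longrightarrow> \<exists>a\<in>crossings \<gamma>. fst a \<in> strip C m \<and> position \<gamma> a = k"
    using x event_elims(3)[of x k] by auto
  show "ev m = RightCusp k \<Longrightarrow> \<exists>a\<in>right_cusps \<gamma>. fst a \<in> strip C m \<and> position \<gamma> a = k"
    using x event_elims(2)[of x k] by auto
qed

lemma QL_event: "a \<in> QL \<gamma> \<Longrightarrow> \<exists>e. (fst a, e) \<in> events \<gamma> C"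
  unfolding QL_def using event_intros(2,3)[of a] by blast

lemma QL_same_strip:
  assumes "a \<in> QL \<gamma>" "b \<in> QL \<gamma>" "fst a \<in> strip C m" "fst b \<in> strip C m" "m \<le> n"
  shows "a = b"
proof -
  obtain e e' where "(fst a, e) \<in> events \<gamma> C" "(fst b, e') \<in> events \<gamma> C"
    using QL_event assms(1,2) by blast
  then show ?thesis using same_strip_event[OF _ _ assms(3-5)] QL_eqI[OF assms(1,2)] by blast
qed

text \<open>The state on the line \<open>m\<close>; the strips to the left of it are those numbered below \<open>m\<close>.\<close>

definition state :: "nat \<Rightarrow> cstate" where
  "state m = run (take m (marked_front \<gamma> C)) start"

lemma length_marked_front: "length (marked_front \<gamma> C) = Suc n"
  by (simp add: marked_front_def)

lemma marked_front_nth: "m \<le> n \<Longrightarrow> marked_front \<gamma> C ! m = (ev m, implicit m)"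
  unfolding marked_front_def by (subst nth_map) (auto simp del: upt_Suc)

lemma state_0: "state 0 = start"
  by (simp add: state_def)

lemma take_Suc_front: "m \<le> n \<Longrightarrow> take (Suc m) (marked_front \<gamma> C) =
    take m (marked_front \<gamma> C) @ [(ev m, implicit m)]"
  by (simp add: take_Suc_conv_app_nth length_marked_front marked_front_nth)

lemma state_Suc: "m \<le> n \<Longrightarrow> state (Suc m) = advance (ev m, implicit m) (state m)"
  by (simp add: state_def take_Suc_front)

lemma late_state: "m \<le> Suc n \<Longrightarrow> late (state m) \<longleftrightarrow> (\<exists>m'<m. \<exists>k. ev m' = RightCusp k)"
proof (induction m)
  case 0
  then show ?case by (simp add: state_0 start_def)
next
  case (Suc m)
  then show ?case by (cases "ev m") (auto simp: state_Suc less_Suc_eq)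
qed

lemma ngen_state: "m \<le> Suc n \<Longrightarrow>
    finite {c \<in> QL \<gamma>. \<exists>m'<m. fst c \<in> strip C m'} \<and>
    ngen (state m) = card {c \<in> QL \<gamma>. \<exists>m'<m. fst c \<in> strip C m'}"
proof (induction m)
  case 0
  then show ?case by (simp add: state_0 start_def)
next
  case (Suc m)
  let ?A = "\<lambda>m. {c \<in> QL \<gamma>. \<exists>m'<m. fst c \<in> strip C m'}"
  let ?B = "{c \<in> QL \<gamma>. fst c \<in> strip C m}"
  have m: "m \<le> n" using Suc.prems by simp
  have un: "?A (Suc m) = ?A m \<union> ?B" by (auto simp: less_Suc_eq)
  have disj: "?A m \<inter> ?B = {}"
  proof (rule equals0I)
    fix c assume "c \<in> ?A m \<inter> ?B"
    then have c: "\<exists>m'<m. fst c \<in> strip C m'" "fst c \<in> strip C m" by simp_all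
    from c(1) obtain m' where "m' < m" "fst c \<in> strip C m'" by (elim exE conjE)
    then show False using strip_unique[of m' m "fst c"] m c(2) by simp
  qed
  have one: "?B = {a}" if "a \<in> QL \<gamma>" "fst a \<in> strip C m" for a
  proof (intro equalityI subsetI)
    show "c \<in> {a}" if "c \<in> ?B" for c
      using QL_same_strip[of c a m] that \<open>a \<in> QL \<gamma>\<close> \<open>fst a \<in> strip C m\<close> m by simp
    show "c \<in> ?B" if "c \<in> {a}" for c
      using that \<open>a \<in> QL \<gamma>\<close> \<open>fst a \<in> strip C m\<close> by simp
  qed
  have fin: "finite (?A m)" and ng: "ngen (state m) = card (?A m)" using Suc by auto
  have B: "finite ?B \<and> ngen (state (Suc m)) = ngen (state m) + card ?B"
  proof (cases "ev m")
    case (Crossing k)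
    then obtain a where "a \<in> crossings \<gamma>" "fst a \<in> strip C m" using strip_QL(1)[OF m] by blast
    then have "?B = {a}" by (intro one) (auto simp: QL_def)
    then show ?thesis using m by (simp add: state_Suc Crossing)
  next
    case (RightCusp k)
    then obtain a where "a \<in> right_cusps \<gamma>" "fst a \<in> strip C m" using strip_QL(2)[OF m] by blast
    then have "?B = {a}" by (intro one) (auto simp: QL_def)
    then show ?thesis using m by (simp add: state_Suc RightCusp)
  next
    case (LeftCusp k)
    have "?B = {}"
    proof (rule ccontr)
      assume "?B \<noteq> {}"
      then obtain a where a: "a \<in> QL \<gamma>" "fst a \<in> strip C m" by blast
      obtain m' where "m' \<le> n" "fst a \<in> strip C m'" "ev m' \<noteq> LeftCusp k"
        using QL_strip[OF a(1)] by (metis event.distinct)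
      then show False using strip_unique[OF m _ a(2)] LeftCusp by blast
    qed
    then have "finite ?B" "card ?B = 0" by (simp_all only: finite.emptyI card.empty)
    then show ?thesis using m by (simp add: state_Suc LeftCusp)
  next
    case (Slide k l)
    have "?B = {}"
    proof (rule ccontr)
      assume "?B \<noteq> {}"
      then obtain a where a: "a \<in> QL \<gamma>" "fst a \<in> strip C m" by blast
      obtain m' where "m' \<le> n" "fst a \<in> strip C m'" "ev m' \<noteq> Slide k l"
        using QL_strip[OF a(1)] by (metis event.distinct)
      then show False using strip_unique[OF m _ a(2)] Slide by blast
    qed
    then have "finite ?B" "card ?B = 0" by (simp_all only: finite.emptyI card.empty)
    then show ?thesis using m by (simp add: state_Suc Slide)
  qed
  have "finite (?A (Suc m))" unfolding un using fin B by simp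
  moreover have "card (?A (Suc m)) = card (?A m) + card ?B"
    unfolding un using fin B disj by (intro card_Un_disjoint) auto
  ultimately show ?case using B ng by simp
qed

lemma QL_all_strips: "{c \<in> QL \<gamma>. \<exists>m'<Suc n. fst c \<in> strip C m'} = QL \<gamma>"
  using QL_strip by (auto simp: less_Suc_eq_le) metis

lemma finite_QL: "finite (QL \<gamma>)"
  using ngen_state[of "Suc n"] QL_all_strips by simp

lemma ngen_final: "ngen (state (Suc n)) = card (QL \<gamma>)"
  using ngen_state[of "Suc n"] QL_all_strips by simp

lemma gen_index_eq:
  assumes "a \<in> QL \<gamma>" "fst a \<in> strip C m" "m \<le> n"
  shows "gen_index \<gamma> a = ngen (state m)"
proof -
  have "{c \<in> QL \<gamma>. fst c < fst a} = {c \<in> QL \<gamma>. \<exists>m'<m. fst c \<in> strip C m'}"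
  proof (intro Collect_cong conj_cong refl iffI)
    fix c assume c: "c \<in> QL \<gamma>"
    show "fst c < fst a" if "\<exists>m'<m. fst c \<in> strip C m'"
      using that strip_less[OF _ assms(3) _ assms(2)] by blast
    assume less: "fst c < fst a"
    obtain m' where m': "m' \<le> n" "fst c \<in> strip C m'" using QL_strip[OF c] by metis
    have "\<not> m < m'" using strip_less[OF _ m'(1) assms(2) m'(2)] less by auto
    moreover have "m' \<noteq> m" using QL_same_strip[OF c assms(1) _ assms(2,3)] m'(2) less by auto
    ultimately show "\<exists>m'<m. fst c \<in> strip C m'" using m'(2) by (intro exI[of _ m']) auto
  qed
  then show ?thesis using ngen_state[of m] assms(3) by (simp add: gen_index_def)
qed

lemma gen_index_less: "a \<in> QL \<gamma> \<Longrightarrow> b \<in> QL \<gamma> \<Longrightarrow> fst a < fst b \<Longrightarrow> gen_index \<gamma> a < gen_index \<gamma> b"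
  unfolding gen_index_def using finite_QL by (intro psubset_card_mono) auto

lemma gen_index_inj: "a \<in> QL \<gamma> \<Longrightarrow> b \<in> QL \<gamma> \<Longrightarrow> gen_index \<gamma> a = gen_index \<gamma> b \<Longrightarrow> a = b"
  using gen_index_less[of a b] gen_index_less[of b a] QL_eqI[of a b]
  by (cases "fst a" "fst b" rule: linorder_cases) auto

lemma gen_index_bound: "a \<in> QL \<gamma> \<Longrightarrow> gen_index \<gamma> a < card (QL \<gamma>)"
  unfolding gen_index_def using finite_QL by (intro psubset_card_mono) auto

lemma gen_index_bij: "bij_betw (gen_index \<gamma>) (QL \<gamma>) {..<card (QL \<gamma>)}"
proof -
  have inj: "inj_on (gen_index \<gamma>) (QL \<gamma>)" using gen_index_inj by (auto intro: inj_onI)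
  have "gen_index \<gamma> ` QL \<gamma> = {..<card (QL \<gamma>)}"
    by (intro card_subset_eq) (auto simp: gen_index_bound card_image[OF inj])
  then show ?thesis using inj by (simp add: bij_betw_def)
qed

end

section \<open>The reading of a Morse complex sequence\<close>

context mcs_front
begin

lemma strand_complex_eq: "strand_complex \<gamma> \<mu> C m = cplx m"
  by (simp add: strand_complex_def stranded_def)

lemma supported_dcoef:
  assumes "1 \<le> m" "m \<le> n" shows "supported (N m) (dcoef C m)"
proof -
  have m: "m \<in> {1..n}" using assms by simp
  show ?thesis
    unfolding supported_def
    by (rule mcs[unfolded is_mcs_def, THEN conjunct2, THEN conjunct2, THEN conjunct1, THEN bspec[OF _ m], THEN conjunct2])
qed

lemma chain_complex_line:
  assumes "1 \<le> m" "m \<le> n" shows "chain_complex (cplx m)"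
proof -
  have m: "m \<in> {1..n}" using assms by simp
  show ?thesis
    using mcs[unfolded is_mcs_def, THEN conjunct2, THEN conjunct2, THEN conjunct1, THEN bspec[OF _ m], THEN conjunct1]
    by (simp only: strand_complex_eq)
qed

lemma consecutive_line:
  assumes "1 \<le> m" "m < n"
  shows "consecutive (ev m)
    (cplx m) (cplx (Suc m))"
proof -
  have m: "m \<in> {1..<n}" using assms by simp
  show ?thesis
    using mcs[unfolded is_mcs_def, THEN conjunct2, THEN conjunct2, THEN conjunct2, THEN conjunct2, THEN conjunct2, THEN conjunct2, THEN conjunct2, THEN bspec[OF _ m]]
    by (simp only: strand_complex_eq)
qed

lemma dcoef_event:
  assumes "1 \<le> m"
  shows "m < n \<Longrightarrow> ev m = LeftCusp k \<Longrightarrow> dcoef C (Suc m) k (Suc k) = 1"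
    and "m \<le> n \<Longrightarrow> ev m = RightCusp k \<Longrightarrow> dcoef C m k (Suc k) = 1"
    and "m < n \<Longrightarrow> ev m = Crossing k \<Longrightarrow> dcoef C m k (Suc k) = 0"
  using assms
    mcs[unfolded is_mcs_def, THEN conjunct2, THEN conjunct2, THEN conjunct2, THEN conjunct1, THEN bspec, of m]
    mcs[unfolded is_mcs_def, THEN conjunct2, THEN conjunct2, THEN conjunct2, THEN conjunct2, THEN conjunct1, THEN bspec, of m]
    mcs[unfolded is_mcs_def, THEN conjunct2, THEN conjunct2, THEN conjunct2, THEN conjunct2, THEN conjunct2, THEN conjunct1, THEN bspec, of m]
  by simp_all

lemma slide_event: "m \<le> n \<Longrightarrow> ev m = Slide k l \<Longrightarrow> 1 \<le> k \<and> k < l"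
proof -
  assume m: "m \<le> n" and e: "ev m = Slide k l"
  obtain x where "(x, Slide k l) \<in> events \<gamma> C" using strip_eventE[OF m] e by metis
  then have "(x, k, l) \<in> slides C" by (rule event_elims)
  then have "handleslide_mark \<gamma> \<mu> (x, k, l)"
    using mcs[unfolded is_mcs_def, THEN conjunct1] by (rule bspec[rotated])
  then show ?thesis by (simp add: handleslide_mark_def)
qed

definition dmat :: "nat \<Rightarrow> bmat" where
  "dmat m = Bmat (dcoef C m)"

lemma entry_dmat:
  assumes "1 \<le> m" "m \<le> n" shows "entry (dmat m) = dcoef C m"
  unfolding dmat_def
proof (rule entry_Bmat)
  fix j
  have "{i. dcoef C m i j \<noteq> 0} \<subseteq> {..N m}"
    using supported_dcoef[OF assms] unfolding supported_def by fastforce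
  then show "finite {i. dcoef C m i j \<noteq> 0}" by (rule finite_subset) simp
qed

lemma strict_upper_dmat: "1 \<le> m \<Longrightarrow> m \<le> n \<Longrightarrow> strict_upper (dmat m)"
  unfolding strict_upper_def using supported_dcoef by (simp add: entry_dmat supported_def)

lemma dmat_square:
  assumes "1 \<le> m" "m \<le> n" shows "dmat m * dmat m = 0"
proof (rule bmat_eqI)
  fix i j
  have "entry (dmat m * dmat m) i j = (\<Sum>l\<in>{1..N m}. entry (dmat m) i l * entry (dmat m) l j)"
  proof (rule entry_times)
    fix l assume "entry (dmat m) l j \<noteq> 0"
    then show "l \<in> {1..N m}"
      using supportedD[OF supported_dcoef[OF assms], of l j] by (simp add: entry_dmat[OF assms])
  qed simp
  then show "entry (dmat m * dmat m) i j = entry 0 i j"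
    using chain_complex_stranded(2)[OF chain_complex_line[OF assms] supported_dcoef[OF assms]]
    by (simp add: entry_dmat[OF assms])
qed

text \<open>There are only two strands on the first line, so the coefficient required to be 1 there is
  the only one.\<close>

lemma first_left_cusp_rel: "left_cusp_rel 1 (implicit 0) 0 (dmat 1)"
proof -
  have m: "(1::nat) \<le> 1" "1 \<le> n" using n_pos by auto
  have d12: "dcoef C 1 1 2 = 1" by (rule mcs[unfolded is_mcs_def, THEN conjunct2, THEN conjunct2, THEN conjunct2, THEN conjunct2, THEN conjunct2, THEN conjunct2, THEN conjunct1])
  have d: "dcoef C 1 i j = (if i = 1 \<and> j = 2 then 1 else 0)" for i j
  proof (cases "i = 1 \<and> j = 2")
    case False
    then have "\<not> (1 \<le> i \<and> i < j \<and> j \<le> N 1)" using N_1 by auto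
    then show ?thesis using False supported_zero[OF supported_dcoef[OF m]] by auto
  qed (use d12 in simp)
  have "reduce 1 (dmat 1) = 0"
    by (rule bmat_eqI) (simp only: entry_reduce entry_dmat[OF m] d skip_cusp_neq simp_thms if_False
      mult_zero_left mult_zero_right add_0 entry_zero; auto simp: skip_cusp_def)
  moreover have "entry (dmat 1) 1 (Suc 1) = 1"
    unfolding entry_dmat[OF m] using d12 by (simp add: numeral_2_eq_2)
  moreover have "implicit_at (entry (dmat 1)) 1 = implicit 0"
    unfolding entry_dmat[OF m] implicit_marks_def first_event by simp
  ultimately show ?thesis
    unfolding left_cusp_rel_def using strict_upper_dmat[OF m] dmat_square[OF m] by blast
qed

lemma left_cusp_rel_line:
  assumes m: "1 \<le> m" "m < n" and e: "ev m = LeftCusp k"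
  shows "left_cusp_rel k (implicit m) (dmat m) (dmat (Suc m))"
proof -
  have m1: "m \<le> n" and m2: "1 \<le> Suc m" "Suc m \<le> n" using m by auto
  note one = dcoef_event(1)[OF m e]
  have "quotient_iso (cplx m) (cplx (Suc m))
      (gen_bd_span (cplx (Suc m)) k)
      (index_map (cplx m) (skip_cusp k))"
    using consecutive_line[OF m] e by simp
  note q = cusp_quotient_iso(3)[OF this supported_dcoef[OF m(1) m1] supported_dcoef[OF m2] one]
  have "reduce k (dmat (Suc m)) = dmat m"
    by (rule bmat_eqI) (simp add: entry_dmat[OF m(1) m1] entry_dmat[OF m2] q)
  then show ?thesis
    unfolding left_cusp_rel_def
    by (simp add: strict_upper_dmat[OF m2] dmat_square[OF m2] entry_dmat[OF m2] one implicit_marks_def e)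
qed

lemma admissible_event:
  assumes m: "m \<le> n" and diff: "1 \<le> m \<Longrightarrow> diff (state m) = dmat m"
  shows "admissible (ev m, implicit m) (state m)"
proof (cases "ev m")
  case (Slide k l)
  then show ?thesis using slide_event[OF m] by simp
next
  case (RightCusp k)
  then obtain a where "a \<in> right_cusps \<gamma>" "position \<gamma> a = k" using strip_QL(2)[OF m] by blast
  then have "odd k" using plat_order(4)[of a] by simp
  then show ?thesis using RightCusp by simp
next
  case (Crossing k)
  have "m \<noteq> 0" using Crossing first_event by (metis event.distinct(3))
  moreover have "m \<noteq> n" using Crossing last_event by (metis event.distinct(7,11))
  ultimately have m': "1 \<le> m" "m < n" using m by auto
  have "\<not> late (state m)"
  proof
    assume "late (state m)"
    then obtain m' l where "m' < m" "ev m' = RightCusp l" using late_state[of m] m by auto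
    then show False using event_order(3)[OF m _ Crossing, of m' l] m by simp
  qed
  then show ?thesis
    using Crossing diff m' dcoef_event(3)[OF m' Crossing] by (simp add: entry_dmat)
next
  case (LeftCusp k)
  have "m \<noteq> n" using LeftCusp last_event by (metis event.distinct(1,5))
  then have mn: "m < n" using m by simp
  have no: "ev m' \<noteq> RightCusp l \<and> ev m' \<noteq> Crossing l" if "m' < m" for m' l
    using event_order(1,2)[OF m _ LeftCusp, of m' l] that m by auto
  have "\<not> late (state m)" using late_state[of m] m no by auto
  moreover have "{c \<in> QL \<gamma>. \<exists>m'<m. fst c \<in> strip C m'} = {}"
  proof (rule equals0I)
    fix c assume "c \<in> {c \<in> QL \<gamma>. \<exists>m'<m. fst c \<in> strip C m'}"
    then have c: "c \<in> QL \<gamma>" "\<exists>m'<m. fst c \<in> strip C m'" by auto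
    from c(2) obtain m' where m': "m' < m" "fst c \<in> strip C m'" by (elim exE conjE)
    obtain m'' where m'': "m'' \<le> n" "fst c \<in> strip C m''"
      "c \<in> crossings \<gamma> \<and> ev m'' = Crossing (position \<gamma> c) \<or>
       c \<in> right_cusps \<gamma> \<and> ev m'' = RightCusp (position \<gamma> c)"
      using QL_strip[OF c(1)] by metis
    have "m'' = m'" using strip_unique[OF m''(1) _ m''(2) m'(2)] m' m by simp
    then show False using no[OF m'(1), of "position \<gamma> c"] m''(3) by auto
  qed
  then have "ngen (state m) = 0" using ngen_state[of m] m by simp
  moreover have "\<exists>D'. left_cusp_rel k (implicit m) (diff (state m)) D'"
  proof (cases "m = 0")
    case True
    then show ?thesis using first_left_cusp_rel first_event LeftCusp by (auto simp: state_0 start_def)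
  next
    case False
    then show ?thesis using left_cusp_rel_line[OF _ mn LeftCusp] diff by auto
  qed
  ultimately show ?thesis by (simp add: LeftCusp)
qed

lemma diff_advance:
  assumes m: "1 \<le> m" "m < n" and diff: "diff (state m) = dmat m"
  shows "diff (advance (ev m, implicit m) (state m)) = dmat (Suc m)"
proof -
  have m1: "m \<le> n" and m2: "1 \<le> Suc m" "Suc m \<le> n" using m by auto
  note sup = supported_dcoef[OF m(1) m1] supported_dcoef[OF m2]
  note ent = entry_dmat[OF m(1) m1] entry_dmat[OF m2]
  show ?thesis
  proof (cases "ev m")
    case (Slide k l)
    have kl: "1 \<le> k" "k < l" using slide_event[OF m1 Slide] by auto
    have "complex_iso (cplx m) (cplx (Suc m))
        (handleslide_map (cplx m) k l)"
      using consecutive_line[OF m] Slide by simp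
    note iso = handleslide_iso(4)[OF this sup kl]
    show ?thesis
      by (rule bmat_eqI) (simp add: Slide diff entry_slide[OF strict_upper_dmat[OF m(1) m1] kl(2)] ent iso)
  next
    case (Crossing k)
    have "complex_iso (cplx m) (cplx (Suc m))
        (index_map (cplx m) (swap k))"
      using consecutive_line[OF m] Crossing by simp
    note iso = crossing_iso(3)[OF this sup]
    show ?thesis
    proof (rule bmat_eqI)
      fix i j
      show "entry (diff (advance (ev m, implicit m) (state m))) i j = entry (dmat (Suc m)) i j"
        using iso[of "swap k i" "swap k j"]
        by (simp add: Crossing diff entry_conj_perm ent)
    qed
  next
    case (LeftCusp k)
    then show ?thesis using the_left_cusp_rel[OF left_cusp_rel_line[OF m LeftCusp]] by (simp add: diff)
  next
    case (RightCusp k)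
    have "quotient_iso (cplx (Suc m)) (cplx m)
        (gen_bd_span (cplx m) k)
        (index_map (cplx (Suc m)) (skip_cusp k))"
      using consecutive_line[OF m] RightCusp by simp
    note q = cusp_quotient_iso(3)[OF this sup(2,1) dcoef_event(2)[OF m(1) m1 RightCusp]]
    show ?thesis by (rule bmat_eqI) (simp add: RightCusp diff ent q)
  qed
qed

text \<open>So the complexes of an MCS are determined by its marked front alone.\<close>

lemma diff_state: "1 \<le> m \<Longrightarrow> m \<le> n \<Longrightarrow> diff (state m) = dmat m"
proof (induction m)
  case (Suc m)
  show ?case
  proof (cases "m = 0")
    case True
    then show ?thesis
      using the_left_cusp_rel[OF first_left_cusp_rel] first_event by (simp add: state_Suc state_0 start_def)
  next
    case False
    then show ?thesis using Suc diff_advance[of m] by (simp add: state_Suc)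
  qed
qed simp

lemma admissible_state: "m \<le> n \<Longrightarrow> admissible (ev m, implicit m) (state m)"
  using admissible_event diff_state by blast

lemma good_take: "m \<le> Suc n \<Longrightarrow> good (take m (marked_front \<gamma> C)) start"
proof (induction m)
  case (Suc m)
  then show ?case
    using admissible_state[of m] by (simp add: take_Suc_front good_append state_def)
qed simp

lemma good_marked_front: "good (marked_front \<gamma> C) start"
  using good_take[of "Suc n"] by (simp add: length_marked_front)

lemma reading_state: "m \<le> Suc n \<Longrightarrow> reading (state m)"
  unfolding state_def by (intro reading_run reading_start good_take)

lemma state_final: "state (Suc n) = run (marked_front \<gamma> C) start"
  by (simp add: state_def length_marked_front)

section \<open>Counting chord paths\<close>

text \<open>The end condition of chord paths to \<open>b\<close>, for the last chord.\<close>

definition terminal :: "real \<times> real \<Rightarrow> chord \<Rightarrow> bool" where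
  "terminal b = (\<lambda>(m, i, j). \<exists>p\<le>n. fst b \<in> strip C p \<and> m = Suc p \<and>
     (j = position \<gamma> b \<and> dcoef C p i j = 1 \<or> i = Suc (position \<gamma> b) \<and> dcoef C p i j = 1))"

definition paths_from :: "real \<times> real \<Rightarrow> chord \<Rightarrow> chord list set" where
  "paths_from b c = {\<Lambda>. \<Lambda> \<noteq> [] \<and> hd \<Lambda> = c \<and> set \<Lambda> \<subseteq> mcs_chords \<gamma> C \<and> terminal b (last \<Lambda>) \<and>
     (\<forall>r. Suc r < length \<Lambda> \<longrightarrow> chord_step \<gamma> C (\<Lambda> ! r) (\<Lambda> ! Suc r))}"

lemma chord_paths_eq:
  assumes "l \<le> n" "fst a \<in> strip C l"
  shows "chord_paths \<gamma> C a b = paths_from b (l, position \<gamma> a, Suc (position \<gamma> a))"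
proof -
  have start: "(\<exists>l'\<le>n. fst a \<in> strip C l' \<and> hd \<Lambda> = (l', position \<gamma> a, Suc (position \<gamma> a))) \<longleftrightarrow>
      hd \<Lambda> = (l, position \<gamma> a, Suc (position \<gamma> a))" for \<Lambda> :: "chord list"
    using assms strip_unique[OF _ assms(1) _ assms(2)] by blast
  have "(\<exists>p\<le>n. fst b \<in> strip C p \<and> (let k = position \<gamma> b in
          (\<exists>i. c = (Suc p, i, k) \<and> dcoef C p i k = 1) \<or>
          (\<exists>j. c = (Suc p, Suc k, j) \<and> dcoef C p (Suc k) j = 1))) \<longleftrightarrow> terminal b c" for c
    by (cases c) (auto simp: terminal_def Let_def)
  then show ?thesis unfolding chord_paths_def paths_from_def start by auto
qed

lemma paths_from_unfold:
  "paths_from b c = (if c \<in> mcs_chords \<gamma> C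
     then (if terminal b c then {[c]} else {}) \<union> (\<Union>c'\<in>{c'. chord_step \<gamma> C c c'}. (#) c ` paths_from b c')
     else {})" (is "_ = ?R")
proof (intro equalityI subsetI)
  fix \<Lambda> assume L: "\<Lambda> \<in> paths_from b c"
  then obtain \<Lambda>' where e: "\<Lambda> = c # \<Lambda>'" unfolding paths_from_def by (cases \<Lambda>) auto
  show "\<Lambda> \<in> ?R"
  proof (cases \<Lambda>')
    case Nil
    then show ?thesis using L e by (simp add: paths_from_def)
  next
    case (Cons c' \<Lambda>'')
    have steps: "chord_step \<gamma> C (\<Lambda> ! r) (\<Lambda> ! Suc r)" if "Suc r < length \<Lambda>" for r
      using L that by (simp add: paths_from_def)
    have "chord_step \<gamma> C (\<Lambda>' ! r) (\<Lambda>' ! Suc r)" if "Suc r < length \<Lambda>'" for r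
      using steps[of "Suc r"] that e by simp
    then have "\<Lambda>' \<in> paths_from b c'" using L e Cons by (auto simp: paths_from_def)
    moreover have "chord_step \<gamma> C c c'" using steps[of 0] e Cons by simp
    ultimately have "\<Lambda> \<in> (\<Union>c'\<in>{c'. chord_step \<gamma> C c c'}. (#) c ` paths_from b c')" using e by blast
    moreover have "c \<in> mcs_chords \<gamma> C" using L e by (simp add: paths_from_def)
    ultimately show ?thesis by simp
  qed
next
  fix \<Lambda> assume R: "\<Lambda> \<in> ?R"
  then have c: "c \<in> mcs_chords \<gamma> C" by (auto split: if_splits)
  consider "terminal b c" "\<Lambda> = [c]" | c' \<Lambda>' where "chord_step \<gamma> C c c'" "\<Lambda>' \<in> paths_from b c'" "\<Lambda> = c # \<Lambda>'"
    using R c by (cases "terminal b c") auto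
  then show "\<Lambda> \<in> paths_from b c"
  proof cases
    case 1
    then show ?thesis using c by (simp add: paths_from_def)
  next
    case 2
    then show ?thesis using c
      by (cases \<Lambda>') (auto simp: paths_from_def nth_Cons split: nat.split)
  qed
qed

lemma card_paths_from:
  assumes "c \<in> mcs_chords \<gamma> C" "finite S" "\<And>c'. chord_step \<gamma> C c c' \<longleftrightarrow> c' \<in> S"
    "\<And>c'. c' \<in> S \<Longrightarrow> finite (paths_from b c')"
  shows "finite (paths_from b c)"
    and "of_nat (card (paths_from b c)) =
      (if terminal b c then 1 else 0) + (\<Sum>c'\<in>S. of_nat (card (paths_from b c')) :: bit)"
proof -
  let ?T = "if terminal b c then {[c]} else {}"
  have eq: "paths_from b c = ?T \<union> (\<Union>c'\<in>S. (#) c ` paths_from b c')"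
  proof -
    have "{c'. chord_step \<gamma> C c c'} = S" using assms(3) by blast
    then show ?thesis by (subst paths_from_unfold) (simp only: assms(1) if_True)
  qed
  have hd: "\<Lambda> \<noteq> [] \<and> hd \<Lambda> = c'" if "\<Lambda> \<in> paths_from b c'" for \<Lambda> c' using that by (simp add: paths_from_def)
  have fin: "finite (\<Union>c'\<in>S. (#) c ` paths_from b c')" using assms(2,4) by auto
  then show "finite (paths_from b c)" unfolding eq by simp
  have "card (paths_from b c) = card ?T + card (\<Union>c'\<in>S. (#) c ` paths_from b c')"
    unfolding eq using fin by (intro card_Un_disjoint) (auto dest!: hd)
  also have "card (\<Union>c'\<in>S. (#) c ` paths_from b c') = (\<Sum>c'\<in>S. card ((#) c ` paths_from b c'))"
  proof (intro card_UN_disjoint ballI impI)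
    show "finite S" by (rule assms(2))
    show "finite ((#) c ` paths_from b c')" if "c' \<in> S" for c'
      using assms(4)[OF that] by (rule finite_imageI)
    show "(#) c ` paths_from b c1 \<inter> (#) c ` paths_from b c2 = {}" if "c1 \<noteq> c2" for c1 c2
    proof (rule equals0I)
      fix \<Lambda> assume "\<Lambda> \<in> (#) c ` paths_from b c1 \<inter> (#) c ` paths_from b c2"
      then obtain A where "A \<in> paths_from b c1" "A \<in> paths_from b c2" by auto
      then show False using hd that by blast
    qed
  qed
  also have "\<dots> = (\<Sum>c'\<in>S. card (paths_from b c'))"
    by (intro sum.cong refl card_image) auto
  finally show "of_nat (card (paths_from b c)) =
      (if terminal b c then 1 else 0) + (\<Sum>c'\<in>S. of_nat (card (paths_from b c')) :: bit)"
    by simp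
qed

lemma chord_iff: "(m, i, j) \<in> mcs_chords \<gamma> C \<longleftrightarrow> 1 \<le> m \<and> m \<le> n \<and> 1 \<le> i \<and> i < j \<and> j \<le> N m"
  by (simp add: mcs_chords_def)

lemma chord_stepE:
  assumes "chord_step \<gamma> C (Suc m, i, j) c'"
  obtains i' j' where "c' = (m, i', j')" "continues (ev m) (i, j) (i', j')"
  using assms by (cases c') (auto simp: chord_step_def)

lemma paths_from_left_empty:
  assumes "fst b \<in> strip C p" "p \<le> n" "m \<le> p"
  shows "paths_from b (m, i, j) = {}"
  using assms(3)
proof (induction m arbitrary: i j)
  case 0
  show ?case by (subst paths_from_unfold) (simp add: chord_iff)
next
  case (Suc m)
  have "\<not> terminal b (Suc m, i, j)"
  proof
    assume "terminal b (Suc m, i, j)"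
    then have "m \<le> n" "fst b \<in> strip C m" by (auto simp: terminal_def)
    then show False using strip_unique[of m p "fst b"] assms Suc.prems by simp
  qed
  moreover have "paths_from b c' = {}" if "chord_step \<gamma> C (Suc m, i, j) c'" for c'
    using that Suc by (elim chord_stepE) simp
  ultimately show ?case by (subst paths_from_unfold) simp
qed

lemma terminal_iff:
  assumes "fst b \<in> strip C p" "p \<le> n"
  shows "terminal b (Suc m, i, j) \<longleftrightarrow> m = p \<and>
     (j = position \<gamma> b \<or> i = Suc (position \<gamma> b)) \<and> dcoef C p i j = 1"
proof -
  have "terminal b (Suc m, i, j) \<longleftrightarrow> (m \<le> n \<and> fst b \<in> strip C m) \<and>
      (j = position \<gamma> b \<or> i = Suc (position \<gamma> b)) \<and> dcoef C m i j = 1"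
    by (auto simp: terminal_def)
  moreover have "m \<le> n \<and> fst b \<in> strip C m \<longleftrightarrow> m = p"
    using assms strip_unique[of m p "fst b"] by blast
  ultimately show ?thesis by (cases "m = p") simp_all
qed

lemma crossing_at_line:
  assumes "a \<in> crossings \<gamma>" "fst a \<in> strip C l" "1 \<le> l" "l \<le> n"
  shows "Q_degree \<gamma> \<mu> a = pot l (position \<gamma> a) - pot l (Suc (position \<gamma> a))"
    and "Suc (position \<gamma> a) \<le> N l"
proof -
  have less: "line C l < fst a" using strip_lower assms by simp
  have no: "fst c \<notin> {line C l..<fst a}" if sing: "c \<in> left_cusps \<gamma> \<union> crossings \<gamma> \<union> right_cusps \<gamma>" for c
  proof
    assume c: "fst c \<in> {line C l..<fst a}"
    obtain e where e: "(fst c, e) \<in> events \<gamma> C" using sing event_intros[of c] by blast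
    have "line C l \<notin> fst ` events \<gamma> C" using lines assms(3,4) by (simp add: mcs_lines_def)
    then have "line C l \<noteq> fst c" using e by force
    then have "fst c \<in> strip C l" using c assms(2,3) by (auto simp: strip_def split: if_splits)
    then show False
      using same_strip_event[OF e event_intros(3)[OF assms(1)] _ assms(2,4)] c by auto
  qed
  show "Q_degree \<gamma> \<mu> a = pot l (position \<gamma> a) - pot l (Suc (position \<gamma> a))"
    and "Suc (position \<gamma> a) \<le> N l"
    using crossing_degree[OF knot plat maslov assms(1) less no] by auto
qed

lemma crossing_line:
  assumes m: "1 \<le> m" "m < n" and e: "ev m = Crossing k"
  defines "\<sigma> \<equiv> swap k"
  shows "\<sigma> i \<in> {1..N m} \<longleftrightarrow> i \<in> {1..N (Suc m)}"
    and "i \<in> {1..N (Suc m)} \<Longrightarrow> pot m (\<sigma> i) = pot (Suc m) i"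
proof -
  have m1: "m \<le> n" and m2: "1 \<le> Suc m" "Suc m \<le> n" using m by auto
  have iso: "complex_iso (cplx m) (cplx (Suc m))
      (index_map (cplx m) (swap k))"
    using consecutive_line[OF m] e by simp
  note iso' = crossing_iso[OF iso supported_dcoef[OF m(1) m1] supported_dcoef[OF m2]]
  show mem: "\<sigma> i \<in> {1..N m} \<longleftrightarrow> i \<in> {1..N (Suc m)}" for i
    using iso'(1)[of "\<sigma> i"] by (simp add: \<sigma>_def)
  show "i \<in> {1..N (Suc m)} \<Longrightarrow> pot m (\<sigma> i) = pot (Suc m) i"
    using iso'(2)[of "\<sigma> i"] mem[of i] by (simp add: \<sigma>_def)
qed

lemma slide_line:
  assumes m: "1 \<le> m" "m < n" and e: "ev m = Slide k l"
  shows "N (Suc m) = N m" and "i \<in> {1..N m} \<Longrightarrow> pot (Suc m) i = pot m i"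
    and "k \<in> {1..N m} \<Longrightarrow> l \<in> {1..N m} \<and> pot m l = pot m k"
proof -
  have m1: "m \<le> n" and m2: "1 \<le> Suc m" "Suc m \<le> n" using m by auto
  have kl: "1 \<le> k" "k < l" using slide_event[OF m1 e] by auto
  have iso: "complex_iso (cplx m) (cplx (Suc m))
      (handleslide_map (cplx m) k l)"
    using consecutive_line[OF m] e by simp
  note iso' = handleslide_iso[OF iso supported_dcoef[OF m(1) m1] supported_dcoef[OF m2] kl]
  show "N (Suc m) = N m" and "i \<in> {1..N m} \<Longrightarrow> pot (Suc m) i = pot m i"
    and "k \<in> {1..N m} \<Longrightarrow> l \<in> {1..N m} \<and> pot m l = pot m k"
    using iso' by blast+
qed

lemma right_cusp_line:
  assumes m: "1 \<le> m" "m < n" and e: "ev m = RightCusp k"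
  shows "i \<in> {1..N (Suc m)} \<Longrightarrow> skip_cusp k i \<in> {1..N m} \<and> pot m (skip_cusp k i) = pot (Suc m) i"
proof -
  have m1: "m \<le> n" and m2: "1 \<le> Suc m" "Suc m \<le> n" using m by auto
  have iso: "quotient_iso (cplx (Suc m)) (cplx m)
        (gen_bd_span (cplx m) k)
        (index_map (cplx (Suc m)) (skip_cusp k))"
    using consecutive_line[OF m] e by simp
  note iso' = cusp_quotient_iso[OF iso supported_dcoef[OF m2] supported_dcoef[OF m(1) m1]
      dcoef_event(2)[OF m(1) m1 e]]
  show "i \<in> {1..N (Suc m)} \<Longrightarrow> skip_cusp k i \<in> {1..N m} \<and> pot m (skip_cusp k i) = pot (Suc m) i"
    using iso'(1,2) by blast
qed

text \<open>Next to the count this carries the degree: the difference of the potentials at the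
  ends of a chord is preserved along chord paths, and exceeds the degree of \<open>b\<close> by 1 for the chords
  at which a path to \<open>b\<close> may end, because the differentials have degree \<open>- 1\<close>.\<close>

definition counted :: "real \<times> real \<Rightarrow> nat \<Rightarrow> nat \<Rightarrow> nat \<Rightarrow> bool" where
  "counted b m i j \<longleftrightarrow> finite (paths_from b (m, i, j)) \<and>
     of_nat (card (paths_from b (m, i, j))) = entry (paths (state m) (gen_index \<gamma> b)) i j \<and>
     (paths_from b (m, i, j) \<noteq> {} \<longrightarrow> pot m i - pot m j = Q_degree \<gamma> \<mu> b + 1)"

lemma counted_step:
  assumes c: "(Suc m, i, j) \<in> mcs_chords \<gamma> C" and t: "\<not> terminal b (Suc m, i, j)"
    and S: "finite S" "\<And>i' j'. continues (ev m) (i, j) (i', j') \<longleftrightarrow> (i', j') \<in> S"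
    and IH: "\<And>i' j'. (i', j') \<in> S \<Longrightarrow> counted b m i' j'"
    and deg: "\<And>i' j'. (i', j') \<in> S \<Longrightarrow> pot m i' - pot m j' = pot (Suc m) i - pot (Suc m) j"
    and entry: "entry (paths (state (Suc m)) (gen_index \<gamma> b)) i j =
      (\<Sum>(i', j')\<in>S. entry (paths (state m) (gen_index \<gamma> b)) i' j')"
  shows "counted b (Suc m) i j"
proof -
  let ?S = "(\<lambda>(i', j'). (m, i', j')) ` S"
  have inj: "inj_on (\<lambda>(i', j'). (m, i', j')) S" by (auto simp: inj_on_def)
  have step: "chord_step \<gamma> C (Suc m, i, j) c' \<longleftrightarrow> c' \<in> ?S" for c'
    by (cases c') (auto simp: chord_step_def S(2) image_iff)
  have fin: "finite (paths_from b c')" if "c' \<in> ?S" for c'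
    using that IH by (auto simp: counted_def)
  note card = card_paths_from[OF c finite_imageI[OF S(1)] step fin]
  have "of_nat (card (paths_from b (Suc m, i, j))) = (\<Sum>c'\<in>?S. of_nat (card (paths_from b c')) :: bit)"
    using card(2) t by simp
  also have "\<dots> = (\<Sum>(i', j')\<in>S. of_nat (card (paths_from b (m, i', j'))))"
    unfolding sum.reindex[OF inj] by (intro sum.cong) auto
  also have "\<dots> = (\<Sum>(i', j')\<in>S. entry (paths (state m) (gen_index \<gamma> b)) i' j')"
    using IH by (intro sum.cong) (auto simp: counted_def)
  finally have cnt: "of_nat (card (paths_from b (Suc m, i, j))) = entry (paths (state (Suc m)) (gen_index \<gamma> b)) i j"
    using entry by simp
  have "pot (Suc m) i - pot (Suc m) j = Q_degree \<gamma> \<mu> b + 1" if ne: "paths_from b (Suc m, i, j) \<noteq> {}"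
  proof -
    have "\<exists>c'\<in>?S. paths_from b c' \<noteq> {}"
      using ne step t by (subst (asm) paths_from_unfold) (auto split: if_splits)
    then obtain i' j' where s: "(i', j') \<in> S" "paths_from b (m, i', j') \<noteq> {}" by auto
    then show ?thesis using IH[OF s(1)] deg[OF s(1)] by (simp add: counted_def)
  qed
  then show ?thesis using card(1) cnt by (simp add: counted_def)
qed

lemma counted_at_crossing:
  assumes b: "b \<in> crossings \<gamma>" "fst b \<in> strip C p" "1 \<le> p" "p < n"
    and e: "ev p = Crossing (position \<gamma> b)"
    and c: "(Suc p, i, j) \<in> mcs_chords \<gamma> C"
  shows "counted b (Suc p) i j"
proof -
  define k where "k = position \<gamma> b"
  have pn: "p \<le> n" using b by simp
  let ?\<sigma> = "swap k"
  have ij: "1 \<le> i" "i < j" "j \<le> N (Suc p)" using c by (auto simp: chord_iff)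
  define S where "S = (if (i, j) = (k, Suc k) then {} else {(p, ?\<sigma> i, ?\<sigma> j)})"
  have step: "chord_step \<gamma> C (Suc p, i, j) c' \<longleftrightarrow> c' \<in> S" for c'
    by (cases c') (auto simp: chord_step_def S_def e k_def[symmetric])
  have empty: "paths_from b c' = {}" if "c' \<in> S" for c'
    using that paths_from_left_empty[OF b(2) pn le_refl] by (auto simp: S_def split: if_splits)
  have fin: "finite S" by (simp add: S_def)
  have card: "finite (paths_from b (Suc p, i, j))"
    "of_nat (card (paths_from b (Suc p, i, j))) = (if terminal b (Suc p, i, j) then 1 else (0 :: bit))"
    using card_paths_from[OF c fin step] empty by auto
  have trm: "terminal b (Suc p, i, j) \<longleftrightarrow> (j = k \<or> i = Suc k) \<and> dcoef C p i j = 1"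
    using terminal_iff[OF b(2) pn] by (simp add: k_def)
  have "gen_index \<gamma> b = ngen (state p)"
    by (rule gen_index_eq[OF _ b(2) pn]) (simp add: QL_def b(1))
  then have M: "paths (state (Suc p)) (gen_index \<gamma> b) = comm (conj_perm k (dmat p)) (unit (Suc k) k)"
    using diff_state[OF b(3) pn] pn by (simp add: state_Suc e k_def)
  have "entry (comm (conj_perm k (dmat p)) (unit (Suc k) k)) i j =
      (if j = k then dcoef C p (?\<sigma> i) k else 0) + (if i = Suc k then dcoef C p (Suc k) (?\<sigma> j) else 0)"
    by (simp add: comm_def entry_conj_perm entry_dmat[OF b(3) pn])
  also have "\<dots> = (if terminal b (Suc p, i, j) then 1 else 0)"
    using ij unfolding trm by (cases "dcoef C p i j") (auto simp: Transposition.transpose_def)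
  finally have cnt: "of_nat (card (paths_from b (Suc p, i, j))) = entry (paths (state (Suc p)) (gen_index \<gamma> b)) i j"
    using card(2) M by simp
  have "pot (Suc p) i - pot (Suc p) j = Q_degree \<gamma> \<mu> b + 1" if ne: "paths_from b (Suc p, i, j) \<noteq> {}"
  proof -
    have t: "terminal b (Suc p, i, j)"
      using ne step empty by (subst (asm) paths_from_unfold) (auto split: if_splits)
    have ki: "k \<in> {1..N p}" "Suc k \<in> {1..N p}"
      using crossing_at_line(2)[OF b(1-3) pn] by (auto simp: k_def position_def)
    note Q = crossing_at_line(1)[OF b(1-3) pn, folded k_def]
    have pots: "pot (Suc p) i = pot p (?\<sigma> i)" "pot (Suc p) j = pot p (?\<sigma> j)"
      using crossing_line(2)[OF b(3,4) e[folded k_def]] ij by auto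
    have d: "pot p j = pot p i - 1"
      using chain_complex_stranded(1)[OF chain_complex_line[OF b(3) pn] supported_dcoef[OF b(3) pn]] t trm by simp
    show ?thesis using t ij Q d unfolding trm pots by (auto simp: Transposition.transpose_def)
  qed
  then show ?thesis using card(1) cnt by (simp add: counted_def)
qed

lemma crossing_strip:
  assumes "b \<in> crossings \<gamma>"
  obtains p where "1 \<le> p" "p < n" "fst b \<in> strip C p" "ev p = Crossing (position \<gamma> b)"
proof -
  obtain p where p: "p \<le> n" "fst b \<in> strip C p" "ev p = Crossing (position \<gamma> b)"
    using event_strip[OF event_intros(3)[OF assms]] by metis
  have "p \<noteq> 0"
  proof
    assume "p = 0"
    then show False using p(3) first_event by simp
  qed
  moreover have "p \<noteq> n"
  proof
    assume "p = n"
    then show False using p(3) last_event by auto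
  qed
  ultimately show ?thesis using that[of p] p by simp
qed

lemma counted_chord:
  assumes b: "b \<in> crossings \<gamma>"
  shows "(m, i, j) \<in> mcs_chords \<gamma> C \<Longrightarrow> counted b m i j"
proof (induction m arbitrary: i j)
  case 0
  then show ?case by (simp add: chord_iff)
next
  case (Suc m)
  obtain p where p: "1 \<le> p" "p < n" "fst b \<in> strip C p" "ev p = Crossing (position \<gamma> b)"
    using crossing_strip[OF b] by blast
  have pn: "p \<le> n" using p by simp
  let ?r = "gen_index \<gamma> b"
  have ij: "1 \<le> i" "i < j" "j \<le> N (Suc m)" and mn: "m < n" "m \<le> n" using Suc.prems by (auto simp: chord_iff)
  show ?case
  proof (cases "m = 0")
    case True
    have "paths_from b (Suc m, i, j) = {}"
      by (rule paths_from_left_empty[OF p(3) pn]) (use True p(1) in simp)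
    moreover have "paths (state (Suc m)) ?r = 0"
      using True first_event by (simp add: state_Suc)
    ultimately show ?thesis by (simp add: counted_def)
  next
    case False
    then have m: "1 \<le> m" "m < n" using mn by auto
    note SU = readingD(1)[OF reading_state, of m ?r]
    show ?thesis
    proof (cases "m = p")
      case True
      show ?thesis using counted_at_crossing[OF b p(3,1,2,4)] Suc.prems True by simp
    next
      case mp: False
      have nt: "\<not> terminal b (Suc m, i, j)" using mp terminal_iff[OF p(3) pn] by simp
      show ?thesis
      proof (cases "ev m")
        case (LeftCusp k)
        show ?thesis
          by (rule counted_step[OF Suc.prems nt, of "{}"]) (use mn in \<open>auto simp: LeftCusp state_Suc\<close>)
      next
        case (RightCusp k)
        note rc = right_cusp_line[OF m RightCusp]
        have mem: "skip_cusp k i \<in> {1..N m}" "skip_cusp k j \<in> {1..N m}" using rc ij by auto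
        show ?thesis
        proof (rule counted_step[OF Suc.prems nt, of "{(skip_cusp k i, skip_cusp k j)}"])
          show "counted b m i' j'" if "(i', j') \<in> {(skip_cusp k i, skip_cusp k j)}" for i' j'
            using that mem ij m by (intro Suc.IH) (auto simp: chord_iff)
          show "pot m i' - pot m j' = pot (Suc m) i - pot (Suc m) j"
            if "(i', j') \<in> {(skip_cusp k i, skip_cusp k j)}" for i' j'
            using that rc[of i] rc[of j] ij by auto
        qed (use mn in \<open>auto simp: RightCusp state_Suc\<close>)
      next
        case (Crossing k)
        let ?\<sigma> = "swap k"
        note cl = crossing_line[OF m Crossing]
        have mem: "?\<sigma> i \<in> {1..N m}" "?\<sigma> j \<in> {1..N m}" using cl(1) ij by auto
        define S where "S = (if (i, j) = (k, Suc k) then {} else {(?\<sigma> i, ?\<sigma> j)})"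
        obtain a where a: "a \<in> crossings \<gamma>" "fst a \<in> strip C m" using strip_QL(1)[OF mn(2) Crossing] by blast
        have "ngen (state m) = gen_index \<gamma> a"
          using gen_index_eq[OF _ a(2) mn(2)] a(1) by (simp add: QL_def)
        moreover have "gen_index \<gamma> a \<noteq> ?r"
        proof
          assume "gen_index \<gamma> a = ?r"
          then have "a = b" using gen_index_inj a(1) b by (simp add: QL_def)
          then show False using strip_unique[OF mn(2) pn a(2)] p(3) mp by simp
        qed
        ultimately have P: "paths (state (Suc m)) ?r = cross k (paths (state m) ?r)"
          using mn by (simp add: state_Suc Crossing)
        show ?thesis
        proof (rule counted_step[OF Suc.prems nt, of S])
          show "counted b m i' j'" if "(i', j') \<in> S" for i' j'
          proof (rule Suc.IH)
            have "?\<sigma> i < ?\<sigma> j" using that ij by (intro transpose_Suc_less) (auto simp: S_def split: if_splits)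
            then show "(m, i', j') \<in> mcs_chords \<gamma> C"
              using that mem m by (auto simp: S_def chord_iff split: if_splits)
          qed
          show "pot m i' - pot m j' = pot (Suc m) i - pot (Suc m) j" if "(i', j') \<in> S" for i' j'
            using that cl(2)[of i] cl(2)[of j] ij by (auto simp: S_def split: if_splits)
          show "entry (paths (state (Suc m)) ?r) i j = (\<Sum>(i', j')\<in>S. entry (paths (state m) ?r) i' j')"
            unfolding P S_def using ij entry_cross[OF SU] mn by auto
        qed (auto simp: Crossing S_def)
      next
        case (Slide k l)
        have kl: "1 \<le> k" "k < l" using slide_event[OF mn(2) Slide] by auto
        note sl = slide_line[OF m Slide]
        have Nm: "j \<le> N m" using ij sl(1) by simp
        define S where "S = {(i, j)} \<union> (if i = k \<and> l < j then {(l, j)} else {}) \<union> (if j = l \<and> i < k then {(i, k)} else {})"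
        have pots: "pot (Suc m) i = pot m i" "pot (Suc m) j = pot m j"
          using sl(2) ij Nm by auto
        show ?thesis
        proof (rule counted_step[OF Suc.prems nt, of S])
          show "counted b m i' j'" if "(i', j') \<in> S" for i' j'
            using that kl ij Nm m by (intro Suc.IH) (auto simp: S_def chord_iff split: if_splits)
          show "pot m i' - pot m j' = pot (Suc m) i - pot (Suc m) j" if "(i', j') \<in> S" for i' j'
            using that kl ij Nm sl(3) unfolding pots by (auto simp: S_def split: if_splits)
          have P: "paths (state (Suc m)) ?r = slide k l (paths (state m) ?r)"
            using mn by (simp add: state_Suc Slide)
          show "entry (paths (state (Suc m)) ?r) i j = (\<Sum>(i', j')\<in>S. entry (paths (state m) ?r) i' j')"
          proof -
            have SU': "strict_upper (paths (state m) ?r)" using SU mn by simp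
            consider "i = k" "l < j" | "j = l" "i < k" | "\<not> (i = k \<and> l < j)" "\<not> (j = l \<and> i < k)" by blast
            then show ?thesis
            proof cases
              case 1
              then have "S = {(i, j), (l, j)}" using kl by (auto simp: S_def)
              then show ?thesis using 1 kl unfolding P entry_slide[OF SU' kl(2)] by auto
            next
              case 2
              then have "S = {(i, j), (i, k)}" using kl by (auto simp: S_def)
              then show ?thesis using 2 kl unfolding P entry_slide[OF SU' kl(2)] by auto
            next
              case 3
              then have "S = {(i, j)}" by (auto simp: S_def)
              moreover have "i = k \<Longrightarrow> entry (paths (state m) ?r) l j = 0"
                using 3 by (intro strict_upperD[OF SU']) auto
              moreover have "j = l \<Longrightarrow> entry (paths (state m) ?r) i k = 0"
                using 3 by (intro strict_upperD[OF SU']) auto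
              ultimately show ?thesis unfolding P entry_slide[OF SU' kl(2)] by auto
            qed
          qed
        qed (use kl in \<open>auto simp: Slide S_def\<close>)
      qed
    qed
  qed
qed

lemma right_cusp_paths:
  assumes "b \<in> right_cusps \<gamma>" "m \<le> Suc n"
  shows "paths (state m) (gen_index \<gamma> b) = 0"
  using assms(2)
proof (induction m)
  case 0
  then show ?case by (simp add: state_0 start_def)
next
  case (Suc m)
  then have m: "m \<le> n" and IH: "paths (state m) (gen_index \<gamma> b) = 0" by auto
  show ?case
  proof (cases "ev m")
    case (Crossing k)
    obtain a where a: "a \<in> crossings \<gamma>" "fst a \<in> strip C m" using strip_QL(1)[OF m Crossing] by blast
    have "ngen (state m) = gen_index \<gamma> a"
      using gen_index_eq[OF _ a(2) m] a(1) by (simp add: QL_def)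
    moreover have "gen_index \<gamma> a \<noteq> gen_index \<gamma> b"
    proof
      assume "gen_index \<gamma> a = gen_index \<gamma> b"
      then have "a = b" using gen_index_inj a(1) assms(1) by (simp add: QL_def)
      then show False using plat_order(2)[OF a(1) assms(1)] by simp
    qed
    ultimately show ?thesis using IH m by (simp add: state_Suc Crossing)
  next
    case (RightCusp k)
    then show ?thesis using IH m by (auto simp: state_Suc intro: bmat_eqI)
  qed (use IH m in \<open>simp_all add: state_Suc\<close>)
qed

lemma lin_state:
  assumes a: "a \<in> QL \<gamma>" "fst a \<in> strip C l" "l \<le> n"
  shows "l < m \<Longrightarrow> m \<le> Suc n \<Longrightarrow> gen_index \<gamma> a < ngen (state m) \<and>
    lin (state m) (gen_index \<gamma> a) = (\<lambda>r. entry (paths (state l) r) (position \<gamma> a) (Suc (position \<gamma> a)))"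
proof (induction m)
  case (Suc m)
  obtain l' where l': "l' \<le> n" "fst a \<in> strip C l'"
    "ev l' = Crossing (position \<gamma> a) \<or> ev l' = RightCusp (position \<gamma> a)"
    using QL_strip[OF a(1)] by metis
  then have ev: "ev l = Crossing (position \<gamma> a) \<or> ev l = RightCusp (position \<gamma> a)"
    using strip_unique[OF l'(1) a(3) l'(2) a(2)] by simp
  show ?case
  proof (cases "m = l")
    case True
    then show ?thesis using ev gen_index_eq[OF a] a(3) by (auto simp: state_Suc)
  next
    case False
    then have "gen_index \<gamma> a < ngen (state m)"
      "lin (state m) (gen_index \<gamma> a) = (\<lambda>r. entry (paths (state l) r) (position \<gamma> a) (Suc (position \<gamma> a)))"
      using Suc by auto
    then show ?thesis using Suc.prems by (cases "ev m") (auto simp: state_Suc)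
  qed
qed simp

text \<open>The degrees recorded in \<^const>\<open>counted\<close> show that chord paths from \<open>a\<close> to \<open>b\<close> exist only
  if \<open>b\<close> has degree one less than \<open>a\<close>.  Hence each coefficient is the plain count.\<close>

lemma d1_coef_eq:
  assumes a: "a \<in> QL \<gamma>" and b: "b \<in> QL \<gamma>"
  shows "d1_coef \<gamma> \<mu> C a b = lin (run (marked_front \<gamma> C) start) (gen_index \<gamma> a) (gen_index \<gamma> b)"
proof -
  obtain l where l: "1 \<le> l" "l \<le> n" "fst a \<in> strip C l"
    "a \<in> crossings \<gamma> \<and> ev l = Crossing (position \<gamma> a) \<or>
     a \<in> right_cusps \<gamma> \<and> ev l = RightCusp (position \<gamma> a)"
    using QL_strip[OF a] by metis
  let ?k = "position \<gamma> a"
  have lin: "lin (run (marked_front \<gamma> C) start) (gen_index \<gamma> a) (gen_index \<gamma> b) =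
      entry (paths (state l) (gen_index \<gamma> b)) ?k (Suc ?k)"
    using lin_state[OF a l(3,2), of "Suc n"] l(2) by (simp add: state_final)
  show ?thesis
  proof (cases "b \<in> crossings \<gamma>")
    case False
    then have "b \<in> right_cusps \<gamma>" using b by (simp add: QL_def)
    then show ?thesis using right_cusp_paths[of b l] l(2) False lin by (simp add: d1_coef_def)
  next
    case True
    have k: "1 \<le> ?k" by (simp add: position_def)
    have chord: "(l, ?k, Suc ?k) \<in> mcs_chords \<gamma> C" and deg: "pot l ?k - pot l (Suc ?k) = Q_degree \<gamma> \<mu> a"
    proof -
      consider "a \<in> crossings \<gamma>" | "a \<in> right_cusps \<gamma>" "ev l = RightCusp ?k" using l(4) by blast
      then have "Suc ?k \<le> N l \<and> pot l ?k - pot l (Suc ?k) = Q_degree \<gamma> \<mu> a"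
      proof cases
        case 1
        then show ?thesis using crossing_at_line[OF 1 l(3,1,2)] by simp
      next
        case 2
        note one = dcoef_event(2)[OF l(1,2) 2(2)]
        show ?thesis
          using supportedD[OF supported_dcoef[OF l(1,2)] one]
            chain_complex_stranded(1)[OF chain_complex_line[OF l(1,2)] supported_dcoef[OF l(1,2)] one] 2(1)
          by (simp add: Q_degree_def)
      qed
      then show "(l, ?k, Suc ?k) \<in> mcs_chords \<gamma> C" "pot l ?k - pot l (Suc ?k) = Q_degree \<gamma> \<mu> a"
        using l(1,2) k by (auto simp: chord_iff)
    qed
    have cnt: "counted b l ?k (Suc ?k)" by (rule counted_chord[OF True chord])
    have cp: "chord_paths \<gamma> C a b = paths_from b (l, ?k, Suc ?k)" by (rule chord_paths_eq[OF l(2,3)])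
    show ?thesis
    proof (cases "Q_degree \<gamma> \<mu> b = Q_degree \<gamma> \<mu> a - 1")
      case eq: True
      then show ?thesis using cnt True lin by (simp add: d1_coef_def cp counted_def)
    next
      case False
      then have "paths_from b (l, ?k, Suc ?k) = {}" using cnt deg by (auto simp: counted_def)
      then show ?thesis using cnt False lin by (simp add: d1_coef_def counted_def)
    qed
  qed
qed

end

section \<open>Isomorphic linearized complexes\<close>

lemma complex_iso_refl: "complex_iso K K (\<lambda>v. v)"
  by (auto simp: complex_iso_def linear_on_chains_def bij_betw_def)

lemma complex_iso_trans:
  assumes f: "complex_iso K K' f" and g: "complex_iso K' K'' g"
  shows "complex_iso K K'' (g \<circ> f)"
  unfolding complex_iso_def
proof (intro conjI)
  have ch: "f v \<in> chains K'" if "v \<in> chains K" for v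
    using f that unfolding complex_iso_def bij_betw_def by blast
  show "linear_on_chains K (g \<circ> f)"
    using f g ch unfolding complex_iso_def linear_on_chains_def by simp
  show "bij_betw (g \<circ> f) (chains K) (chains K'')"
    using f g unfolding complex_iso_def by (blast intro: bij_betw_trans)
  show "\<forall>d v. homogeneous K d v \<longrightarrow> homogeneous K'' d ((g \<circ> f) v)"
    using f g unfolding complex_iso_def by simp
  show "\<forall>v\<in>chains K. (g \<circ> f) (bd K v) = bd K'' ((g \<circ> f) v)"
    using f g ch unfolding complex_iso_def by simp
qed

lemma finite_chains: "finite (basis K) \<Longrightarrow> finite (chains K)"
proof -
  assume fin: "finite (basis K)"
  have "chains K \<subseteq> {f. \<forall>x. (x \<in> basis K \<longrightarrow> f x \<in> {0, 1 :: bit}) \<and> (x \<notin> basis K \<longrightarrow> f x = 0)}"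
  proof
    fix v assume v: "v \<in> chains K"
    have "v x \<in> {0, 1}" for x by (cases "v x") auto
    moreover have "v x = 0" if "x \<notin> basis K" for x
      using v that unfolding chains_def by blast
    ultimately show "v \<in> {f. \<forall>x. (x \<in> basis K \<longrightarrow> f x \<in> {0, 1}) \<and> (x \<notin> basis K \<longrightarrow> f x = 0)}" by simp
  qed
  then show ?thesis
    by (rule finite_subset) (intro finite_set_of_finite_funs fin, simp)
qed

lemma linear_ext_add:
  "linear_ext B \<phi> (\<lambda>a. c * v a + w a) = (\<lambda>b. c * linear_ext B \<phi> v b + linear_ext B \<phi> w b)"
  by (rule ext) (simp add: linear_ext_def distrib_right sum.distrib sum_distrib_left mult.assoc)

text \<open>Both differentials are homogeneous, so the part of degree 0 of the chain map \<open>F\<close> is a chain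
  map.  It is still unitriangular, hence injective: the last generator in a nonzero vector keeps
  its coefficient.  Surjectivity follows since the space is finite.\<close>

lemma isomorphic_if_intertwined:
  fixes Q :: "'a set" and deg :: "'a \<Rightarrow> int" and idx :: "'a \<Rightarrow> nat"
  assumes Q: "finite Q" "bij_betw idx Q {..<n}"
    and \<delta>: "\<And>a b. a \<in> Q \<Longrightarrow> b \<in> Q \<Longrightarrow> \<delta> a b = d (idx a) (idx b)"
      "\<And>a b. \<delta> a b \<noteq> 0 \<Longrightarrow> b \<in> Q \<and> deg b = deg a - 1"
    and \<delta>': "\<And>a b. a \<in> Q \<Longrightarrow> b \<in> Q \<Longrightarrow> \<delta>' a b = d' (idx a) (idx b)"
      "\<And>a b. \<delta>' a b \<noteq> 0 \<Longrightarrow> b \<in> Q \<and> deg b = deg a - 1"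
    and F: "unitriangular n F" "intertwines n d d' F"
  shows "isomorphic_complexes \<lparr>basis = Q, degr = deg, bd = linear_ext Q \<delta>\<rparr>
    \<lparr>basis = Q, degr = deg, bd = linear_ext Q \<delta>'\<rparr>" (is "isomorphic_complexes ?K ?K'")
proof -
  define \<phi> where "\<phi> = (\<lambda>a b. if a \<in> Q \<and> b \<in> Q \<and> deg a = deg b then F (idx a) (idx b) else 0)"
  define f where "f = linear_ext Q \<phi>"
  have f_apply: "f v b = (\<Sum>a\<in>Q. v a * \<phi> a b)" for v b by (simp add: f_def linear_ext_def)
  have idx: "idx a < n" if "a \<in> Q" for a using Q(2) that by (auto simp: bij_betw_def)
  have idx_inj: "a = b" if "a \<in> Q" "b \<in> Q" "idx a = idx b" for a b
    using Q(2) that by (auto simp: bij_betw_def inj_on_def)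
  have chains: "f v \<in> chains ?K'" for v
    by (auto simp: chains_def f_apply \<phi>_def intro: ccontr)
  have lin: "f (\<lambda>a. c * v a + w a) = (\<lambda>b. c * f v b + f w b)" for c v w
    unfolding f_def by (rule linear_ext_add)
  have kernel: "u = (\<lambda>a. 0)" if u: "u \<in> chains ?K" and fu: "f u = (\<lambda>b. 0)" for u
  proof (rule ccontr)
    assume "u \<noteq> (\<lambda>a. 0)"
    define A where "A = {a \<in> Q. u a = 1}"
    have "A \<noteq> {}"
    proof
      assume "A = {}"
      then have "u a = 0" for a using u by (cases "a \<in> Q") (auto simp: A_def chains_def)
      then show False using \<open>u \<noteq> (\<lambda>a. 0)\<close> by auto
    qed
    moreover have "finite A" using Q(1) by (simp add: A_def)
    ultimately have fin: "finite (idx ` A)" and "Max (idx ` A) \<in> idx ` A" by simp_all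
    then obtain a where a: "a \<in> A" "idx a = Max (idx ` A)" by (metis imageE)
    then have max: "idx c \<le> idx a" if "c \<in> A" for c using Max_ge[OF fin, of "idx c"] that by simp
    have "u c * \<phi> c a = (if c = a then 1 else 0)" if "c \<in> Q" for c
    proof (cases "u c = 1 \<and> c \<noteq> a")
      case True
      then have "idx c \<le> idx a" "idx c \<noteq> idx a"
        using max[of c] idx_inj[OF that, of a] a(1) that by (auto simp: A_def)
      then have "F (idx c) (idx a) = 0" using F(1) idx[OF that] by (simp add: unitriangular_def)
      then show ?thesis using True by (simp add: \<phi>_def)
    next
      case False
      then show ?thesis using a(1) F(1) idx by (auto simp: A_def \<phi>_def unitriangular_def)
    qed
    then have "f u a = (\<Sum>c\<in>Q. if c = a then 1 else 0)" by (simp add: f_apply)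
    also have "\<dots> = 1" using a(1) Q(1) by (simp add: A_def)
    finally show False using fu by simp
  qed
  have inj: "inj_on f (chains ?K)"
  proof (rule inj_onI)
    fix v w assume vw: "v \<in> chains ?K" "w \<in> chains ?K" "f v = f w"
    have "(\<lambda>a. 1 * v a + w a) = (\<lambda>a. 0)"
    proof (rule kernel)
      have "v a = 0 \<and> w a = 0" if "a \<notin> Q" for a
        using vw(1,2) that unfolding chains_def by auto
      then show "(\<lambda>a. 1 * v a + w a) \<in> chains ?K" unfolding chains_def by fastforce
      show "f (\<lambda>a. 1 * v a + w a) = (\<lambda>b. 0)" unfolding lin using vw(3) by simp
    qed
    then show "v = w" by (metis bit_sum_zero_iff ext mult_1)
  qed
  have "f ` chains ?K = chains ?K"
    by (rule endo_inj_surj[OF finite_chains _ inj]) (use Q(1) chains in \<open>auto simp: chains_def\<close>)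
  then have bij: "bij_betw f (chains ?K) (chains ?K')"
    using inj by (simp add: bij_betw_def chains_def)
  have hom: "homogeneous ?K' e (f v)" if "homogeneous ?K e v" for e v
  proof -
    have "deg b = e" if fb: "f v b = 1" for b
    proof -
      obtain a where "a \<in> Q" "v a * \<phi> a b = 1"
        using fb unfolding f_apply by (rule sum_bit_nonzeroE)
      then have "v a \<noteq> 0" "\<phi> a b \<noteq> 0" by (metis mult_zero_left mult_zero_right zero_neq_one)+
      then show ?thesis using \<open>homogeneous ?K e v\<close>
        by (auto simp: homogeneous_def \<phi>_def split: if_splits)
    qed
    then show ?thesis using chains by (simp add: homogeneous_def)
  qed
  have comm: "(\<Sum>c\<in>Q. \<delta> a c * \<phi> c b) = (\<Sum>c\<in>Q. \<phi> a c * \<delta>' c b)" if a: "a \<in> Q" for a b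
  proof (cases "b \<in> Q \<and> deg b = deg a - 1")
    case False
    have \<phi>: "c \<in> Q \<and> e \<in> Q \<and> deg c = deg e" if "\<phi> c e \<noteq> 0" for c e
      using that unfolding \<phi>_def by presburger
    have "\<delta> a c = 0 \<or> \<phi> c b = 0" for c using \<delta>(2)[of a c] \<phi>[of c b] False by fastforce
    then have 1: "\<delta> a c * \<phi> c b = 0" for c by (metis mult_zero_left mult_zero_right)
    have "\<phi> a c = 0 \<or> \<delta>' c b = 0" for c using \<delta>'(2)[of c b] \<phi>[of a c] False by fastforce
    then have 2: "\<phi> a c * \<delta>' c b = 0" for c by (metis mult_zero_left mult_zero_right)
    show ?thesis by (simp only: 1 2)
  next
    case b: True
    have "(\<Sum>c\<in>Q. \<delta> a c * \<phi> c b) = (\<Sum>c\<in>Q. d (idx a) (idx c) * F (idx c) (idx b))"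
    proof (rule sum.cong[OF refl])
      fix c assume c: "c \<in> Q"
      show "\<delta> a c * \<phi> c b = d (idx a) (idx c) * F (idx c) (idx b)"
      proof (cases "\<delta> a c = 0")
        case True
        then show ?thesis using \<delta>(1)[OF a c] by simp
      next
        case False
        then show ?thesis using \<delta>(2)[of a c] \<delta>(1)[OF a c] b c by (simp add: \<phi>_def)
      qed
    qed
    also have "\<dots> = (\<Sum>t<n. d (idx a) t * F t (idx b))"
      by (rule sum.reindex_bij_betw[OF Q(2)])
    also have "\<dots> = (\<Sum>t<n. F (idx a) t * d' t (idx b))"
      using F(2) idx[OF a] by (simp add: intertwines_def)
    also have "\<dots> = (\<Sum>c\<in>Q. F (idx a) (idx c) * d' (idx c) (idx b))"
      by (rule sum.reindex_bij_betw[OF Q(2), symmetric])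
    also have "\<dots> = (\<Sum>c\<in>Q. \<phi> a c * \<delta>' c b)"
    proof (rule sum.cong[OF refl])
      fix c assume c: "c \<in> Q"
      show "F (idx a) (idx c) * d' (idx c) (idx b) = \<phi> a c * \<delta>' c b"
      proof (cases "\<delta>' c b = 0")
        case True
        then show ?thesis using \<delta>'(1)[OF c] b by simp
      next
        case False
        then show ?thesis using \<delta>'(2)[of c b] \<delta>'(1)[OF c] a b c by (simp add: \<phi>_def)
      qed
    qed
    finally show ?thesis .
  qed
  have "f (linear_ext Q \<delta> v) = linear_ext Q \<delta>' (f v)" for v
  proof (rule ext)
    fix b
    have "f (linear_ext Q \<delta> v) b = (\<Sum>c\<in>Q. \<Sum>a\<in>Q. v a * (\<delta> a c * \<phi> c b))"
      by (simp add: f_apply linear_ext_def sum_distrib_right mult.assoc)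
    also have "\<dots> = (\<Sum>a\<in>Q. v a * (\<Sum>c\<in>Q. \<delta> a c * \<phi> c b))"
      by (subst sum.swap) (simp add: sum_distrib_left)
    also have "\<dots> = (\<Sum>a\<in>Q. v a * (\<Sum>c\<in>Q. \<phi> a c * \<delta>' c b))"
      by (intro sum.cong refl) (simp add: comm)
    also have "\<dots> = (\<Sum>c\<in>Q. \<Sum>a\<in>Q. v a * (\<phi> a c * \<delta>' c b))"
      by (subst sum.swap) (simp add: sum_distrib_left)
    also have "\<dots> = linear_ext Q \<delta>' (f v) b"
      by (simp add: f_apply linear_ext_def sum_distrib_right mult.assoc)
    finally show "f (linear_ext Q \<delta> v) b = linear_ext Q \<delta>' (f v) b" .
  qed
  then have "complex_iso ?K ?K' f"
    using bij hom lin by (simp add: complex_iso_def linear_on_chains_def)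
  then show ?thesis by (auto simp: isomorphic_complexes_def)
qed

lemma isomorphic_if_equivalent_readings:
  assumes "mcs_front \<gamma> \<mu> C" "mcs_front \<gamma> \<mu> C'"
    and eq: "equivalent_readings (run (marked_front \<gamma> C) start) (run (marked_front \<gamma> C') start)"
  shows "isomorphic_complexes (linearized_complex \<gamma> \<mu> C) (linearized_complex \<gamma> \<mu> C')"
proof -
  interpret C: mcs_front \<gamma> \<mu> C by fact
  interpret C': mcs_front \<gamma> \<mu> C' by fact
  let ?s = "run (marked_front \<gamma> C) start" and ?s' = "run (marked_front \<gamma> C') start"
  have n: "ngen ?s = card (QL \<gamma>)" using C.ngen_final by (simp add: C.state_final)
  obtain F where F: "unitriangular (card (QL \<gamma>)) F" "intertwines (card (QL \<gamma>)) (lin ?s) (lin ?s') F"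
    using eq n unfolding equivalent_readings_def by auto
  have deg: "b \<in> QL \<gamma> \<and> Q_degree \<gamma> \<mu> b = Q_degree \<gamma> \<mu> a - 1" if "d1_coef \<gamma> \<mu> D a b \<noteq> 0" for D a b
    using that by (simp add: d1_coef_def QL_def split: if_splits)
  show ?thesis
    unfolding linearized_complex_def
    by (rule isomorphic_if_intertwined[OF C.finite_QL C.gen_index_bij _ deg _ deg F])
      (simp_all add: C.d1_coef_eq C'.d1_coef_eq)
qed

lemma good_marks_less: "good (marks ms) s \<Longrightarrow> (a, b) \<in> set ms \<Longrightarrow> a < b"
  by (induction ms arbitrary: s) (auto simp: marks_def)

lemma equivalent_readings_moves1_14:
  assumes "moves1_14 W W'" "good W start" "good W' start"
  shows "equivalent_readings (run W start) (run W' start)"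
    and "equivalent_readings (run W' start) (run W start)"
proof -
  obtain A B U U' where m: "local_move U U'" "W = A @ U @ B" "W' = A @ U' @ B"
    using assms(1) by (auto simp: moves1_14_def)
  have g: "good A start" "good U (run A start)" "good U' (run A start)"
    using assms(2,3) by (auto simp: m good_append)
  have cl: "close (run U (run A start)) (run U' (run A start))"
    by (rule close_local_move[OF m(1) reading_run[OF reading_start g(1)] g(2,3)])
  show "equivalent_readings (run W start) (run W' start)"
    unfolding m(2,3) by (rule equivalent_readings_replace) (use assms(2,3) m cl in simp_all)
  show "equivalent_readings (run W' start) (run W start)"
    unfolding m(2,3) by (rule equivalent_readings_replace) (use assms(2,3) m close_sym[OF cl] in simp_all)
qed

lemma equivalent_readings_move15:
  assumes "mcs_front \<gamma> \<mu> C" "mcs_front \<gamma> \<mu> C'" and move: "move15 \<gamma> \<mu> C C'"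
  shows "equivalent_readings (run (marked_front \<gamma> C) start) (run (marked_front \<gamma> C') start)"
    and "equivalent_readings (run (marked_front \<gamma> C') start) (run (marked_front \<gamma> C) start)"
proof -
  interpret C: mcs_front \<gamma> \<mu> C by fact
  interpret C': mcs_front \<gamma> \<mu> C' by fact
  obtain p i j us vs A B where p: "1 \<le> p" "p \<le> nlines C" and ij: "i < j"
    and us: "distinct us" "set us = {u. dcoef C p u i = 1}"
    and vs: "distinct vs" "set vs = {v. dcoef C p j v = 1}"
    and W: "marked_front \<gamma> C = A @ B" "length A = p"
    and W': "marked_front \<gamma> C' = A @ map (\<lambda>u. mark u j) us @ map (\<lambda>v. mark i v) vs @ B \<or>
         marked_front \<gamma> C' = A @ map (\<lambda>v. mark i v) vs @ map (\<lambda>u. mark u j) us @ B"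
    using move unfolding move15_def by blast
  define ms where "ms = (if marked_front \<gamma> C' = A @ map (\<lambda>u. mark u j) us @ map (\<lambda>v. mark i v) vs @ B
    then map (\<lambda>u. (u, j)) us @ map (\<lambda>v. (i, v)) vs else map (\<lambda>v. (i, v)) vs @ map (\<lambda>u. (u, j)) us)"
  have ms: "ms = map (\<lambda>u. (u, j)) us @ map (\<lambda>v. (i, v)) vs \<or> ms = map (\<lambda>v. (i, v)) vs @ map (\<lambda>u. (u, j)) us"
    by (simp add: ms_def)
  have W'': "marked_front \<gamma> C' = A @ marks ms @ B"
    using W' by (auto simp: ms_def marks_def comp_def)
  have gW: "good (A @ [] @ B) start" using C.good_marked_front W by simp
  have gW': "good (A @ marks ms @ B) start" using C'.good_marked_front W'' by simp
  let ?s = "run A start"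
  have "A = take p (marked_front \<gamma> C)" using W by simp
  then have s: "?s = C.state p" by (simp add: C.state_def)
  have R: "reading ?s" unfolding s using p by (intro C.reading_state) simp
  have D: "entry (diff ?s) = dcoef C p" unfolding s using p by (simp add: C.diff_state C.entry_dmat)
  have lt: "a < b" if "(a, b) \<in> set ms" for a b
    using good_marks_less[OF _ that] gW' by (auto simp: good_append)
  have cl: "close (run [] ?s) (run (marks ms) ?s)"
    using close_homotopy_marks[OF R ij us(1) _ vs(1) _ ms lt] us(2) vs(2) by (simp add: D)
  show "equivalent_readings (run (marked_front \<gamma> C) start) (run (marked_front \<gamma> C') start)"
    unfolding W'' using equivalent_readings_replace[OF gW gW' cl] W by simp
  show "equivalent_readings (run (marked_front \<gamma> C') start) (run (marked_front \<gamma> C) start)"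
    unfolding W'' using equivalent_readings_replace[OF gW' gW close_sym[OF cl]] W by simp
qed

lemma isomorphic_if_mcs_step:
  assumes knot: "legendrian_knot \<gamma>" "nearly_plat \<gamma>" "maslov_potential \<gamma> \<mu>"
    and step: "mcs_step \<gamma> \<mu> C C'"
  shows "isomorphic_complexes (linearized_complex \<gamma> \<mu> C) (linearized_complex \<gamma> \<mu> C')"
proof -
  have C: "mcs_front \<gamma> \<mu> C" and C': "mcs_front \<gamma> \<mu> C'"
    using knot step by (simp_all add: mcs_front_def mcs_step_def)
  note g = mcs_front.good_marked_front[OF C] mcs_front.good_marked_front[OF C']
  consider "marked_front \<gamma> C = marked_front \<gamma> C'" | "moves1_14 (marked_front \<gamma> C) (marked_front \<gamma> C')"
    | "moves1_14 (marked_front \<gamma> C') (marked_front \<gamma> C)" | "move15 \<gamma> \<mu> C C'" | "move15 \<gamma> \<mu> C' C"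
    using step unfolding mcs_step_def by blast
  then have "equivalent_readings (run (marked_front \<gamma> C) start) (run (marked_front \<gamma> C') start)"
  proof cases
    case 1
    then show ?thesis
      using close_equivalent[OF close_refl reading_run[OF reading_start g(1)]] by simp
  next
    case 2
    then show ?thesis by (rule equivalent_readings_moves1_14(1)[OF _ g])
  next
    case 3
    then show ?thesis by (rule equivalent_readings_moves1_14(2)[OF _ g(2,1)])
  next
    case 4
    then show ?thesis by (rule equivalent_readings_move15(1)[OF C C'])
  next
    case 5
    then show ?thesis by (rule equivalent_readings_move15(2)[OF C' C])
  qed
  then show ?thesis by (rule isomorphic_if_equivalent_readings[OF C C'])
qed

theorem theorem5p5:
  fixes \<gamma> :: space_curve and \<mu> :: "real \<times> real \<times> real \<Rightarrow> int" and Cplus Cminus :: mcs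
  assumes "legendrian_knot \<gamma>" and "nearly_plat \<gamma>"
    and "maslov_potential \<gamma> \<mu>"
    and "is_mcs \<gamma> \<mu> Cplus" and "is_mcs \<gamma> \<mu> Cminus"
    and "mcs_equivalent \<gamma> \<mu> Cplus Cminus"
  shows "isomorphic_complexes (linearized_complex \<gamma> \<mu> Cplus) (linearized_complex \<gamma> \<mu> Cminus)"
proof -
  have "(mcs_step \<gamma> \<mu>)\<^sup>*\<^sup>* Cplus Cminus"
    using assms(6) by (simp add: mcs_equivalent_def)
  then show ?thesis
  proof (induction rule: rtranclp_induct)
    case base
    show ?case unfolding isomorphic_complexes_def using complex_iso_refl by blast
  next
    case (step C C')
    then show ?case
      using isomorphic_if_mcs_step[OF assms(1-3) step(2)] complex_iso_trans
      unfolding isomorphic_complexes_def by blast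
  qed
qed

end
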